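(* The mapping $\phi\mapsto \phi(N)$ constitutes a $*$-homomorphism from $\mathcal F_{N}$ (with pointwise operations and involution $\phi\mapsto\phi^\#$) into $\{N,N^*\}'' \ (\subseteq B(\mathcal K))$ with $s_N(N) = s(A,B)$ for all $s\in \mathbb C[z,w]$.
   Context: Setting. For bounded linear operators between Krein or Hilbert spaces, ${}^*$ denotes the adjoint with respect to the given inner products; $C'$ is the commutant of an operator $C$ in the algebra of bounded operators and $\{N,N^*\}''$ is the bicommutant of $\{N,N^*\}$ in $B(\mathcal K)$. A bounded linear operator $N$ on a Krein space $(\mathcal K,[.,.])$ is normal if $NN^*=N^*N$; put $A:=\frac{N+N^*}{2}$, $B:=\frac{N-N^*}{2i}$. A normal $N$ is definitizable if there are nonzero real polynomials $p,q\in\mathbb R[z]$ with $[p(A)x,x]\ge 0$ and $[q(B)x,x]\ge 0$ for all $x\in\mathcal K$. Fix a bounded normal definitizable $N$ and such $p,q$. Let $\mathcal V_1,\mathcal V_2,\mathcal V$ be Hilbert spaces and $T_1:\mathcal V_1\to\mathcal K$, $T_2:\mathcal V_2\to\mathcal K$, $T:\mathcal V\to\mathcal K$ bounded linear injective maps with $T_1T_1^*=p(A)$, $T_2T_2^*=q(B)$, $TT^*=p(A)+q(B)$ (these exist: e.g. $\mathcal V$ is the completion of $\mathcal K/\ker(p(A)+q(B))$ with respect to $[(p(A)+q(B)).,.]$ and $T$ is the adjoint of the canonical map $\mathcal K\to\mathcal V$; similarly for $T_1,T_2$ with $p(A)$, $q(B)$). Let $R_j:\mathcal V_j\to\mathcal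 V$ ($j=1,2$) be the injective contractions with $T_j=TR_j$; they satisfy $R_1R_1^*+R_2R_2^*=I$. For $C\in(TT^* )'$ let $\Theta(C)=T^{-1}CT$, i.e. the bounded operator on $\mathcal V$ determined by $T\Theta(C)=CT$; $\Theta:(TT^* )'\to(T^*T)'$ is a unital $*$-homomorphism. Let $\Xi:(T^*T)'\to(TT^* )'$, $\Xi(D)=TDT^*$. Then $\Theta(N)$ is a normal operator on the Hilbert space $\mathcal V$; $E$ denotes its spectral measure. Function classes. For $m,n\in\mathbb N$ (positive) let $I_{m,n}:=(\{0,\dots,m-1\}\times\{0,\dots,n-1\})\cup\{(m,0),(0,n)\}$, let $\mathcal A_{m,n}$ be the space of families $(a_{k,l})_{(k,l)\in I_{m,n}}$ of complex numbers and $\mathcal B_{m,n}$ the space of families indexed by $\{0,\dots,m-1\}\times\{0,\dots,n-1\}$, with componentwise addition, scalar multiplication and conjugation $\overline a=(\bar a_{k,l})$, and with multiplication $(a\cdot b)_{k,l}=\sum_{c=0}^k\sum_{d=0}^l a_{c,d}b_{k-c,l-d}$. They are commutative unital $*$-algebras. $\pi:\mathcal A_{m,n}\to\mathcal B_{m,n}$ drops the entries with indices $(m,0),(0,n)$; on $\mathcal B_{m,n}$, $\pi$ is the identity. Let $\mathfrak d_p(z)$, $\mathfrak d_q(z)$ be the multiplicity of $z\in\mathbb C$ as a zero of $p$, $q$; $Z^{\mathbb R}_p:=p^{-1}\{0\}\cap\mathbb R$, $Z^{\mathbb R}_q:=q^{-1}\{0\}\cap\mathbb R$, $Z^{\mathbb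 R}_p+iZ^{\mathbb R}_q:=\{x+iy: x\in Z^{\mathbb R}_p,y\in Z^{\mathbb R}_q\}$, $Z^i:=(p^{-1}\{0\}\times q^{-1}\{0\})\setminus(\mathbb R\times\mathbb R)\subseteq\mathbb C^2$. Put $\mathfrak C(z):=\mathbb C$ for $z\in\sigma(\Theta(N))\setminus(Z^{\mathbb R}_p+iZ^{\mathbb R}_q)$, $\mathfrak C(z):=\mathcal A_{\mathfrak d_p(\operatorname{Re}z),\mathfrak d_q(\operatorname{Im}z)}$ for $z\in Z^{\mathbb R}_p+iZ^{\mathbb R}_q$, $\mathfrak C(\xi,\eta):=\mathcal B_{\mathfrak d_p(\xi),\mathfrak d_q(\eta)}$ for $(\xi,\eta)\in Z^i$. $\mathcal M_N$ is the set of functions $\phi$ on $\big(\sigma(\Theta(N))\cup(Z^{\mathbb R}_p+iZ^{\mathbb R}_q)\big)\,\dot\cup\, Z^i$ with $\phi(z)\in\mathfrak C(z)$, with pointwise algebra operations and the involution $\phi^\#(z)=\overline{\phi(z)}$ for $z\in\sigma(\Theta(N))\cup(Z^{\mathbb R}_p+iZ^{\mathbb R}_q)$, $\phi^\#(\xi,\eta)=\overline{\phi(\bar\xi,\bar\eta)}$ for $(\xi,\eta)\in Z^i$. $\mathcal R$ is the set of $\phi\in\mathcal M_N$ with $\pi(\phi(z))=0$ for all $z\in(Z^{\mathbb R}_p+iZ^{\mathbb R}_q)\,\dot\cup\, Z^i$. $\mathcal F_N$ is the set of $\phi\in\mathcal M_N$ that are Borel measurable and bounded on $\sigma(\Theta(N))\setminus(Z^{\mathbb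 R}_p+iZ^{\mathbb R}_q)$ and such that for each $w\in\sigma(\Theta(N))\cap(Z^{\mathbb R}_p+iZ^{\mathbb R}_q)$ the quotient $$\frac{\phi(z)-\sum_{k=0}^{\mathfrak d_p(\operatorname{Re}w)-1}\sum_{l=0}^{\mathfrak d_q(\operatorname{Im}w)-1}\phi(w)_{k,l}\operatorname{Re}(z-w)^k\operatorname{Im}(z-w)^l}{\max(|\operatorname{Re}(z-w)|^{\mathfrak d_p(\operatorname{Re}w)},|\operatorname{Im}(z-w)|^{\mathfrak d_q(\operatorname{Im}w)})}$$ is bounded for $z\in\sigma(\Theta(N))\cap U(w)\setminus\{w\}$, where $U(w)$ is a sufficiently small neighbourhood of $w$. A polynomial $s\in\mathbb C[z,w]$ gives $s_N\in\mathcal F_N$: $s_N(z)=s(\operatorname{Re}z,\operatorname{Im}z)$ for $z\in\sigma(\Theta(N))\setminus(Z^{\mathbb R}_p+iZ^{\mathbb R}_q)$; $s_N(z)_{k,l}=\frac1{k!l!}\frac{\partial^{k+l}s}{\partial x^k\partial y^l}(\operatorname{Re}z,\operatorname{Im}z)$, $(k,l)\in I_{\mathfrak d_p(\operatorname{Re}z),\mathfrak d_q(\operatorname{Im}z)}$, for $z\in Z^{\mathbb R}_p+iZ^{\mathbb R}_q$; $s_N(\xi,\eta)_{k,l}=\frac1{k!l!}\frac{\partial^{k+l}s}{\partial z^k\partial w^l}(\xi,\eta)$, $0\le k<\mathfrak d_p(\xi)$, $0\le l<\mathfrak d_q(\eta)$, for $(\xi,\eta)\in Z^i$. $p_N$ and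 $q_N$ are obtained from $p(z)$ and $q(w)$ regarded as elements of $\mathbb C[z,w]$. Definition of $\phi(N)$. $(s,g)$ is an admissible decomposition of $\phi\in\mathcal F_N$ if $s\in\mathbb C[z,w]$, $g$ is a function on $\sigma(\Theta(N))$ with values in $\mathbb C$ on $\sigma(\Theta(N))\setminus(Z^{\mathbb R}_p+iZ^{\mathbb R}_q)$, where it is bounded and measurable, and values $g(z)=(g(z)_1,g(z)_2)\in\mathbb C^2$ on $\sigma(\Theta(N))\cap(Z^{\mathbb R}_p+iZ^{\mathbb R}_q)$, $\phi-s_N\in\mathcal R$, and $\phi(z)=s_N(z)+(p_N+q_N)(z)\cdot g(z)$ for all $z\in\sigma(\Theta(N))$. Here $(p_N+q_N)(z)\cdot g(z)$ is the usual product $(p(\operatorname{Re}z)+q(\operatorname{Im}z))g(z)$ for $z\in\sigma(\Theta(N))\setminus(Z^{\mathbb R}_p+iZ^{\mathbb R}_q)$, and for $z\in\sigma(\Theta(N))\cap(Z^{\mathbb R}_p+iZ^{\mathbb R}_q)$ it is the element of $\mathfrak C(z)$ whose entries with $0\le k<\mathfrak d_p(\operatorname{Re}z)$, $0\le l<\mathfrak d_q(\operatorname{Im}z)$ are $0$, whose $(\mathfrak d_p(\operatorname{Re}z),0)$ entry is $(p_N+q_N)(z)_{\mathfrak d_p(\operatorname{Re}z),0}\,g(z)_1$ and whose $(0,\mathfrak d_q(\operatorname{Im}z))$ entry is $(p_N+q_N)(z)_{0,\mathfrak d_q(\operatorname{Im}z)}\,g(z)_2$. Every $\phi\in\mathcal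 F_N$ has an admissible decomposition, and $$\phi(N):=s(A,B)+\Xi\Big(\int^{R_1,R_2}_{\sigma(\Theta(N))}g\,dE\Big),$$ $$\int^{R_1,R_2}_{\sigma(\Theta(N))} g\,dE:=\int_{\sigma(\Theta(N))\setminus(Z^{\mathbb R}_p+iZ^{\mathbb R}_q)}g\,dE+\sum_{w\in\sigma(\Theta(N))\cap(Z^{\mathbb R}_p+iZ^{\mathbb R}_q)}\big(g(w)_1R_1R_1^*E\{w\}+g(w)_2R_2R_2^*E\{w\}\big),$$ which does not depend on the chosen admissible decomposition $(s,g)$. *)

theory Defs
  imports "HOL-Analysis.Analysis" "HOL-Computational_Algebra.Polynomial"
begin

section \<open>Krein and Hilbert spaces\<close>

class complex_vector = real_vector +
  fixes scaleC :: "complex \<Rightarrow> 'a \<Rightarrow> 'a"  (infixr "*\<^sub>C" 75)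
  assumes scaleC_add_right: "a *\<^sub>C (x + y) = a *\<^sub>C x + a *\<^sub>C y"
    and scaleC_add_left: "(a + b) *\<^sub>C x = a *\<^sub>C x + b *\<^sub>C x"
    and scaleC_scaleC: "a *\<^sub>C b *\<^sub>C x = (a * b) *\<^sub>C x"
    and scaleC_one: "1 *\<^sub>C x = x"
    and scaleR_scaleC: "r *\<^sub>R x = complex_of_real r *\<^sub>C x"
begin

definition csubspace :: "'a set \<Rightarrow> bool" where
  "csubspace S \<longleftrightarrow> 0 \<in> S \<and> (\<forall>x\<in>S. \<forall>y\<in>S. x + y \<in> S) \<and> (\<forall>c. \<forall>x\<in>S. c *\<^sub>C x \<in> S)"

end

text \<open>Inner products are linear in the first argument and may be indefinite.\<close>

class hermitian_space = complex_vector +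
  fixes cinner :: "'a \<Rightarrow> 'a \<Rightarrow> complex"
  assumes cinner_add_left: "cinner (x + y) z = cinner x z + cinner y z"
    and cinner_scaleC_left: "cinner (a *\<^sub>C x) z = a * cinner x z"
    and cinner_commute: "cinner y x = cnj (cinner x y)"
begin

definition orthogonal_decomposition :: "'a set \<Rightarrow> 'a set \<Rightarrow> bool" where
  "orthogonal_decomposition P M \<longleftrightarrow>
     csubspace P \<and> csubspace M \<and>
     (\<forall>z. \<exists>x\<in>P. \<exists>y\<in>M. z = x + y) \<and>
     (\<forall>x\<in>P. \<forall>y\<in>M. cinner x y = 0) \<and>
     (\<forall>x\<in>P. x \<noteq> 0 \<longrightarrow> 0 < Re (cinner x x)) \<and>
     (\<forall>y\<in>M. y \<noteq> 0 \<longrightarrow> Re (cinner y y) < 0)"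

end

text \<open>
  A Krein space is the orthogonal direct sum of a Hilbert space \<open>P\<close> and an anti-Hilbert
  space \<open>M\<close>.  The norm carried by the type is the one belonging to some such decomposition, so
  that completeness of the type is completeness of \<open>P\<close> and \<open>M\<close>.  Any two such norms are
  equivalent, hence boundedness of operators does not depend on the choice.
\<close>

class krein_space = hermitian_space + banach +
  assumes fundamental_decomposition:
    "\<exists>P M. orthogonal_decomposition P M \<and>
       (\<forall>x\<in>P. \<forall>y\<in>M. (norm (x + y))\<^sup>2 = Re (cinner x x) - Re (cinner y y))"

class chilbert_space = hermitian_space + banach +
  assumes cinner_norm: "cinner x x = complex_of_real ((norm x)\<^sup>2)"

instance chilbert_space \<subseteq> krein_space
proof
  have sc: "c *\<^sub>C (0::'a) = 0" for c
    using scaleC_add_right[of c 0 "0::'a"] by simp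
  have z: "cinner x (0::'a) = 0" for x
    using cinner_add_left[of 0 0 x] cinner_commute[of x 0] by simp
  have "orthogonal_decomposition (UNIV :: 'a set) {0}"
    unfolding orthogonal_decomposition_def
    by (auto simp: csubspace_def cinner_norm z sc)
  then show "\<exists>P M. orthogonal_decomposition P (M :: 'a set) \<and>
     (\<forall>x\<in>P. \<forall>y\<in>M. (norm (x + y))\<^sup>2 = Re (cinner x x) - Re (cinner y y))"
    by (intro exI[of _ UNIV] exI[of _ "{0}"]) (auto simp: cinner_norm z)
qed

section \<open>Bounded operators\<close>

definition bounded_clinear ::
    "('a::{complex_vector,real_normed_vector} \<Rightarrow> 'b::{complex_vector,real_normed_vector}) \<Rightarrow> bool" where
  "bounded_clinear f \<longleftrightarrow> bounded_linear f \<and> (\<forall>c x. f (c *\<^sub>C x) = c *\<^sub>C f x)"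

definition adj :: "('a::hermitian_space \<Rightarrow> 'b::hermitian_space) \<Rightarrow> 'b \<Rightarrow> 'a" where
  "adj f = (THE g. \<forall>x y. cinner (f x) y = cinner x (g y))"

definition normal_op :: "('a::hermitian_space \<Rightarrow> 'a) \<Rightarrow> bool" where
  "normal_op N \<longleftrightarrow> N \<circ> adj N = adj N \<circ> N"

definition re_part :: "('a::hermitian_space \<Rightarrow> 'a) \<Rightarrow> 'a \<Rightarrow> 'a" where
  "re_part N x = (1 / 2) *\<^sub>C (N x + adj N x)"

definition im_part :: "('a::hermitian_space \<Rightarrow> 'a) \<Rightarrow> 'a \<Rightarrow> 'a" where
  "im_part N x = (1 / (2 * \<i>)) *\<^sub>C (N x - adj N x)"

definition commutant ::
    "('a::{complex_vector,real_normed_vector} \<Rightarrow> 'a) set \<Rightarrow> ('a \<Rightarrow> 'a) set" where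
  "commutant S = {D. bounded_clinear D \<and> (\<forall>C\<in>S. C \<circ> D = D \<circ> C)}"

definition spectrum :: "('a::{complex_vector,real_normed_vector} \<Rightarrow> 'a) \<Rightarrow> complex set" where
  "spectrum D = {z. \<not> (\<exists>S. bounded_clinear S \<and>
     S \<circ> (\<lambda>x. D x - z *\<^sub>C x) = id \<and> (\<lambda>x. D x - z *\<^sub>C x) \<circ> S = id)}"

definition op_poly :: "real poly \<Rightarrow> ('a::real_vector \<Rightarrow> 'a) \<Rightarrow> 'a \<Rightarrow> 'a" where
  "op_poly p C x = (\<Sum>k\<le>degree p. coeff p k *\<^sub>R (C ^^ k) x)"

text \<open>
  An element of \<open>\<complex>[z,w]\<close> is a polynomial in \<open>w\<close> with coefficients in \<open>\<complex>[z]\<close>: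
  the coefficient of \<open>z^k w^l\<close> in \<open>s\<close> is \<open>coeff (coeff s l) k\<close>.
\<close>

definition op_poly2 ::
    "complex poly poly \<Rightarrow> ('a::complex_vector \<Rightarrow> 'a) \<Rightarrow> ('a \<Rightarrow> 'a) \<Rightarrow> 'a \<Rightarrow> 'a" where
  "op_poly2 s A B x =
     (\<Sum>l\<le>degree s. \<Sum>k\<le>degree (coeff s l). coeff (coeff s l) k *\<^sub>C (A ^^ k) ((B ^^ l) x))"

definition definitizing ::
    "('a::hermitian_space \<Rightarrow> 'a) \<Rightarrow> real poly \<Rightarrow> real poly \<Rightarrow> bool" where
  "definitizing N p q \<longleftrightarrow> p \<noteq> 0 \<and> q \<noteq> 0 \<and>
     (\<forall>x. cinner (op_poly p (re_part N) x) x \<in> \<real>\<^sub>\<ge>\<^sub>0) \<and>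
     (\<forall>x. cinner (op_poly q (im_part N) x) x \<in> \<real>\<^sub>\<ge>\<^sub>0)"

definition Theta ::
    "('v::{complex_vector,real_normed_vector} \<Rightarrow> 'k) \<Rightarrow> ('k \<Rightarrow> 'k) \<Rightarrow> 'v \<Rightarrow> 'v" where
  "Theta T C = (THE D. bounded_clinear D \<and> T \<circ> D = C \<circ> T)"

definition Xi ::
    "('v::hermitian_space \<Rightarrow> 'k::hermitian_space) \<Rightarrow> ('v \<Rightarrow> 'v) \<Rightarrow> 'k \<Rightarrow> 'k" where
  "Xi T D = T \<circ> D \<circ> adj T"

section \<open>Spectral measures\<close>

definition projection_valued_measure ::
    "(complex set \<Rightarrow> 'v::chilbert_space \<Rightarrow> 'v) \<Rightarrow> bool" where
  "projection_valued_measure E \<longleftrightarrow>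
     (\<forall>\<Delta>\<in>sets borel. bounded_clinear (E \<Delta>) \<and> adj (E \<Delta>) = E \<Delta> \<and> E \<Delta> \<circ> E \<Delta> = E \<Delta>) \<and>
     E UNIV = id \<and>
     (\<forall>\<Delta>\<in>sets borel. \<forall>\<Delta>'\<in>sets borel. E (\<Delta> \<inter> \<Delta>') = E \<Delta> \<circ> E \<Delta>') \<and>
     (\<forall>X. range X \<subseteq> sets borel \<longrightarrow> disjoint_family X \<longrightarrow>
        (\<forall>u. (\<lambda>i::nat. E (X i) u) sums E (\<Union>i. X i) u))"

definition scalar_measure ::
    "(complex set \<Rightarrow> 'v::chilbert_space \<Rightarrow> 'v) \<Rightarrow> 'v \<Rightarrow> complex measure" where
  "scalar_measure E u = measure_of UNIV (sets borel) (\<lambda>\<Delta>. ennreal (Re (cinner (E \<Delta> u) u)))"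

text \<open>By polarization, an operator is determined by its quadratic form.\<close>

definition has_spectral_integral ::
    "(complex set \<Rightarrow> 'v::chilbert_space \<Rightarrow> 'v) \<Rightarrow> complex set \<Rightarrow> (complex \<Rightarrow> complex)
      \<Rightarrow> ('v \<Rightarrow> 'v) \<Rightarrow> bool" where
  "has_spectral_integral E S g X \<longleftrightarrow> bounded_clinear X \<and>
     (\<forall>u. cinner (X u) u = set_lebesgue_integral (scalar_measure E u) S g)"

definition spectral_integral ::
    "(complex set \<Rightarrow> 'v::chilbert_space \<Rightarrow> 'v) \<Rightarrow> complex set \<Rightarrow> (complex \<Rightarrow> complex)
      \<Rightarrow> 'v \<Rightarrow> 'v" where
  "spectral_integral E S g = (THE X. has_spectral_integral E S g X)"

definition spectral_measure_of ::
    "('v::chilbert_space \<Rightarrow> 'v) \<Rightarrow> (complex set \<Rightarrow> 'v \<Rightarrow> 'v) \<Rightarrow> bool" where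
  "spectral_measure_of Z E \<longleftrightarrow> projection_valued_measure E \<and>
     E (spectrum Z) = id \<and> has_spectral_integral E (spectrum Z) (\<lambda>z. z) Z"

section \<open>Function classes\<close>

definition zero_mult :: "real poly \<Rightarrow> complex \<Rightarrow> nat" where
  "zero_mult p z = order z (map_poly complex_of_real p)"

definition crit_real :: "real poly \<Rightarrow> real poly \<Rightarrow> complex set" where
  "crit_real p q = {z. poly p (Re z) = 0 \<and> poly q (Im z) = 0}"

definition crit_nonreal :: "real poly \<Rightarrow> real poly \<Rightarrow> (complex \<times> complex) set" where
  "crit_nonreal p q = {(\<xi>, \<eta>). poly (map_poly complex_of_real p) \<xi> = 0 \<and>
     poly (map_poly complex_of_real q) \<eta> = 0 \<and> \<not> (\<xi> \<in> \<real> \<and> \<eta> \<in> \<real>)}"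

text \<open>
  Points of the disjoint union are tagged by \<open>Inl\<close> (points of \<open>\<complex>\<close>) and \<open>Inr\<close> (points of
  \<open>\<complex>\<^sup>2\<close>).  Values in \<open>\<complex>\<close>, \<open>\<A>\<close> or \<open>\<B>\<close> are all written as families indexed by
  \<open>nat \<times> nat\<close> that vanish off the respective index set, \<open>\<complex>\<close> having index set \<open>{(0,0)}\<close>;
  functions vanish off their domain.  The set \<open>S\<close> below stands for \<open>\<sigma>(\<Theta>(N))\<close>.
\<close>

type_synonym point = "complex + complex \<times> complex"
type_synonym jet_fun = "point \<Rightarrow> nat \<Rightarrow> nat \<Rightarrow> complex"

definition dom_pts :: "real poly \<Rightarrow> real poly \<Rightarrow> complex set \<Rightarrow> point set" where
  "dom_pts p q S = Inl ` (S \<union> crit_real p q) \<union> Inr ` crit_nonreal p q"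

definition idx_B :: "nat \<Rightarrow> nat \<Rightarrow> (nat \<times> nat) set" where
  "idx_B m n = {..<m} \<times> {..<n}"

definition idx_A :: "nat \<Rightarrow> nat \<Rightarrow> (nat \<times> nat) set" where
  "idx_A m n = idx_B m n \<union> {(m, 0), (0, n)}"

definition idx :: "real poly \<Rightarrow> real poly \<Rightarrow> point \<Rightarrow> (nat \<times> nat) set" where
  "idx p q u = (case u of
      Inl z \<Rightarrow> if z \<in> crit_real p q
        then idx_A (zero_mult p (of_real (Re z))) (zero_mult q (of_real (Im z))) else {(0, 0)}
    | Inr (\<xi>, \<eta>) \<Rightarrow> idx_B (zero_mult p \<xi>) (zero_mult q \<eta>))"

definition M_class :: "real poly \<Rightarrow> real poly \<Rightarrow> complex set \<Rightarrow> jet_fun set" where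
  "M_class p q S = {\<phi>. \<forall>u k l. \<not> (u \<in> dom_pts p q S \<and> (k, l) \<in> idx p q u) \<longrightarrow> \<phi> u k l = 0}"

definition fadd :: "jet_fun \<Rightarrow> jet_fun \<Rightarrow> jet_fun" where
  "fadd \<phi> \<psi> = (\<lambda>u k l. \<phi> u k l + \<psi> u k l)"

definition fdiff :: "jet_fun \<Rightarrow> jet_fun \<Rightarrow> jet_fun" where
  "fdiff \<phi> \<psi> = (\<lambda>u k l. \<phi> u k l - \<psi> u k l)"

definition fscale :: "complex \<Rightarrow> jet_fun \<Rightarrow> jet_fun" where
  "fscale c \<phi> = (\<lambda>u k l. c * \<phi> u k l)"

definition fmult :: "real poly \<Rightarrow> real poly \<Rightarrow> jet_fun \<Rightarrow> jet_fun \<Rightarrow> jet_fun" where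
  "fmult p q \<phi> \<psi> = (\<lambda>u k l. if (k, l) \<in> idx p q u
     then \<Sum>c\<le>k. \<Sum>d\<le>l. \<phi> u c d * \<psi> u (k - c) (l - d) else 0)"

definition fsharp :: "jet_fun \<Rightarrow> jet_fun" where
  "fsharp \<phi> = (\<lambda>u k l. case u of
      Inl z \<Rightarrow> cnj (\<phi> (Inl z) k l)
    | Inr (\<xi>, \<eta>) \<Rightarrow> cnj (\<phi> (Inr (cnj \<xi>, cnj \<eta>)) k l))"

definition R_class :: "real poly \<Rightarrow> real poly \<Rightarrow> complex set \<Rightarrow> jet_fun set" where
  "R_class p q S = {\<phi> \<in> M_class p q S.
     (\<forall>z\<in>crit_real p q. \<forall>(k, l)\<in>idx_B (zero_mult p (of_real (Re z))) (zero_mult q (of_real (Im z))).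
        \<phi> (Inl z) k l = 0) \<and>
     (\<forall>w\<in>crit_nonreal p q. \<forall>k l. \<phi> (Inr w) k l = 0)}"

definition F_class :: "real poly \<Rightarrow> real poly \<Rightarrow> complex set \<Rightarrow> jet_fun set" where
  "F_class p q S = {\<phi> \<in> M_class p q S.
     (\<lambda>z. \<phi> (Inl z) 0 0) \<in> borel_measurable (restrict_space borel (S - crit_real p q)) \<and>
     bounded ((\<lambda>z. \<phi> (Inl z) 0 0) ` (S - crit_real p q)) \<and>
     (\<forall>w\<in>S \<inter> crit_real p q.
        let m = zero_mult p (of_real (Re w)); n = zero_mult q (of_real (Im w)) in
        \<exists>C. \<forall>\<^sub>F z in at w within S.
          norm ((\<phi> (Inl z) 0 0 - (\<Sum>k<m. \<Sum>l<n. \<phi> (Inl w) k l *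
                   of_real (Re (z - w) ^ k * Im (z - w) ^ l))) /
                of_real (max (\<bar>Re (z - w)\<bar> ^ m) (\<bar>Im (z - w)\<bar> ^ n))) \<le> C)}"

text \<open>
  \<open>taylor_coeff s \<xi> \<eta> k l\<close> is \<open>1/(k! l!)\<close> times the partial derivative of \<open>s\<close> of order
  \<open>k\<close> in \<open>z\<close> and \<open>l\<close> in \<open>w\<close> at \<open>(\<xi>,\<eta>)\<close>; \<open>map_poly pderiv\<close> differentiates in \<open>z\<close>,
  \<open>pderiv\<close> in \<open>w\<close>.
\<close>

definition taylor_coeff ::
    "complex poly poly \<Rightarrow> complex \<Rightarrow> complex \<Rightarrow> nat \<Rightarrow> nat \<Rightarrow> complex" where
  "taylor_coeff s \<xi> \<eta> k l =
     poly (poly ((map_poly pderiv ^^ k) ((pderiv ^^ l) s)) [:\<eta>:]) \<xi> / (fact k * fact l)"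

definition poly_fun ::
    "real poly \<Rightarrow> real poly \<Rightarrow> complex set \<Rightarrow> complex poly poly \<Rightarrow> jet_fun" where
  "poly_fun p q S s = (\<lambda>u k l.
     if u \<in> dom_pts p q S \<and> (k, l) \<in> idx p q u then
       (case u of Inl z \<Rightarrow> taylor_coeff s (of_real (Re z)) (of_real (Im z)) k l
        | Inr (\<xi>, \<eta>) \<Rightarrow> taylor_coeff s \<xi> \<eta> k l)
     else 0)"

definition poly_z :: "real poly \<Rightarrow> complex poly poly" where
  "poly_z p = [:map_poly complex_of_real p:]"

definition poly_w :: "real poly \<Rightarrow> complex poly poly" where
  "poly_w q = map_poly (\<lambda>c. [:complex_of_real c:]) q"

section \<open>The functional calculus\<close>

text \<open>
  The function \<open>g\<close> of a decomposition is split into its scalar part \<open>g\<close> on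
  \<open>S - crit_real p q\<close> and its \<open>\<complex>\<^sup>2\<close>-valued part \<open>h\<close> on \<open>S \<inter> crit_real p q\<close>;
  values elsewhere are irrelevant.  \<open>pq_times\<close> is \<open>(p_N + q_N)(z) \<cdot> g(z)\<close>.
\<close>

definition pq_times ::
    "real poly \<Rightarrow> real poly \<Rightarrow> complex set \<Rightarrow> (complex \<Rightarrow> complex) \<Rightarrow> (complex \<Rightarrow> complex \<times> complex)
      \<Rightarrow> complex \<Rightarrow> nat \<Rightarrow> nat \<Rightarrow> complex" where
  "pq_times p q S g h z k l =
     (let pq = fadd (poly_fun p q S (poly_z p)) (poly_fun p q S (poly_w q));
          m = zero_mult p (of_real (Re z)); n = zero_mult q (of_real (Im z)) in
      if z \<notin> crit_real p q then
        (if (k, l) = (0, 0) then of_real (poly p (Re z) + poly q (Im z)) * g z else 0)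
      else if (k, l) = (m, 0) then pq (Inl z) m 0 * fst (h z)
      else if (k, l) = (0, n) then pq (Inl z) 0 n * snd (h z)
      else 0)"

definition admissible ::
    "real poly \<Rightarrow> real poly \<Rightarrow> complex set \<Rightarrow> jet_fun
      \<Rightarrow> complex poly poly \<Rightarrow> (complex \<Rightarrow> complex) \<Rightarrow> (complex \<Rightarrow> complex \<times> complex) \<Rightarrow> bool" where
  "admissible p q S \<phi> s g h \<longleftrightarrow>
     bounded (g ` (S - crit_real p q)) \<and>
     g \<in> borel_measurable (restrict_space borel (S - crit_real p q)) \<and>
     fdiff \<phi> (poly_fun p q S s) \<in> R_class p q S \<and>
     (\<forall>z\<in>S. \<forall>k l. \<phi> (Inl z) k l = poly_fun p q S s (Inl z) k l + pq_times p q S g h z k l)"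

definition R_integral ::
    "('v1::chilbert_space \<Rightarrow> 'v::chilbert_space) \<Rightarrow> ('v2::chilbert_space \<Rightarrow> 'v)
      \<Rightarrow> (complex set \<Rightarrow> 'v \<Rightarrow> 'v) \<Rightarrow> real poly \<Rightarrow> real poly \<Rightarrow> complex set
      \<Rightarrow> (complex \<Rightarrow> complex) \<Rightarrow> (complex \<Rightarrow> complex \<times> complex) \<Rightarrow> 'v \<Rightarrow> 'v" where
  "R_integral R1 R2 E p q S g h x =
     spectral_integral E (S - crit_real p q) g x +
     (\<Sum>w\<in>S \<inter> crit_real p q. fst (h w) *\<^sub>C R1 (adj R1 (E {w} x)) + snd (h w) *\<^sub>C R2 (adj R2 (E {w} x)))"

text \<open>
  The definite description makes the value \<open>\<phi>(N)\<close> meaningful only because decompositions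
  exist and all yield the same operator.
\<close>

definition fun_calc ::
    "('k::krein_space \<Rightarrow> 'k) \<Rightarrow> real poly \<Rightarrow> real poly \<Rightarrow> ('v::chilbert_space \<Rightarrow> 'k)
      \<Rightarrow> ('v1::chilbert_space \<Rightarrow> 'v) \<Rightarrow> ('v2::chilbert_space \<Rightarrow> 'v)
      \<Rightarrow> (complex set \<Rightarrow> 'v \<Rightarrow> 'v) \<Rightarrow> jet_fun \<Rightarrow> 'k \<Rightarrow> 'k" where
  "fun_calc N p q T R1 R2 E \<phi> =
     (let S = spectrum (Theta T N) in
      THE X. \<exists>s g h. admissible p q S \<phi> s g h \<and>
        X = (\<lambda>x. op_poly2 s (re_part N) (im_part N) x + Xi T (R_integral R1 R2 E p q S g h) x))"

end

theory Submission
  imports Defs "HOL-Computational_Algebra.Fundamental_Theorem_Algebra"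
begin

text \<open>
  Write \<open>Z = \<Theta>(N)\<close>, \<open>S = \<sigma>(Z)\<close>, \<open>Q\<^sub>j = R\<^sub>j R\<^sub>j\<^sup>*\<close>, and \<open>K\<close> for the set of real critical points.  Everything
  rests on transporting operators through \<open>T\<close>.  An operator \<open>C\<close> that commutes with \<open>T T\<^sup>*\<close> has a bounded
  companion \<open>D\<close> with \<open>T D = C T\<close> (\<open>intertwiner_exists\<close>): the norms \<open>\<parallel>T\<^sup>* (C\<^sup>* C)\<^sup>n x\<parallel>\<close> cannot grow faster than
  those of the powers of \<open>C\<^sup>* C\<close>, whence \<open>\<parallel>T\<^sup>* C x\<parallel> \<le> M \<parallel>T\<^sup>* x\<parallel>\<close>, and \<open>D\<close> comes from the Riesz theorem.  As
  \<open>A\<close>, \<open>B\<close> have the companions \<open>re_part Z\<close>, \<open>im_part Z\<close>, the hypotheses on \<open>T\<close>, \<open>T\<^sub>1\<close>, \<open>T\<^sub>2\<close> turn into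
  \<open>T\<^sup>* T = (p + q)(Z)\<close>, \<open>Q\<^sub>1 T\<^sup>* T = p(Z)\<close> and \<open>Q\<^sub>2 T\<^sup>* T = q(Z)\<close> in the bounded Borel calculus \<open>I\<close> of \<open>E\<close>, where
  \<open>p\<close> is evaluated at real and \<open>q\<close> at imaginary parts.

  That calculus is built from the quadratic forms that define spectral integrals, by uniform
  approximation with simple functions.  An operator that commutes, together with its adjoint, with
  \<open>Z\<close> also commutes with \<open>E\<close> (\<open>commutes_with_spectral_measure\<close>): the range of \<open>E\<close> of a disc is characterized
  by the growth of the powers of \<open>Z - a\<close>, and the discs generate the Borel sets.  In particular the
  \<open>Q\<^sub>j\<close> commute with \<open>E\<close>, and so does the companion of every operator in the commutant of \<open>N\<close> and \<open>N\<^sup>*\<close>.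

  Since the \<open>Q\<^sub>j\<close> are contractions, the above identities imply \<open>\<bar>p\<bar> \<le> \<bar>p + q\<bar>\<close> and \<open>\<bar>q\<bar> \<le> \<bar>p + q\<bar>\<close> on \<open>S\<close>
  (\<open>contraction_dominates\<close>).  So \<open>p + q\<close> has no zeros on \<open>S - K\<close> and at a point of \<open>K\<close> it does not decay
  faster than the denominators in the definition of the function class.  Interpolating the jets of
  \<open>\<phi>\<close> by a polynomial and dividing the rest by \<open>p + q\<close> shows that the class consists exactly of the
  functions with an admissible decomposition (\<open>admissible_if_F_class\<close>, \<open>F_class_if_admissible\<close>).  Closure
  under the operations and all homomorphism properties can therefore be checked on decompositions.

  Two decompositions of one function differ by a polynomial whose jets vanish at all common zeros of
  \<open>p(z)\<close> and \<open>q(w)\<close>, hence by \<open>p(z) u + q(w) v\<close> (\<open>in_ideal_if_jets_vanish\<close>).  As \<open>p(A) u(A, B) = \<Xi> (Q\<^sub>1 u(Z))\<close> and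
  \<open>q(B) v(A, B) = \<Xi> (Q\<^sub>2 v(Z))\<close>, independence amounts to an identity between integrals, which on the range
  of \<open>E (S - K)\<close> may be multiplied by the injective operator \<open>T\<^sup>* T\<close> and becomes
  \<open>p u + q v = (p + q) (g - g')\<close> (\<open>RInt_difference\<close>).  For multiplicativity (\<open>Op_mult\<close>) the essential point is
  \<open>\<Xi>(X) \<Xi>(Y) = \<Xi>(X (p + q)(Z) Y)\<close>, which matches the factor \<open>p + q\<close> in a decomposition.
\<close>

section \<open>Inner products and adjoints in Krein spaces\<close>

lemma scaleC_zero_right [simp]: "c *\<^sub>C (0::'a::complex_vector) = 0"
  using scaleC_add_right[of c "0::'a" 0] by simp

lemma scaleC_zero_left [simp]: "0 *\<^sub>C (x::'a::complex_vector) = 0"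
  using scaleC_add_left[of 0 0 x] by simp

lemma scaleC_minus_right [simp]: "c *\<^sub>C (- x) = - (c *\<^sub>C (x::'a::complex_vector))"
  using scaleC_add_right[of c x "- x"] by (simp add: eq_neg_iff_add_eq_0 add.commute)

lemma scaleC_minus_left [simp]: "(- c) *\<^sub>C x = - (c *\<^sub>C (x::'a::complex_vector))"
  using scaleC_add_left[of c "- c" x] by (simp add: eq_neg_iff_add_eq_0 add.commute)

lemma scaleC_diff_right: "c *\<^sub>C (x - y) = c *\<^sub>C x - c *\<^sub>C (y::'a::complex_vector)"
  using scaleC_add_right[of c x "- y"] by simp

lemma scaleC_diff_left: "(c - d) *\<^sub>C x = c *\<^sub>C x - d *\<^sub>C (x::'a::complex_vector)"
  using scaleC_add_left[of c "- d" x] by simp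

lemma cinner_zero_left [simp]: "cinner 0 (x::'a::hermitian_space) = 0"
  using cinner_add_left[of 0 0 x] by simp

lemma cinner_zero_right [simp]: "cinner (x::'a::hermitian_space) 0 = 0"
  using cinner_commute[of x 0] by simp

lemma cinner_add_right: "cinner (x::'a::hermitian_space) (y + z) = cinner x y + cinner x z"
  by (metis cinner_commute cinner_add_left complex_cnj_add)

lemma cinner_scaleC_right: "cinner (x::'a::hermitian_space) (a *\<^sub>C y) = cnj a * cinner x y"
  by (metis cinner_commute cinner_scaleC_left complex_cnj_mult)

lemma cinner_minus_left: "cinner (- x) (y::'a::hermitian_space) = - cinner x y"
  using cinner_add_left[of x "- x" y] by (intro minus_unique[symmetric]) simp

lemma cinner_minus_right: "cinner (x::'a::hermitian_space) (- y) = - cinner x y"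
  using cinner_add_right[of x y "- y"] by (intro minus_unique[symmetric]) simp

lemma cinner_diff_left: "cinner (x - y) (z::'a::hermitian_space) = cinner x z - cinner y z"
  using cinner_add_left[of x "- y" z] by (simp add: cinner_minus_left)

lemma cinner_diff_right: "cinner (x::'a::hermitian_space) (y - z) = cinner x y - cinner x z"
  using cinner_add_right[of x y "- z"] by (simp add: cinner_minus_right)

lemma cinner_sum_left: "cinner (sum f A) (y::'a::hermitian_space) = (\<Sum>i\<in>A. cinner (f i) y)"
  by (induction A rule: infinite_finite_induct) (auto simp: cinner_add_left)

lemma cinner_scaleR_left: "cinner (r *\<^sub>R x) (y::'a::hermitian_space) = complex_of_real r * cinner x y"
  by (simp add: scaleR_scaleC cinner_scaleC_left)

lemma cinner_scaleR_right: "cinner (x::'a::hermitian_space) (r *\<^sub>R y) = complex_of_real r * cinner x y"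
  by (simp add: scaleR_scaleC cinner_scaleC_right)

lemmas cinner_simps = cinner_add_left cinner_add_right cinner_diff_left cinner_diff_right
  cinner_minus_left cinner_minus_right cinner_scaleC_left cinner_scaleC_right

text \<open>
  A fundamental decomposition is used only through its fundamental symmetry \<open>J\<close>, the identity on
  the positive and minus the identity on the negative summand: it turns the indefinite product into
  a Hilbert space product \<open>cinner (J x) y\<close> for the norm of the type.
\<close>

definition fundamental_symmetry :: "('k::krein_space \<Rightarrow> 'k) \<Rightarrow> bool" where
  "fundamental_symmetry J \<longleftrightarrow>
     (\<forall>x y. J (x + y) = J x + J y) \<and> (\<forall>c x. J (c *\<^sub>C x) = c *\<^sub>C J x) \<and>
     (\<forall>x. J (J x) = x) \<and> (\<forall>x y. cinner (J x) y = cinner x (J y)) \<and>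
     (\<forall>x. cinner (J x) x = complex_of_real ((norm x)\<^sup>2))"

lemma cinner_self_real: "cinner x x = complex_of_real (Re (cinner x (x::'a::hermitian_space)))"
  using cinner_commute[of x x] by (simp add: complex_eq_iff)

lemma fundamental_symmetry_exists: "\<exists>J::'k::krein_space \<Rightarrow> 'k. fundamental_symmetry J"
proof -
  obtain P M :: "'k set" where D: "orthogonal_decomposition P M"
    and nrm: "\<forall>x\<in>P. \<forall>y\<in>M. (norm (x + y))\<^sup>2 = Re (cinner x x) - Re (cinner y y)"
    using fundamental_decomposition by blast
  note D' = D[unfolded orthogonal_decomposition_def]
  have sP: "csubspace P" and sM: "csubspace M" using D' by auto
  have ex: "\<exists>x\<in>P. \<exists>y\<in>M. z = x + y" for z using D' by simp
  have orth: "cinner x y = 0" if "x \<in> P" "y \<in> M" for x y using D' that by simp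
  have pos: "0 < Re (cinner x x)" if "x \<in> P" "x \<noteq> 0" for x using D' that by simp
  have orth': "cinner y x = 0" if "x \<in> P" "y \<in> M" for x y
    using orth[OF that] cinner_commute[of y x] by simp
  have min: "- x \<in> S" if "csubspace S" "x \<in> S" for S and x :: 'k
  proof -
    have "(-1) *\<^sub>C x \<in> S" using that unfolding csubspace_def by blast
    then show ?thesis by (simp add: scaleC_one)
  qed
  have uniq: "x = x' \<and> y = y'" if "x \<in> P" "x' \<in> P" "y \<in> M" "y' \<in> M" "x + y = x' + y'" for x x' y y'
  proof -
    have "x - x' \<in> P" using min[OF sP that(2)] that(1) sP unfolding csubspace_def
      by (metis diff_conv_add_uminus)
    moreover have "x - x' = y' - y" using that(5) by (simp add: algebra_simps)
    moreover have "y' - y \<in> M" using min[OF sM that(3)] that(4) sM unfolding csubspace_def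
      by (metis diff_conv_add_uminus)
    ultimately have "x - x' = 0" using orth[of "x - x'" "y' - y"] pos[of "x - x'"]
      by (metis order_less_irrefl zero_complex.simps(1))
    then show ?thesis using that(5) by simp
  qed
  define pp where "pp z = (SOME x. x \<in> P \<and> (\<exists>y\<in>M. z = x + y))" for z
  have pp: "pp z \<in> P \<and> (\<exists>y\<in>M. z = pp z + y)" for z
    unfolding pp_def by (rule someI_ex) (use ex in blast)
  define mm where "mm z = z - pp z" for z
  have mm: "mm z \<in> M" for z using pp[of z] unfolding mm_def by (metis add_diff_cancel_left')
  have z: "z = pp z + mm z" for z unfolding mm_def by simp
  have ppI: "pp (x + y) = x \<and> mm (x + y) = y" if "x \<in> P" "y \<in> M" for x y
    using uniq[of "pp (x+y)" x "mm (x+y)" y] that pp[of "x+y"] mm[of "x+y"] z[of "x+y"] by auto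
  define J where "J z = pp z - mm z" for z
  have JI: "J (x + y) = x - y" if "x \<in> P" "y \<in> M" for x y
    using ppI[OF that] unfolding J_def by simp
  have add: "J (x + y) = J x + J y" for x y
  proof -
    have "x + y = (pp x + pp y) + (mm x + mm y)" using z[of x] z[of y] by (metis add.assoc add.left_commute)
    moreover have "pp x + pp y \<in> P" "mm x + mm y \<in> M"
      using pp mm sP sM unfolding csubspace_def by blast+
    ultimately show ?thesis using JI by (metis J_def add_diff_add)
  qed
  have scal: "J (c *\<^sub>C x) = c *\<^sub>C J x" for c x
  proof -
    have "c *\<^sub>C x = c *\<^sub>C pp x + c *\<^sub>C mm x" using z[of x] by (metis scaleC_add_right)
    moreover have "c *\<^sub>C pp x \<in> P" "c *\<^sub>C mm x \<in> M"
      using pp mm sP sM unfolding csubspace_def by blast+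
    ultimately show ?thesis using JI by (metis J_def scaleC_diff_right)
  qed
  have inv: "J (J x) = x" for x
  proof -
    have "J x = pp x + (- mm x)" unfolding J_def by simp
    then have "J (J x) = pp x - (- mm x)" using JI pp[of x] min[OF sM mm[of x]] by metis
    then show ?thesis using z[of x] by simp
  qed
  have inner: "cinner (J x) y = cinner (pp x) (pp y) - cinner (mm x) (mm y)"
    "cinner x (J y) = cinner (pp x) (pp y) - cinner (mm x) (mm y)" for x y
  proof -
    have "cinner (J x) y = cinner (pp x - mm x) (pp y + mm y)" using z[of y] J_def by simp
    then show "cinner (J x) y = cinner (pp x) (pp y) - cinner (mm x) (mm y)"
      using pp mm orth orth' by (simp add: cinner_simps)
    have "cinner x (J y) = cinner (pp x + mm x) (pp y - mm y)" using z[of x] J_def by simp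
    then show "cinner x (J y) = cinner (pp x) (pp y) - cinner (mm x) (mm y)"
      using pp mm orth orth' by (simp add: cinner_simps)
  qed
  have "cinner (J x) x = complex_of_real ((norm x)\<^sup>2)" for x
  proof -
    have "(norm x)\<^sup>2 = Re (cinner (pp x) (pp x)) - Re (cinner (mm x) (mm x))"
      using nrm pp[of x] mm[of x] z[of x] by metis
    then show ?thesis using inner(1)[of x x] cinner_self_real[of "pp x"] cinner_self_real[of "mm x"]
      by simp
  qed
  then have "fundamental_symmetry J"
    unfolding fundamental_symmetry_def using add scal inv inner by auto
  then show ?thesis by blast
qed

definition krein_symmetry :: "'k::krein_space \<Rightarrow> 'k" ("\<J>") where
  "\<J> = (SOME J. fundamental_symmetry J)"

lemma fundamental_symmetry_J: "fundamental_symmetry (\<J>::'k::krein_space \<Rightarrow> 'k)"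
  unfolding krein_symmetry_def using fundamental_symmetry_exists by (rule someI_ex)

lemma J_add: "\<J> (x + y) = \<J> x + \<J> y"
  and J_scaleC: "\<J> (c *\<^sub>C x) = c *\<^sub>C \<J> x"
  and J_J [simp]: "\<J> (\<J> x) = x"
  and cinner_J_left: "cinner (\<J> x) y = cinner x (\<J> y)"
  and cinner_J_self: "cinner (\<J> x) x = complex_of_real ((norm x)\<^sup>2)"
  using fundamental_symmetry_J unfolding fundamental_symmetry_def by blast+

lemma norm_scaleC [simp]: "norm (c *\<^sub>C x) = cmod c * norm (x::'k::krein_space)"
proof -
  have "complex_of_real ((norm (c *\<^sub>C x))\<^sup>2) = complex_of_real ((cmod c * norm x)\<^sup>2)"
    using cinner_J_self[of "c *\<^sub>C x"] cinner_J_self[of x] complex_norm_square[of c]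
    by (simp add: J_scaleC cinner_simps power_mult_distrib mult_ac)
  then have "(norm (c *\<^sub>C x))\<^sup>2 = (cmod c * norm x)\<^sup>2" by (simp only: of_real_eq_iff)
  then show ?thesis by (simp add: power2_eq_iff_nonneg)
qed

lemma norm_J [simp]: "norm (\<J> x) = norm x"
proof -
  have "cinner (\<J> (\<J> x)) (\<J> x) = cinner (\<J> x) x" by (simp add: cinner_J_left)
  then have "(norm (\<J> x))\<^sup>2 = (norm x)\<^sup>2" unfolding cinner_J_self by (simp only: of_real_eq_iff)
  then show ?thesis by (simp add: power2_eq_iff_nonneg)
qed

lemma norm_diff_scaleC_sq:
  "(norm (x - c *\<^sub>C y))\<^sup>2 = (norm x)\<^sup>2 - 2 * Re (cnj c * cinner (\<J> x) y) + (cmod c * norm y)\<^sup>2"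
proof -
  have e: "\<J> (x - c *\<^sub>C y) = \<J> x - c *\<^sub>C \<J> y"
    using J_add[of "x - c *\<^sub>C y" "c *\<^sub>C y"] by (simp add: J_scaleC algebra_simps)
  have yx: "cinner (\<J> y) x = cnj (cinner (\<J> x) y)"
    using cinner_commute[of "\<J> y" x] by (simp add: cinner_J_left)
  have "complex_of_real ((norm (x - c *\<^sub>C y))\<^sup>2) = cinner (\<J> x) x - cnj c * cinner (\<J> x) y
    - c * cinner (\<J> y) x + c * cnj c * cinner (\<J> y) y"
    unfolding cinner_J_self[symmetric] e by (simp add: cinner_simps algebra_simps)
  also have "\<dots> = complex_of_real ((norm x)\<^sup>2) - (cnj c * cinner (\<J> x) y + cnj (cnj c * cinner (\<J> x) y))
     + c * cnj c * complex_of_real ((norm y)\<^sup>2)"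
    unfolding yx cinner_J_self by simp
  also have "\<dots> = complex_of_real ((norm x)\<^sup>2 - 2 * Re (cnj c * cinner (\<J> x) y) + (cmod c * norm y)\<^sup>2)"
    unfolding complex_add_cnj complex_norm_square[symmetric] by (simp add: power_mult_distrib)
  finally show ?thesis by (simp only: of_real_eq_iff)
qed

lemma projection_coefficient:
  fixes u :: complex and r :: real
  assumes "r \<noteq> 0" "c = u / complex_of_real (r\<^sup>2)"
  shows "cnj c * u = complex_of_real ((cmod u)\<^sup>2 / r\<^sup>2)" "(cmod c * r)\<^sup>2 = (cmod u)\<^sup>2 / r\<^sup>2"
proof -
  have "cnj u * u = complex_of_real ((cmod u)\<^sup>2)" by (subst complex_norm_square) (rule mult.commute)
  then show "cnj c * u = complex_of_real ((cmod u)\<^sup>2 / r\<^sup>2)"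
    unfolding assms(2) by (simp del: of_real_power)
  have "cmod c = cmod u / r\<^sup>2" unfolding assms(2) by (simp add: norm_divide norm_power)
  then show "(cmod c * r)\<^sup>2 = (cmod u)\<^sup>2 / r\<^sup>2"
    using assms(1) by (simp add: power_mult_distrib power_divide power2_eq_square)
qed

lemma Cauchy_Schwarz_J: "cmod (cinner (\<J> x) y) \<le> norm x * norm y"
proof (cases "y = 0")
  case False
  define c where "c = cinner (\<J> x) y / complex_of_real ((norm y)\<^sup>2)"
  have "norm y \<noteq> 0" using False by simp
  note projection_coefficient[OF this c_def]
  then have "0 \<le> (norm x)\<^sup>2 - (cmod (cinner (\<J> x) y))\<^sup>2 / (norm y)\<^sup>2"
    using norm_diff_scaleC_sq[of x c y] zero_le_power2[of "norm (x - c *\<^sub>C y)"] by simp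
  then have "(cmod (cinner (\<J> x) y))\<^sup>2 \<le> (norm x * norm y)\<^sup>2"
    using False by (simp add: field_simps power_mult_distrib)
  then show ?thesis by (rule power2_le_imp_le) simp
qed simp

lemma Cauchy_Schwarz: "cmod (cinner x y) \<le> norm x * norm (y::'k::krein_space)"
  using Cauchy_Schwarz_J[of "\<J> x" y] by simp

lemma cinner_eqI: "x = y" if "\<And>z. cinner z x = cinner z (y::'k::krein_space)"
  using that[of "\<J> (x - y)"] cinner_J_self[of "x - y"] by (simp add: cinner_diff_right)

lemma bounded_bilinear_cinner:
  "bounded_bilinear (cinner :: 'k::krein_space \<Rightarrow> 'k \<Rightarrow> complex)"
  by (rule bounded_bilinear.intro)
    (auto simp: cinner_simps cinner_scaleR_left cinner_scaleR_right scaleR_conv_of_real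
      intro!: exI[of _ 1] Cauchy_Schwarz)

lemmas tendsto_cinner = bounded_bilinear.tendsto[OF bounded_bilinear_cinner]

text \<open>
  The Riesz representation theorem: an element of least norm in the hyperplane where the functional
  is \<open>1\<close> exists by the parallelogram law, and is orthogonal to the kernel for the product of \<open>\<J>\<close>.
  The functional lives on a subspace, because intertwining operators will be found by representing
  functionals on the range of \<open>T\<^sup>*\<close>; the least-norm element then lies in the closure of the subspace.
\<close>

lemma Riesz_representation:
  fixes f :: "'k::krein_space \<Rightarrow> complex"
  assumes W: "csubspace W"
    and add: "\<And>x y. x \<in> W \<Longrightarrow> y \<in> W \<Longrightarrow> f (x + y) = f x + f y"
    and sc: "\<And>c x. x \<in> W \<Longrightarrow> f (c *\<^sub>C x) = c * f x"
    and bd: "\<And>x. x \<in> W \<Longrightarrow> cmod (f x) \<le> K * norm x" and K: "0 \<le> K"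
  shows "\<exists>y. norm y \<le> K \<and> (\<forall>x\<in>W. f x = cinner x y)"
proof (cases "\<forall>x\<in>W. f x = 0")
  case True
  then show ?thesis using K by (intro exI[of _ 0]) simp
next
  case False
  have Wadd: "x + y \<in> W" if "x \<in> W" "y \<in> W" for x y using W that unfolding csubspace_def by blast
  have Wsc: "c *\<^sub>C x \<in> W" if "x \<in> W" for c x using W that unfolding csubspace_def by blast
  have Wdiff: "x - c *\<^sub>C y \<in> W \<and> f (x - c *\<^sub>C y) = f x - c * f y" if "x \<in> W" "y \<in> W" for x y c
    using Wadd[OF that(1) Wsc[OF that(2), of "- c"]] add[OF that(1) Wsc[OF that(2), of "- c"]]
      sc[OF that(2), of "- c"] by simp
  define H where "H = {x \<in> W. f x = 1}"
  obtain x1 where "f x1 \<noteq> 0" "x1 \<in> W" using False by blast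
  then have "(1 / f x1) *\<^sub>C x1 \<in> H" unfolding H_def by (simp add: sc Wsc)
  then have ne: "norm ` H \<noteq> {}" by blast
  define d where "d = Inf (norm ` H)"
  have bb: "bdd_below (norm ` H)" by (rule bdd_belowI[of _ 0]) auto
  have dle: "d \<le> norm x" if "x \<in> H" for x unfolding d_def using that bb by (intro cInf_lower) auto
  have d0: "0 \<le> d" unfolding d_def using ne by (intro cInf_greatest) auto
  have "\<exists>x\<in>H. norm x < d + 1 / real (Suc n)" for n
  proof -
    have "d < d + 1 / real (Suc n)" by simp
    then show ?thesis unfolding d_def using cInf_lessD[OF ne] by blast
  qed
  then obtain u where uH: "\<And>n. u n \<in> H" and un: "\<And>n. norm (u n) < d + 1 / real (Suc n)" by metis
  have uW: "u n \<in> W" "f (u n) = 1" for n using uH[of n] unfolding H_def by auto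
  have par: "(norm (x - y))\<^sup>2 = 2 * (norm x)\<^sup>2 + 2 * (norm y)\<^sup>2 - (norm (x + y))\<^sup>2" for x y :: 'k
    using norm_diff_scaleC_sq[of x 1 y] norm_diff_scaleC_sq[of x "-1" y] by (simp add: scaleC_one)
  \<comment> \<open>Midpoints of elements of \<open>H\<close> lie in \<open>H\<close>, so the parallelogram law makes the minimizing sequence Cauchy.\<close>
  have close: "(norm (u m - u n))\<^sup>2 \<le> 2 * (d + 1 / real (Suc m))\<^sup>2 + 2 * (d + 1 / real (Suc n))\<^sup>2 - 4 * d\<^sup>2" for m n
  proof -
    have "(1/2) *\<^sub>C (u m + u n) \<in> H" using uW unfolding H_def by (simp add: sc add Wadd Wsc)
    then have "d \<le> (1/2) * norm (u m + u n)" using dle by fastforce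
    then have "(2 * d)\<^sup>2 \<le> (norm (u m + u n))\<^sup>2" using d0 by (intro power_mono) auto
    moreover have "(norm (u k))\<^sup>2 \<le> (d + 1 / real (Suc k))\<^sup>2" for k
      using un[of k] by (intro power_mono) auto
    note this[of m] this[of n]
    ultimately show ?thesis using par[of "u m" "u n"] by (simp add: power_mult_distrib)
  qed
  have lim: "(\<lambda>n. 4 * (d + 1 / real (Suc n))\<^sup>2 - 4 * d\<^sup>2) \<longlonglongrightarrow> 4 * (d + 0)\<^sup>2 - 4 * d\<^sup>2"
    by (intro tendsto_intros LIMSEQ_Suc lim_1_over_n)
  have "Cauchy u"
  proof (rule metric_CauchyI)
    fix e :: real assume e: "0 < e"
    then obtain M where M: "4 * (d + 1 / real (Suc M))\<^sup>2 - 4 * d\<^sup>2 < e\<^sup>2"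
      using order_tendstoD(2)[OF lim, of "e\<^sup>2"] by (auto simp: eventually_sequentially)
    have "dist (u m) (u n) < e" if "m \<ge> M" "n \<ge> M" for m n
    proof -
      have mono: "(d + 1 / real (Suc k))\<^sup>2 \<le> (d + 1 / real (Suc M))\<^sup>2" if "k \<ge> M" for k
        using that d0 by (intro power_mono add_mono order_refl divide_left_mono) auto
      have "(norm (u m - u n))\<^sup>2 < e\<^sup>2" using close[of m n] mono[OF that(1)] mono[OF that(2)] M by linarith
      then show ?thesis using e unfolding dist_norm by (simp add: power2_less_imp_less)
    qed
    then show "\<exists>M. \<forall>m\<ge>M. \<forall>n\<ge>M. dist (u m) (u n) < e" by blast
  qed
  then obtain x0 where x0: "u \<longlonglongrightarrow> x0" using Cauchy_convergent convergent_def by blast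
  have one: "1 \<le> K * norm x0"
  proof -
    have "(\<lambda>n. K * norm (u n)) \<longlonglongrightarrow> K * norm x0" by (intro tendsto_intros x0)
    moreover have "1 \<le> K * norm (u n)" for n using bd[OF uW(1), of n] uW(2)[of n] by simp
    ultimately show ?thesis by (intro LIMSEQ_le_const) auto
  qed
  then have x0ne: "x0 \<noteq> 0" by auto
  have "norm x0 \<le> d"
  proof -
    have "(\<lambda>n. d + 1 / real (Suc n)) \<longlonglongrightarrow> d + 0" by (intro tendsto_intros LIMSEQ_Suc lim_1_over_n)
    moreover have "norm (u n) \<le> d + 1 / real (Suc n)" for n using un[of n] by simp
    ultimately show ?thesis using LIMSEQ_le[OF tendsto_norm[OF x0], of _ "d + 0"] by auto
  qed
  have orth: "cinner (\<J> x0) z = 0" if z: "z \<in> W" and fz: "f z = 0" for z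
  proof (rule ccontr)
    assume nz: "cinner (\<J> x0) z \<noteq> 0"
    then have zne: "norm z \<noteq> 0" by auto
    \<comment> \<open>The multiple of \<open>z\<close> whose removal shortens \<open>x0\<close> most.\<close>
    define c where "c = cinner (\<J> x0) z / complex_of_real ((norm z)\<^sup>2)"
    note c = projection_coefficient[OF zne c_def]
    have "(norm (x0 - c *\<^sub>C z))\<^sup>2 = (norm x0)\<^sup>2 - (cmod (cinner (\<J> x0) z))\<^sup>2 / (norm z)\<^sup>2"
      using norm_diff_scaleC_sq[of x0 c z] c by simp
    also have "\<dots> < (norm x0)\<^sup>2" using nz zne by simp
    finally have "norm (x0 - c *\<^sub>C z) < norm x0" by (rule power2_less_imp_less) simp
    moreover have "d \<le> norm (x0 - c *\<^sub>C z)"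
    proof (rule LIMSEQ_le_const)
      show "(\<lambda>n. norm (u n - c *\<^sub>C z)) \<longlonglongrightarrow> norm (x0 - c *\<^sub>C z)" by (intro tendsto_intros x0)
      have "u n - c *\<^sub>C z \<in> H" for n using Wdiff[OF uW(1) z] uW(2) fz unfolding H_def by simp
      then show "\<exists>N. \<forall>n\<ge>N. d \<le> norm (u n - c *\<^sub>C z)" using dle by blast
    qed
    ultimately show False using \<open>norm x0 \<le> d\<close> by simp
  qed
  define y where "y = (1 / complex_of_real ((norm x0)\<^sup>2)) *\<^sub>C \<J> x0"
  have "f x = cinner x y" if x: "x \<in> W" for x
  proof -
    have "cinner (\<J> x0) x = cnj (f x) * cinner (\<J> x0) (u n)" for n
      using orth[of "x - f x *\<^sub>C u n"] Wdiff[OF x uW(1)] uW(2) by (simp add: cinner_simps)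
    moreover have "(\<lambda>n. cnj (f x) * cinner (\<J> x0) (u n)) \<longlonglongrightarrow> cnj (f x) * cinner (\<J> x0) x0"
      by (intro tendsto_intros tendsto_cinner x0)
    ultimately have "cinner (\<J> x0) x = cnj (f x) * complex_of_real ((norm x0)\<^sup>2)"
      using LIMSEQ_unique[of "\<lambda>n. cinner (\<J> x0) x"] unfolding cinner_J_self[symmetric] by auto
    then have "cinner x (\<J> x0) = f x * complex_of_real ((norm x0)\<^sup>2)"
      using cinner_commute[of x "\<J> x0"] by simp
    then show ?thesis unfolding y_def using x0ne by (simp add: cinner_scaleC_right)
  qed
  moreover have "norm y \<le> K"
  proof -
    have "norm y = 1 / norm x0"
      using x0ne unfolding y_def by (simp add: norm_divide norm_power norm_mult power2_eq_square)
    then show ?thesis using one x0ne by (simp add: divide_le_eq)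
  qed
  ultimately show ?thesis by blast
qed

lemma bounded_clinear_bounded_linear: "bounded_clinear f \<Longrightarrow> bounded_linear f"
  and bounded_clinear_scaleC: "bounded_clinear f \<Longrightarrow> f (c *\<^sub>C x) = c *\<^sub>C f x"
  unfolding bounded_clinear_def by auto

lemma bounded_clinear_add: "bounded_clinear f \<Longrightarrow> f (x + y) = f x + f y"
  and bounded_clinear_diff: "bounded_clinear f \<Longrightarrow> f (x - y) = f x - f y"
  and bounded_clinear_minus: "bounded_clinear f \<Longrightarrow> f (- x) = - f x"
  and bounded_clinear_zero: "bounded_clinear f \<Longrightarrow> f 0 = 0"
  and bounded_clinear_sum: "bounded_clinear f \<Longrightarrow> f (sum g A) = (\<Sum>i\<in>A. f (g i))"
  using bounded_clinear_bounded_linear[of f]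
  by (auto simp: bounded_linear_def linear_add linear_diff linear_neg linear_0 linear_sum)

lemmas bounded_clinear_simps = bounded_clinear_add bounded_clinear_diff bounded_clinear_minus
  bounded_clinear_zero bounded_clinear_scaleC

lemma bounded_clinear_bound:
  assumes "bounded_clinear f" shows "\<exists>K\<ge>0. \<forall>x. norm (f x) \<le> K * norm x"
  using bounded_linear.nonneg_bounded[OF bounded_clinear_bounded_linear[OF assms]]
  by (auto simp: mult.commute)

lemma bounded_clinearI:
  assumes "\<And>x y. f (x + y) = f x + f y" "\<And>c x. f (c *\<^sub>C x) = c *\<^sub>C f x"
    and "\<And>x. norm (f x) \<le> K * norm x"
  shows "bounded_clinear f"
  unfolding bounded_clinear_def
  by (intro conjI bounded_linear_intro[of _ K]) (use assms in \<open>auto simp: scaleR_scaleC mult.commute\<close>)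

lemma bounded_clinear_compose:
  "bounded_clinear f \<Longrightarrow> bounded_clinear g \<Longrightarrow> bounded_clinear (\<lambda>x. f (g x))"
  unfolding bounded_clinear_def by (auto intro: bounded_linear_compose)

lemma bounded_clinear_comp:
  "bounded_clinear f \<Longrightarrow> bounded_clinear g \<Longrightarrow> bounded_clinear (f \<circ> g)"
  using bounded_clinear_compose[of f g] by (simp add: o_def)

lemma bounded_clinear_plus:
  "bounded_clinear f \<Longrightarrow> bounded_clinear g \<Longrightarrow> bounded_clinear (\<lambda>x. f x + g x)"
  unfolding bounded_clinear_def by (auto intro: bounded_linear_add simp: scaleC_add_right)

lemma bounded_clinear_sub:
  "bounded_clinear f \<Longrightarrow> bounded_clinear g \<Longrightarrow> bounded_clinear (\<lambda>x. f x - g x)"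
  unfolding bounded_clinear_def by (auto intro: bounded_linear_sub simp: scaleC_diff_right)

lemma bounded_clinear_scale:
  fixes f :: "'a::{complex_vector,real_normed_vector} \<Rightarrow> 'b::krein_space"
  assumes "bounded_clinear f" shows "bounded_clinear (\<lambda>x. c *\<^sub>C f x)"
proof -
  obtain K where "\<forall>x. norm (f x) \<le> K * norm x" using bounded_clinear_bound[OF assms] by blast
  then have "norm (c *\<^sub>C f x) \<le> (cmod c * K) * norm x" for x
    by (simp add: mult.assoc mult_left_mono)
  then show ?thesis
    by (intro bounded_clinearI[of _ "cmod c * K"])
      (auto simp: bounded_clinear_simps[OF assms] scaleC_add_right scaleC_scaleC mult.commute)
qed

lemma bounded_clinear_0: "bounded_clinear (\<lambda>x. 0)"
  and bounded_clinear_ident: "bounded_clinear (\<lambda>x. x)"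
  and bounded_clinear_id: "bounded_clinear id"
  unfolding bounded_clinear_def id_def by auto

lemma bounded_clinear_setsum:
  "(\<And>i. i \<in> A \<Longrightarrow> bounded_clinear (f i)) \<Longrightarrow> bounded_clinear (\<lambda>x. \<Sum>i\<in>A. f i x)"
  by (induction A rule: infinite_finite_induct) (auto intro: bounded_clinear_0 bounded_clinear_plus)

lemma bounded_clinear_funpow: "bounded_clinear (f :: 'a \<Rightarrow> 'a) \<Longrightarrow>
    bounded_clinear (f ^^ n :: 'a::{complex_vector,real_normed_vector} \<Rightarrow> 'a)"
  by (induction n) (auto intro: bounded_clinear_id bounded_clinear_comp)

text \<open>An adjoint is unique because the inner product is nondegenerate.\<close>

lemma adj_eqI:
  fixes f :: "'a::krein_space \<Rightarrow> 'b::krein_space"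
  assumes "\<And>x y. cinner (f x) y = cinner x (g y)"
  shows "adj f = g"
  unfolding adj_def
proof (rule the_equality)
  fix h assume "\<forall>x y. cinner (f x) y = cinner x (h y)"
  then show "h = g" using assms by (intro ext cinner_eqI) metis
qed (use assms in blast)

context
  fixes f :: "'a::krein_space \<Rightarrow> 'b::krein_space"
  assumes f: "bounded_clinear f"
begin

lemma cinner_adj_right: "cinner x (adj f y) = cinner (f x) y"
proof -
  obtain K where K: "0 \<le> K" "\<And>x. norm (f x) \<le> K * norm x" using bounded_clinear_bound[OF f] by blast
  have "\<exists>z. norm z \<le> K * norm y \<and> (\<forall>x\<in>UNIV. cinner (f x) y = cinner x z)" for y
  proof (rule Riesz_representation)
    show "cmod (cinner (f x) y) \<le> K * norm y * norm x" for x
      using Cauchy_Schwarz[of "f x" y] mult_right_mono[OF K(2)[of x], of "norm y"]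
      by (simp add: mult_ac)
  qed (use K in \<open>auto simp: bounded_clinear_simps[OF f] cinner_simps csubspace_def\<close>)
  then obtain g where "\<And>x y. cinner (f x) y = cinner x (g y)" by (metis UNIV_I)
  then show ?thesis using adj_eqI[of f g] by simp
qed

lemma cinner_adj_left: "cinner (adj f x) y = cinner x (f y)"
  by (metis cinner_adj_right cinner_commute)

lemma adj_norm_bound:
  assumes "\<And>x. norm (f x) \<le> K * norm x" and K: "0 \<le> K" shows "norm (adj f y) \<le> K * norm y"
proof (cases "adj f y = 0")
  case True
  then show ?thesis using K by simp
next
  case False
  \<comment> \<open>The norm of the adjoint vector is attained by pairing it with its image under \<open>\<J>\<close>.\<close>
  have "complex_of_real ((norm (adj f y))\<^sup>2) = cinner (f (\<J> (adj f y))) y"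
    unfolding cinner_adj_right[symmetric] by (rule cinner_J_self[symmetric])
  then have "(norm (adj f y))\<^sup>2 = cmod (cinner (f (\<J> (adj f y))) y)"
    by (metis abs_of_nonneg norm_of_real zero_le_power2)
  also have "\<dots> \<le> norm (f (\<J> (adj f y))) * norm y" by (rule Cauchy_Schwarz)
  also have "\<dots> \<le> K * norm (adj f y) * norm y"
    using assms(1)[of "\<J> (adj f y)"] by (intro mult_right_mono) auto
  finally have "norm (adj f y) * norm (adj f y) \<le> norm (adj f y) * (K * norm y)"
    by (simp add: power2_eq_square mult_ac)
  then show ?thesis using False by simp
qed

lemma bounded_clinear_adj: "bounded_clinear (adj f)"
proof -
  obtain K where K: "\<And>x. norm (f x) \<le> K * norm x" "0 \<le> K"
    using bounded_clinear_bound[OF f] by blast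
  show ?thesis
  proof (rule bounded_clinearI)
    show "adj f (x + y) = adj f x + adj f y" for x y
      by (rule cinner_eqI) (simp add: cinner_adj_right cinner_add_right)
    show "adj f (c *\<^sub>C x) = c *\<^sub>C adj f x" for c x
      by (rule cinner_eqI) (simp add: cinner_adj_right cinner_scaleC_right)
    show "norm (adj f y) \<le> K * norm y" for y by (rule adj_norm_bound[OF K])
  qed
qed

lemma adj_adj: "adj (adj f) = f"
  by (rule adj_eqI) (rule cinner_adj_left)

end

lemma adj_comp:
  assumes "bounded_clinear f" "bounded_clinear (g :: 'a::krein_space \<Rightarrow> 'b::krein_space)"
  shows "adj (f \<circ> g) = adj g \<circ> adj (f :: 'b \<Rightarrow> 'c::krein_space)"
  by (rule adj_eqI) (simp add: cinner_adj_right[OF assms(1)] cinner_adj_right[OF assms(2)])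

section \<open>Intertwining operators\<close>

text \<open>
  The inequality behind \<open>\<Theta>\<close>: with \<open>P = C\<^sup>* C\<close> and \<open>a n = \<parallel>T\<^sup>* P\<^sup>n x\<parallel>\<close> one has
  \<open>(a n)\<^sup>2 \<le> a (2 n) * a 0\<close>, because \<open>C\<close> commutes with \<open>T T\<^sup>*\<close>.  Iterating this along the powers of
  two compares \<open>a 1 / a 0\<close> with the growth of \<open>\<parallel>P\<^sup>n\<parallel>\<close>.
\<close>

lemma commuting_factor_estimate:
  fixes T :: "'v::chilbert_space \<Rightarrow> 'k::krein_space" and C :: "'k \<Rightarrow> 'k"
  assumes T: "bounded_clinear T" and C: "bounded_clinear C"
    and comm: "\<And>x. C (T (adj T x)) = T (adj T (C x))"
  shows "\<exists>M\<ge>0. \<forall>x. norm (adj T (C x)) \<le> M * norm (adj T x)"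
proof -
  note T' = bounded_clinear_adj[OF T]
  have sq: "(norm (adj T (D x)))\<^sup>2 \<le> norm (adj T (adj D (D x))) * norm (adj T x)"
    if D: "bounded_clinear D" and cD: "\<And>x. D (T (adj T x)) = T (adj T (D x))" for D :: "'k \<Rightarrow> 'k" and x
  proof -
    have cD': "adj D (T (adj T x)) = T (adj T (adj D x))" for x
      by (rule cinner_eqI)
        (simp add: cinner_adj_right[OF D] cinner_adj_right[OF T] flip: cinner_adj_left[OF T] cD)
    have "complex_of_real ((norm (adj T (D x)))\<^sup>2) = cinner (adj T (D x)) (adj T (D x))"
      by (rule cinner_norm[symmetric])
    also have "\<dots> = cinner (T (adj T (D x))) (D x)" by (rule cinner_adj_right[OF T])
    also have "\<dots> = cinner (adj D (T (adj T (D x)))) x" by (rule cinner_adj_left[OF D, symmetric])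
    also have "\<dots> = cinner (T (adj T (adj D (D x)))) x" by (simp only: cD')
    also have "\<dots> = cinner (adj T (adj D (D x))) (adj T x)" by (rule cinner_adj_right[OF T, symmetric])
    finally have "(norm (adj T (D x)))\<^sup>2 = cmod (cinner (adj T (adj D (D x))) (adj T x))"
      by (metis abs_of_nonneg norm_of_real zero_le_power2)
    then show ?thesis using Cauchy_Schwarz by metis
  qed
  define P where "P = adj C \<circ> C"
  have P: "bounded_clinear P"
    unfolding P_def by (intro bounded_clinear_comp bounded_clinear_adj C)
  have P': "adj P = P"
    unfolding P_def by (simp add: adj_comp bounded_clinear_adj C adj_adj)
  have cC': "adj C (T (adj T x)) = T (adj T (adj C x))" for x
    by (rule cinner_eqI)
      (simp add: cinner_adj_right[OF C] cinner_adj_right[OF T] flip: cinner_adj_left[OF T] comm)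
  have cP: "(P ^^ n) (T (adj T x)) = T (adj T ((P ^^ n) x))" for n x
    by (induction n) (simp_all add: P_def cC' comm)
  have Pn: "bounded_clinear (P ^^ n)" for n by (rule bounded_clinear_funpow[OF P])
  have Pn': "adj (P ^^ n) = P ^^ n" for n
  proof (induction n)
    case 0
    show ?case by (rule adj_eqI) simp
  next
    case (Suc n)
    have "adj (P ^^ Suc n) = adj (P ^^ n) \<circ> adj P" by (simp add: adj_comp P Pn)
    also have "\<dots> = P ^^ Suc n" by (simp add: Suc P' funpow_swap1 fun_eq_iff)
    finally show ?case .
  qed
  obtain c where c: "\<And>x. norm (P x) \<le> c * norm x" "0 \<le> c" using bounded_clinear_bound[OF P] by blast
  \<comment> \<open>A bound of \<open>P\<close> that is positive, since powers of \<open>t / \<pi>\<close> will be formed.\<close>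
  define \<pi> where "\<pi> = c + 1"
  have \<pi>: "norm (P x) \<le> \<pi> * norm x" "0 < \<pi>" for x
    using c(1)[of x] c(2) norm_ge_zero[of x] unfolding \<pi>_def distrib_right by linarith+
  have \<pi>n: "norm ((P ^^ n) x) \<le> \<pi> ^ n * norm x" for n x
  proof (induction n)
    case (Suc n)
    have "norm ((P ^^ Suc n) x) \<le> \<pi> * norm ((P ^^ n) x)" using \<pi>(1) by simp
    also have "\<dots> \<le> \<pi> * (\<pi> ^ n * norm x)" using Suc \<pi>(2) by (intro mult_left_mono) auto
    finally show ?case by (simp add: mult.assoc)
  qed simp
  obtain L where L: "\<And>x. norm (adj T x) \<le> L * norm x" "0 \<le> L" using bounded_clinear_bound[OF T'] by blast
  have P1: "norm (adj T (P x)) \<le> \<pi> * norm (adj T x)" for x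
  proof (cases "adj T x = 0")
    case True
    then show ?thesis using sq[OF Pn[of 1] cP[of 1], of x] by simp
  next
    case False
    define b where "b = norm (adj T x)"
    define t where "t = norm (adj T (P x)) / b"
    have b: "b > 0" unfolding b_def using False by simp
    \<comment> \<open>Squaring the estimate at stage \<open>k\<close> and dividing by \<open>b\<close> gives stage \<open>k + 1\<close>.\<close>
    have low: "t ^ (2 ^ k) * b \<le> norm (adj T ((P ^^ (2 ^ k)) x))" for k
    proof (induction k)
      case 0
      then show ?case using b unfolding t_def by simp
    next
      case (Suc k)
      have "(t ^ (2 ^ k) * b)\<^sup>2 \<le> (norm (adj T ((P ^^ (2 ^ k)) x)))\<^sup>2"
        using Suc b unfolding t_def by (intro power_mono) auto
      also have "\<dots> \<le> norm (adj T ((P ^^ (2 ^ k)) ((P ^^ (2 ^ k)) x))) * b"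
        using sq[OF Pn cP, of "2 ^ k" x] unfolding Pn' b_def .
      also have "(P ^^ (2 ^ k)) ((P ^^ (2 ^ k)) x) = (P ^^ (2 ^ Suc k)) x"
        by (simp add: mult_2 funpow_add)
      finally have "(t ^ (2 ^ Suc k) * b) * b \<le> norm (adj T ((P ^^ (2 ^ Suc k)) x)) * b"
        by (simp add: power2_eq_square mult_2 power_add mult_ac)
      then show ?case using b by simp
    qed
    have "t \<le> \<pi>"
    proof (rule ccontr)
      assume "\<not> t \<le> \<pi>"
      then have r: "1 < t / \<pi>" using \<pi>(2) by simp
      then obtain n where n: "L * norm x / b < (t / \<pi>) ^ n" using real_arch_pow by blast
      have "(t / \<pi>) ^ n \<le> (t / \<pi>) ^ (2 ^ n)" using r by (intro power_increasing) (auto intro: less_imp_le)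
      moreover have "t ^ (2 ^ n) * b \<le> L * (\<pi> ^ (2 ^ n) * norm x)"
        using low[of n] L(1)[of "(P ^^ (2 ^ n)) x"] mult_left_mono[OF \<pi>n[of "2 ^ n" x] L(2)] by linarith
      then have "(t / \<pi>) ^ (2 ^ n) \<le> L * norm x / b"
        using b \<pi>(2) by (simp add: power_divide field_simps)
      ultimately show False using n by linarith
    qed
    then show ?thesis using b unfolding t_def b_def by (simp add: divide_le_eq)
  qed
  have "norm (adj T (C x)) \<le> sqrt \<pi> * norm (adj T x)" for x
  proof -
    have "(norm (adj T (C x)))\<^sup>2 \<le> norm (adj T (P x)) * norm (adj T x)"
      using sq[OF C comm, of x] by (simp add: P_def)
    also have "\<dots> \<le> \<pi> * norm (adj T x) * norm (adj T x)" by (intro mult_right_mono P1) auto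
    also have "\<dots> = (sqrt \<pi> * norm (adj T x))\<^sup>2" using \<pi>(2) by (simp add: power_mult_distrib power2_eq_square)
    finally show ?thesis by (rule power2_le_imp_le) (use \<pi>(2) in auto)
  qed
  then show ?thesis using \<pi>(2) by (intro exI[of _ "sqrt \<pi>"]) auto
qed

definition intertwines :: "('v \<Rightarrow> 'k) \<Rightarrow> ('v::chilbert_space \<Rightarrow> 'v) \<Rightarrow> ('k::krein_space \<Rightarrow> 'k) \<Rightarrow> bool" where
  "intertwines T D C \<longleftrightarrow> bounded_clinear D \<and> (\<forall>v. T (D v) = C (T v))"

text \<open>
  Solving \<open>T w = C (T v)\<close> means representing the functional \<open>T\<^sup>* x \<mapsto> [C (T v), x]\<close> on the range of
  \<open>T\<^sup>*\<close>, which is bounded by the estimate for \<open>C\<^sup>*\<close>.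
\<close>

lemma intertwiner_exists:
  fixes T :: "'v::chilbert_space \<Rightarrow> 'k::krein_space" and C :: "'k \<Rightarrow> 'k"
  assumes T: "bounded_clinear T" and inj: "inj T" and C: "bounded_clinear C"
    and comm: "\<And>x. C (T (adj T x)) = T (adj T (C x))"
  shows "\<exists>D. intertwines T D C"
proof -
  note T' = bounded_clinear_adj[OF T] and C' = bounded_clinear_adj[OF C]
  have cC': "adj C (T (adj T x)) = T (adj T (adj C x))" for x
    by (rule cinner_eqI)
      (simp add: cinner_adj_right[OF C] cinner_adj_right[OF T] flip: cinner_adj_left[OF T] comm)
  obtain M where M: "0 \<le> M" "\<And>x. norm (adj T (adj C x)) \<le> M * norm (adj T x)"
    using commuting_factor_estimate[OF T C' cC'] by blast
  have ker: "adj T (adj C x) = adj T (adj C y)" if "adj T x = adj T y" for x y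
    using M(2)[of "x - y"] that by (simp add: bounded_clinear_simps[OF T'] bounded_clinear_simps[OF C'])
  have W: "csubspace (range (adj T))"
    unfolding csubspace_def
    by (auto simp flip: bounded_clinear_simps(1)[OF T'] bounded_clinear_simps(5)[OF T'])
      (metis bounded_clinear_zero[OF T'] rangeI)
  have "\<exists>w. norm w \<le> M * norm v \<and> T w = C (T v)" for v
  proof -
    \<comment> \<open>Well defined on the range of \<open>T\<^sup>*\<close> by \<open>ker\<close>, whichever preimage is chosen.\<close>
    define f where "f y = cinner (adj T (adj C (SOME x. adj T x = y))) v" for y
    have f: "f (adj T x) = cinner (adj T (adj C x)) v" for x
    proof -
      have "adj T (SOME z. adj T z = adj T x) = adj T x" by (rule someI[of _ x]) simp
      then show ?thesis unfolding f_def using ker by metis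
    qed
    have "\<exists>w. norm w \<le> M * norm v \<and> (\<forall>y\<in>range (adj T). f y = cinner y w)"
    proof (rule Riesz_representation[OF W])
      fix y z c assume "y \<in> range (adj T)"
      then obtain a where a: "y = adj T a" by blast
      show "f (c *\<^sub>C y) = c * f y"
        unfolding a using f[of "c *\<^sub>C a"] f[of a]
        by (simp add: bounded_clinear_simps[OF T'] bounded_clinear_simps[OF C'] cinner_simps)
      have "cmod (f y) \<le> norm (adj T (adj C a)) * norm v" unfolding a f by (rule Cauchy_Schwarz)
      also have "\<dots> \<le> M * norm y * norm v" unfolding a by (intro mult_right_mono M) auto
      finally show "cmod (f y) \<le> M * norm v * norm y" by (simp add: mult_ac)
      assume "z \<in> range (adj T)"
      then obtain b where b: "z = adj T b" by blast
      show "f (y + z) = f y + f z"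
        unfolding a b using f[of "a + b"] f[of a] f[of b]
        by (simp add: bounded_clinear_simps[OF T'] bounded_clinear_simps[OF C'] cinner_simps)
    qed (use M in simp)
    then obtain w where w: "norm w \<le> M * norm v" "\<And>x. f (adj T x) = cinner (adj T x) w" by blast
    have "T w = C (T v)"
    proof (rule cinner_eqI)
      fix x
      have "cinner x (T w) = cinner (adj T x) w" by (rule cinner_adj_left[OF T, symmetric])
      also have "\<dots> = cinner (adj T (adj C x)) v" using w(2)[of x] f[of x] by simp
      also have "\<dots> = cinner x (C (T v))" by (simp add: cinner_adj_left[OF T] cinner_adj_left[OF C])
      finally show "cinner x (T w) = cinner x (C (T v))" .
    qed
    then show ?thesis using w by blast
  qed
  then obtain D where D: "\<And>v. norm (D v) \<le> M * norm v" "\<And>v. T (D v) = C (T v)" by metis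
  have "bounded_clinear D"
  proof (rule bounded_clinearI)
    show "D (x + y) = D x + D y" for x y
      by (rule injD[OF inj]) (simp add: D(2) bounded_clinear_simps[OF T] bounded_clinear_simps[OF C])
    show "D (c *\<^sub>C x) = c *\<^sub>C D x" for c x
      by (rule injD[OF inj]) (simp add: D(2) bounded_clinear_simps[OF T] bounded_clinear_simps[OF C])
  qed (rule D(1))
  then show ?thesis using D(2) unfolding intertwines_def by blast
qed

context
  fixes T :: "'v::chilbert_space \<Rightarrow> 'k::krein_space"
  assumes T: "bounded_clinear T" and inj: "inj T"
begin

lemma intertwines_unique: "intertwines T D C \<Longrightarrow> intertwines T D' C \<Longrightarrow> D = D'"
  unfolding intertwines_def by (auto intro!: ext injD[OF inj])

lemma intertwines_Theta:
  assumes "bounded_clinear C" "\<And>x. C (T (adj T x)) = T (adj T (C x))"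
  shows "intertwines T (Theta T C) C"
proof -
  obtain D where D: "intertwines T D C" using intertwiner_exists[OF T inj assms] by blast
  have "Theta T C = D"
    unfolding Theta_def
  proof (rule the_equality)
    show "bounded_clinear D \<and> T \<circ> D = C \<circ> T" using D unfolding intertwines_def by auto
    fix D' assume "bounded_clinear D' \<and> T \<circ> D' = C \<circ> T"
    then have "intertwines T D' C" unfolding intertwines_def by (auto simp: fun_eq_iff)
    then show "D' = D" using D intertwines_unique by blast
  qed
  then show ?thesis using D by simp
qed

text \<open>
  Injectivity of \<open>T\<close> means that \<open>T\<^sup>*\<close> has dense range; passing to adjoints uses this without
  mentioning closures.
\<close>

lemma eq_on_range_adj:
  fixes D D' :: "'v \<Rightarrow> 'v"
  assumes D: "bounded_clinear D" "bounded_clinear D'" and e: "\<And>x. T (D (adj T x)) = T (D' (adj T x))"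
  shows "D = D'"
proof
  fix v
  show "D v = D' v"
  proof (rule cinner_eqI)
    fix z
    have "T (adj D z) = T (adj D' z)"
      by (rule cinner_eqI)
        (use e in \<open>simp add: injD[OF inj] cinner_adj_right[OF D(1)] cinner_adj_right[OF D(2)]
          injD[OF inj, OF e] flip: cinner_adj_left[OF T]\<close>)
    then have "adj D z = adj D' z" by (rule injD[OF inj])
    then show "cinner z (D v) = cinner z (D' v)"
      by (simp flip: cinner_adj_left[OF D(1)] cinner_adj_left[OF D(2)])
  qed
qed

lemma intertwines_adj_T:
  assumes "intertwines T D C" and "\<And>x. C (T (adj T x)) = T (adj T (C x))"
  shows "D (adj T x) = adj T (C x)"
  using assms unfolding intertwines_def by (auto intro!: injD[OF inj])

lemma intertwines_adj:
  assumes i: "intertwines T D C" and C: "bounded_clinear C"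
    and c: "\<And>x. C (T (adj T x)) = T (adj T (C x))"
  shows "intertwines T (adj D) (adj C)"
  unfolding intertwines_def
proof (intro conjI allI)
  have D: "bounded_clinear D" using i unfolding intertwines_def by blast
  then show "bounded_clinear (adj D)" by (rule bounded_clinear_adj)
  fix v
  show "T (adj D v) = adj C (T v)"
    by (rule cinner_eqI)
      (simp add: cinner_adj_right[OF C] intertwines_adj_T[OF i c] cinner_adj_right[OF D]
        flip: cinner_adj_left[OF T])
qed

end

section \<open>The spectrum is compact\<close>

text \<open>
  Closedness and boundedness of the spectrum both follow from stability of invertibility under
  small perturbations. The contraction principle gives it in place of the Neumann series.
\<close>

lemma small_perturbation_invertible:
  fixes A :: "'v::krein_space \<Rightarrow> 'v"
  assumes A: "bounded_clinear A" and S: "bounded_clinear S" and SA: "\<And>x. S (A x) = x" and AS: "\<And>x. A (S x) = x"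
    and K: "\<And>x. norm (S x) \<le> K * norm x" "0 \<le> K"
    and H: "bounded_clinear H" and c: "\<And>x. norm (H x) \<le> c * norm x" "K * c < 1" "0 \<le> c"
  shows "\<exists>S'. bounded_clinear S' \<and> S' \<circ> (\<lambda>x. A x - H x) = id \<and> (\<lambda>x. A x - H x) \<circ> S' = id"
proof -
  have contr: "norm (S (H x)) \<le> K * c * norm x" for x
    using K(1)[of "H x"] mult_left_mono[OF c(1)[of x] K(2)] by (simp add: mult.assoc)
  \<comment> \<open>\<open>(A - H) x = y\<close> is the fixed point equation \<open>x = S (y + H x)\<close>.\<close>
  have fix_iff: "A x - H x = y \<longleftrightarrow> S (y + H x) = x" for x y
  proof
    assume "S (y + H x) = x"
    then have "A x = y + H x" using AS by metis
    then show "A x - H x = y" by simp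
  qed (use SA in auto)
  have "\<exists>!x. S (y + H x) = x" for y
  proof (rule banach_fix_type[of "K * c"])
    show "\<forall>x x'. dist (S (y + H x)) (S (y + H x')) \<le> K * c * dist x x'"
    proof (intro allI)
      fix x x'
      have "S (y + H x) - S (y + H x') = S (H (x - x'))"
        by (simp add: bounded_clinear_simps[OF S] bounded_clinear_simps[OF H])
      then show "dist (S (y + H x)) (S (y + H x')) \<le> K * c * dist x x'"
        using contr[of "x - x'"] by (simp add: dist_norm)
    qed
  qed (use K c in auto)
  then have ex1: "\<exists>!x. A x - H x = y" for y unfolding fix_iff .
  then obtain S' where S': "\<And>y. A (S' y) - H (S' y) = y" by metis
  have uniq: "A x - H x = y \<Longrightarrow> S' y = x" for x y using ex1 S' by blast
  have "bounded_clinear S'"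
  proof (rule bounded_clinearI)
    fix x y c
    show "S' (x + y) = S' x + S' y"
      by (rule uniq) (use S'[of x] S'[of y] in
        \<open>simp add: bounded_clinear_simps[OF A] bounded_clinear_simps[OF H] algebra_simps\<close>)
    show "S' (c *\<^sub>C x) = c *\<^sub>C S' x"
      by (rule uniq) (use S'[of x] in
        \<open>simp add: bounded_clinear_simps[OF A] bounded_clinear_simps[OF H] flip: scaleC_diff_right\<close>)
  next
    fix y
    have "S' y = S y + S (H (S' y))" using S'[of y] unfolding fix_iff
      by (simp add: bounded_clinear_simps[OF S])
    then have "norm (S' y) \<le> K * norm y + K * c * norm (S' y)"
      using norm_triangle_ineq[of "S y" "S (H (S' y))"] K(1)[of y] contr[of "S' y"] by simp
    then have "(1 - K * c) * norm (S' y) \<le> K * norm y" by (simp add: algebra_simps)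
    then show "norm (S' y) \<le> K / (1 - K * c) * norm y" using c(2) by (simp add: field_simps)
  qed
  then show ?thesis using S' uniq by (intro exI[of _ S']) (auto simp: fun_eq_iff)
qed

lemma not_in_spectrumD:
  assumes "z \<notin> spectrum D"
  obtains S where "bounded_clinear S" "\<And>x. S (D x - z *\<^sub>C x) = x" "\<And>x. D (S x) - z *\<^sub>C S x = x"
  using assms unfolding spectrum_def by (auto simp: fun_eq_iff)

lemma bounded_spectrum:
  fixes D :: "'v::krein_space \<Rightarrow> 'v"
  assumes D: "bounded_clinear D"
  shows "bounded (spectrum D)"
proof -
  obtain M where M: "\<And>x. norm (D x) \<le> M * norm x" "0 \<le> M" using bounded_clinear_bound[OF D] by blast
  have "cmod z \<le> M" if z: "z \<in> spectrum D" for z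
  proof (rule ccontr)
    assume "\<not> cmod z \<le> M"
    then have zM: "M < cmod z" and z0: "z \<noteq> 0" using M(2) by auto
    have "\<exists>S'. bounded_clinear S' \<and> S' \<circ> (\<lambda>x. (- z) *\<^sub>C x - (- D x)) = id \<and> (\<lambda>x. (- z) *\<^sub>C x - (- D x)) \<circ> S' = id"
    proof (rule small_perturbation_invertible[where S = "\<lambda>x. (- 1 / z) *\<^sub>C x" and K = "1 / cmod z" and c = M])
      have "bounded_clinear (\<lambda>x. (- 1) *\<^sub>C D x)" by (rule bounded_clinear_scale[OF D])
      then show "bounded_clinear (\<lambda>x. - D x)" by (simp add: scaleC_one)
      show "bounded_clinear (\<lambda>x::'v. (- z) *\<^sub>C x)" "bounded_clinear (\<lambda>x::'v. (- 1 / z) *\<^sub>C x)"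
        by (rule bounded_clinear_scale[OF bounded_clinear_ident])+
    qed (use z0 zM M in \<open>auto simp: scaleC_scaleC scaleC_one norm_divide\<close>)
    then show False using z unfolding spectrum_def by auto
  qed
  then show ?thesis by (auto intro: boundedI)
qed

lemma closed_spectrum:
  fixes D :: "'v::krein_space \<Rightarrow> 'v"
  assumes D: "bounded_clinear D"
  shows "closed (spectrum D)"
proof -
  have "\<exists>e>0. ball z e \<subseteq> - spectrum D" if zn: "z \<notin> spectrum D" for z
  proof -
    obtain S where S: "bounded_clinear S" "\<And>x. S (D x - z *\<^sub>C x) = x" "\<And>x. D (S x) - z *\<^sub>C S x = x"
      using not_in_spectrumD[OF zn] by blast
    obtain K where K: "\<And>x. norm (S x) \<le> K * norm x" "0 \<le> K" using bounded_clinear_bound[OF S(1)] by blast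
    have "w \<notin> spectrum D" if w: "dist z w < 1 / (K + 1)" for w
    proof -
      have "K * cmod (w - z) \<le> K * (1 / (K + 1))"
        using w K(2) by (intro mult_left_mono) (auto simp: dist_norm norm_minus_commute)
      also have "\<dots> < 1" using K(2) by (simp add: field_simps)
      finally have lt: "K * cmod (w - z) < 1" .
      have "\<exists>S'. bounded_clinear S' \<and> S' \<circ> (\<lambda>x. (D x - z *\<^sub>C x) - (w - z) *\<^sub>C x) = id \<and>
          (\<lambda>x. (D x - z *\<^sub>C x) - (w - z) *\<^sub>C x) \<circ> S' = id"
        by (rule small_perturbation_invertible[where S = S and K = K and c = "cmod (w - z)"])
          (use S K lt in \<open>auto intro!: bounded_clinear_sub bounded_clinear_scale bounded_clinear_ident D\<close>)
      moreover have "(D x - z *\<^sub>C x) - (w - z) *\<^sub>C x = D x - w *\<^sub>C x" for x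
        by (simp add: scaleC_diff_left)
      ultimately show ?thesis unfolding spectrum_def by auto
    qed
    then show ?thesis using K(2) by (intro exI[of _ "1 / (K + 1)"]) auto
  qed
  then have "open (- spectrum D)" unfolding open_contains_ball by blast
  then show ?thesis by (simp add: closed_def)
qed

section \<open>Bounded Borel functional calculus of a spectral measure\<close>

definition bounded_borel :: "(complex \<Rightarrow> complex) \<Rightarrow> bool" where
  "bounded_borel f \<longleftrightarrow> f \<in> borel_measurable borel \<and> bounded (range f)"

lemma bounded_borel_measurable: "bounded_borel f \<Longrightarrow> f \<in> borel_measurable borel"
  unfolding bounded_borel_def by simp

lemma bounded_borel_bound: "bounded_borel f \<Longrightarrow> \<exists>M\<ge>0. \<forall>z. cmod (f z) \<le> M"
proof -
  assume "bounded_borel f"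
  then obtain M where "\<And>z. cmod (f z) \<le> M" unfolding bounded_borel_def bounded_iff by auto
  then show ?thesis by (intro exI[of _ "max M 0"]) (auto simp: le_max_iff_disj)
qed

lemma bounded_borelI:
  "f \<in> borel_measurable borel \<Longrightarrow> (\<And>z. cmod (f z) \<le> M) \<Longrightarrow> bounded_borel f"
  unfolding bounded_borel_def by (auto intro: boundedI)

lemma bounded_borel_indicator: "\<Delta> \<in> sets borel \<Longrightarrow> bounded_borel (indicator \<Delta>)"
  by (rule bounded_borelI[of _ 1]) (auto simp: indicator_def)

lemma bounded_borel_const: "bounded_borel (\<lambda>z. c)"
  by (rule bounded_borelI[of _ "cmod c"]) auto

lemma bounded_borel_add: "bounded_borel f \<Longrightarrow> bounded_borel g \<Longrightarrow> bounded_borel (\<lambda>z. f z + g z)"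
  unfolding bounded_borel_def by (auto intro: bounded_plus_comp)

lemma bounded_borel_mult:
  assumes "bounded_borel f" "bounded_borel g" shows "bounded_borel (\<lambda>z. f z * g z)"
proof -
  obtain A B where "\<And>z. cmod (f z) \<le> A" "\<And>z. cmod (g z) \<le> B" "0 \<le> A"
    using bounded_borel_bound assms by metis
  then show ?thesis
    by (intro bounded_borelI[of _ "A * B"])
      (use assms in \<open>auto simp: norm_mult intro!: mult_mono borel_measurable_times
        dest!: bounded_borel_measurable\<close>)
qed

lemma bounded_borel_scale: "bounded_borel f \<Longrightarrow> bounded_borel (\<lambda>z. c * f z)"
  by (rule bounded_borel_mult[OF bounded_borel_const])

lemma bounded_borel_cnj: "bounded_borel f \<Longrightarrow> bounded_borel (\<lambda>z. cnj (f z))"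
proof -
  assume f: "bounded_borel f"
  obtain M where "\<And>z. cmod (f z) \<le> M" using bounded_borel_bound[OF f] by blast
  then show ?thesis
    by (intro bounded_borelI[of _ M])
      (auto intro!: borel_measurable_continuous_on[of cnj] continuous_intros bounded_borel_measurable[OF f])
qed

lemma bounded_borel_diff: "bounded_borel f \<Longrightarrow> bounded_borel g \<Longrightarrow> bounded_borel (\<lambda>z. f z - g z)"
  using bounded_borel_add[of f "\<lambda>z. - 1 * g z"] bounded_borel_scale[of g "- 1"] by simp

lemma bounded_borel_power: "bounded_borel f \<Longrightarrow> bounded_borel (\<lambda>z. f z ^ n)"
  by (induction n) (auto intro: bounded_borel_const bounded_borel_mult)

lemma bounded_borel_sum:
  "(\<And>i. i \<in> A \<Longrightarrow> bounded_borel (f i)) \<Longrightarrow> bounded_borel (\<lambda>z. \<Sum>i\<in>A. f i z)"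
  by (induction A rule: infinite_finite_induct) (auto intro: bounded_borel_const bounded_borel_add)

lemma superlevel_set_borel: "bounded_borel f \<Longrightarrow> {z. r \<le> cmod (f z)} \<in> sets borel"
  and sublevel_set_borel: "bounded_borel f \<Longrightarrow> {z. cmod (f z) \<le> r} \<in> sets borel"
proof -
  assume f: "bounded_borel f"
  note [measurable] = bounded_borel_measurable[OF f]
  have "{z \<in> space borel. r \<le> cmod (f z)} \<in> sets borel" "{z \<in> space borel. cmod (f z) \<le> r} \<in> sets borel"
    by measurable
  then show "{z. r \<le> cmod (f z)} \<in> sets borel" "{z. cmod (f z) \<le> r} \<in> sets borel" by simp_all
qed

text \<open>
  Rounding real and imaginary part down to multiples of \<open>1 / (n + 1)\<close> approximates a bounded
  function uniformly by functions with finitely many values.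
\<close>

lemma bounded_borel_induct [consumes 1, case_names indicator add scale limit]:
  assumes f: "bounded_borel f"
    and ind: "\<And>\<Delta>. \<Delta> \<in> sets borel \<Longrightarrow> P (indicator \<Delta>)"
    and add: "\<And>f g. bounded_borel f \<Longrightarrow> bounded_borel g \<Longrightarrow> P f \<Longrightarrow> P g \<Longrightarrow> P (\<lambda>z. f z + g z)"
    and scale: "\<And>c f. bounded_borel f \<Longrightarrow> P f \<Longrightarrow> P (\<lambda>z. c * f z)"
    and lim: "\<And>f F. bounded_borel f \<Longrightarrow> (\<And>n. bounded_borel (F n)) \<Longrightarrow> (\<And>n. P (F n)) \<Longrightarrow>
      (\<And>n z. cmod (F n z - f z) \<le> 2 / real (Suc n)) \<Longrightarrow> P f"
  shows "P f"
proof -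
  have fm: "f \<in> borel_measurable borel" using bounded_borel_measurable[OF f] .
  obtain M where M: "\<And>z. cmod (f z) \<le> M" "0 \<le> M" using bounded_borel_bound[OF f] by blast
  define a where "a n z = \<lfloor>real (Suc n) * Re (f z)\<rfloor>" for n z
  define b where "b n z = \<lfloor>real (Suc n) * Im (f z)\<rfloor>" for n z
  define val where "val n i j = Complex (real_of_int i / real (Suc n)) (real_of_int j / real (Suc n))"
    for n i j
  define F where "F n z = val n (a n z) (b n z)" for n z
  define X where "X n i j = {z. a n z = i \<and> b n z = j}" for n i j
  define K where "K n = \<lceil>real (Suc n) * M\<rceil> + 1" for n
  have Xb: "X n i j \<in> sets borel" for n i j
  proof -
    have "{z \<in> space borel. a n z = i \<and> b n z = j} \<in> sets borel"
      unfolding a_def b_def using fm by measurable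
    then show ?thesis unfolding X_def by simp
  qed
  have fl_le: "\<lfloor>t\<rfloor> \<in> {- (\<lceil>m\<rceil> + 1)..\<lceil>m\<rceil> + 1}" if "\<bar>t\<bar> \<le> m" for t m :: real
    unfolding atLeastAtMost_iff using that by linarith
  have rng: "x \<in> {- K n..K n}" if "x = \<lfloor>real (Suc n) * y\<rfloor>" "\<bar>y\<bar> \<le> M" for x n y
    unfolding that(1) K_def by (rule fl_le) (use that(2) in \<open>simp add: abs_mult mult_left_mono\<close>)
  have inK: "a n z \<in> {- K n..K n}" "b n z \<in> {- K n..K n}" for n z
    by (rule rng[OF a_def], use abs_Re_le_cmod[of "f z"] M(1)[of z] in simp)
      (rule rng[OF b_def], use abs_Im_le_cmod[of "f z"] M(1)[of z] in simp)
  have step: "bounded_borel (\<lambda>z. \<Sum>x\<in>A. c x * indicator (Y x) z) \<and> P (\<lambda>z. \<Sum>x\<in>A. c x * indicator (Y x) z)"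
    if "finite A" "\<And>x. Y x \<in> sets borel" for A :: "(int \<times> int) set" and c Y
    using that(1)
  proof (induction A rule: finite_induct)
    case empty
    have "P (\<lambda>z. 0 * indicator {} z)" by (rule scale[OF bounded_borel_indicator ind]) auto
    then show ?case by (simp add: bounded_borel_const)
  next
    case (insert x A)
    have s: "bounded_borel (\<lambda>z. c x * indicator (Y x) z)" "P (\<lambda>z. c x * indicator (Y x) z)"
      by (auto intro!: scale bounded_borel_scale bounded_borel_indicator ind that(2))
    show ?case
      unfolding sum.insert[OF insert(1,2)] using bounded_borel_add[OF s(1)] add[OF s(1) _ s(2)] insert(3) by blast
  qed
  have Feq: "F n = (\<lambda>z. \<Sum>x\<in>{- K n..K n} \<times> {- K n..K n}. (case x of (i, j) \<Rightarrow> val n i j) * indicator (case x of (i, j) \<Rightarrow> X n i j) z)" for n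
  proof
    fix z
    have "F n z = (\<Sum>x\<in>{- K n..K n} \<times> {- K n..K n}. if x = (a n z, b n z) then val n (a n z) (b n z) else 0)"
      using inK[where n = n and z = z] by (subst sum.delta) (auto simp: F_def)
    also have "\<dots> = (\<Sum>x\<in>{- K n..K n} \<times> {- K n..K n}. (case x of (i, j) \<Rightarrow> val n i j) * indicator (case x of (i, j) \<Rightarrow> X n i j) z)"
      by (rule sum.cong) (auto simp: X_def indicator_def)
    finally show "F n z = \<dots>" .
  qed
  have "bounded_borel (F n) \<and> P (F n)" for n
    unfolding Feq by (rule step) (auto simp: Xb split: prod.split)
  moreover have "cmod (F n z - f z) \<le> 2 / real (Suc n)" for n z
  proof -
    have fl: "\<bar>real_of_int \<lfloor>real (Suc n) * y\<rfloor> / real (Suc n) - y\<bar> \<le> 1 / real (Suc n)" for y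
    proof -
      have "\<bar>real_of_int \<lfloor>real (Suc n) * y\<rfloor> - real (Suc n) * y\<bar> \<le> 1" by linarith
      moreover have eq: "real_of_int \<lfloor>real (Suc n) * y\<rfloor> / real (Suc n) - y
          = (real_of_int \<lfloor>real (Suc n) * y\<rfloor> - real (Suc n) * y) / real (Suc n)"
        by (simp add: field_simps)
      ultimately show ?thesis unfolding eq abs_divide by (simp add: divide_right_mono)
    qed
    have "cmod (F n z - f z) \<le> \<bar>Re (F n z - f z)\<bar> + \<bar>Im (F n z - f z)\<bar>" by (rule cmod_le)
    also have "\<dots> \<le> 1 / real (Suc n) + 1 / real (Suc n)"
      unfolding F_def val_def a_def b_def using fl[of "Re (f z)"] fl[of "Im (f z)"] by (intro add_mono) auto
    finally show ?thesis by simp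
  qed
  ultimately show ?thesis using lim[OF f] by blast
qed

text \<open>
  A spectral integral is given by its quadratic form only.  Polarization recovers the operator, and
  its norm up to a factor \<open>2\<close>; the factor disappears in \<open>norm_I_le\<close>, once the integral is known to be
  multiplicative.
\<close>

lemma polarization:
  fixes X :: "'v::chilbert_space \<Rightarrow> 'v"
  assumes X: "bounded_clinear X"
  shows "4 * cinner (X u) v = cinner (X (u + v)) (u + v) - cinner (X (u - v)) (u - v)
     + \<i> * cinner (X (u + \<i> *\<^sub>C v)) (u + \<i> *\<^sub>C v) - \<i> * cinner (X (u - \<i> *\<^sub>C v)) (u - \<i> *\<^sub>C v)"
  by (simp add: bounded_clinear_simps[OF X] cinner_simps algebra_simps)

lemma quadratic_form_bound:
  fixes X :: "'v::chilbert_space \<Rightarrow> 'v"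
  assumes X: "bounded_clinear X" and q: "\<And>u. cmod (cinner (X u) u) \<le> M * (norm u)\<^sup>2"
  shows "norm (X u) \<le> 2 * M * norm u"
proof (cases "X u = 0 \<or> u = 0")
  case True
  moreover have "0 \<le> M * norm u"
  proof (cases "u = 0")
    case False
    have "0 \<le> M * (norm u)\<^sup>2" using q[of u] norm_ge_zero order_trans by blast
    then show ?thesis using False by (simp add: zero_le_mult_iff)
  qed simp
  ultimately show ?thesis using bounded_clinear_zero[OF X] by auto
next
  case False
  have nsq: "(norm w)\<^sup>2 = Re (cinner w w)" for w :: 'v unfolding cinner_norm by simp
  have est: "cmod (cinner (X u) v) \<le> M * ((norm u)\<^sup>2 + (norm v)\<^sup>2)" for v
  proof -
    have "cmod (4 * cinner (X u) v) \<le> M * (norm (u + v))\<^sup>2 + M * (norm (u - v))\<^sup>2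
        + M * (norm (u + \<i> *\<^sub>C v))\<^sup>2 + M * (norm (u - \<i> *\<^sub>C v))\<^sup>2"
      unfolding polarization[OF X]
      using norm_triangle_ineq4[of "cinner (X (u + v)) (u + v) - cinner (X (u - v)) (u - v)
           + \<i> * cinner (X (u + \<i> *\<^sub>C v)) (u + \<i> *\<^sub>C v)" "\<i> * cinner (X (u - \<i> *\<^sub>C v)) (u - \<i> *\<^sub>C v)"]
        norm_triangle_ineq[of "cinner (X (u + v)) (u + v) - cinner (X (u - v)) (u - v)"
           "\<i> * cinner (X (u + \<i> *\<^sub>C v)) (u + \<i> *\<^sub>C v)"]
        norm_triangle_ineq4[of "cinner (X (u + v)) (u + v)" "cinner (X (u - v)) (u - v)"]
        q[of "u + v"] q[of "u - v"] q[of "u + \<i> *\<^sub>C v"] q[of "u - \<i> *\<^sub>C v"]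
      by (simp add: norm_mult)
    also have "\<dots> = M * ((norm (u + v))\<^sup>2 + (norm (u - v))\<^sup>2
        + (norm (u + \<i> *\<^sub>C v))\<^sup>2 + (norm (u - \<i> *\<^sub>C v))\<^sup>2)" by (simp add: algebra_simps)
    also have "(norm (u + v))\<^sup>2 + (norm (u - v))\<^sup>2 + (norm (u + \<i> *\<^sub>C v))\<^sup>2 + (norm (u - \<i> *\<^sub>C v))\<^sup>2
        = 4 * ((norm u)\<^sup>2 + (norm v)\<^sup>2)"
      unfolding nsq by (simp add: cinner_simps algebra_simps)
    finally show ?thesis by (simp add: norm_mult algebra_simps)
  qed
  \<comment> \<open>Test against the multiple of \<open>X u\<close> that has the norm of \<open>u\<close>.\<close>
  define c where "c = complex_of_real (norm u / norm (X u))"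
  have "cinner (X u) (c *\<^sub>C X u) = complex_of_real (norm u * norm (X u))"
    using False unfolding c_def by (simp add: cinner_simps cinner_norm power2_eq_square)
  then have "norm u * norm (X u) \<le> M * ((norm u)\<^sup>2 + (norm (c *\<^sub>C X u))\<^sup>2)"
    using est[of "c *\<^sub>C X u"] by (simp add: norm_mult flip: of_real_mult)
  also have "norm (c *\<^sub>C X u) = norm u" using False unfolding c_def by (simp add: norm_divide)
  finally have "norm u * norm (X u) \<le> norm u * (2 * M * norm u)"
    by (simp add: power2_eq_square mult_ac)
  then show ?thesis using False by simp
qed

locale spectral_resolution =
  fixes E :: "complex set \<Rightarrow> 'v::chilbert_space \<Rightarrow> 'v"
  assumes pvm: "projection_valued_measure E"
begin

lemma E_clinear: "\<Delta> \<in> sets borel \<Longrightarrow> bounded_clinear (E \<Delta>)"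
  and E_adj: "\<Delta> \<in> sets borel \<Longrightarrow> adj (E \<Delta>) = E \<Delta>"
  and E_UNIV: "E UNIV = id"
  and E_sums: "range X \<subseteq> sets borel \<Longrightarrow> disjoint_family X \<Longrightarrow> (\<lambda>i::nat. E (X i) u) sums E (\<Union>i. X i) u"
  using pvm unfolding projection_valued_measure_def by auto

lemma E_Int: "\<Delta> \<in> sets borel \<Longrightarrow> \<Delta>' \<in> sets borel \<Longrightarrow> E \<Delta> (E \<Delta>' u) = E (\<Delta> \<inter> \<Delta>') u"
  using pvm unfolding projection_valued_measure_def by (auto simp: fun_eq_iff)

lemma E_quadratic:
  assumes "\<Delta> \<in> sets borel" shows "cinner (E \<Delta> u) u = complex_of_real ((norm (E \<Delta> u))\<^sup>2)"
  by (metis E_Int E_adj E_clinear Int_absorb assms cinner_adj_right cinner_norm)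

lemma E_empty: "E {} u = 0"
proof -
  have "(\<lambda>i::nat. E {} u) sums E {} u" using E_sums[of "\<lambda>i. {}" u] by (simp add: disjoint_family_on_def)
  from sums_summable[OF this] summable_LIMSEQ_zero have "(\<lambda>i::nat. E {} u) \<longlonglongrightarrow> 0" by blast
  then show ?thesis by (simp add: LIMSEQ_const_iff)
qed

abbreviation mu :: "'v \<Rightarrow> complex measure" ("\<mu>") where "\<mu> \<equiv> scalar_measure E"

lemma sets_mu [simp, measurable_cong]: "sets (\<mu> u) = sets borel" and space_mu [simp]: "space (\<mu> u) = UNIV"
  unfolding scalar_measure_def using sets.sigma_sets_eq[of borel] by (auto simp: sets_measure_of_conv space_measure_of_conv)

lemma emeasure_mu: "\<Delta> \<in> sets borel \<Longrightarrow> emeasure (\<mu> u) \<Delta> = ennreal ((norm (E \<Delta> u))\<^sup>2)"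
proof -
  assume D: "\<Delta> \<in> sets borel"
  have sa: "sigma_algebra UNIV (sets (borel :: complex measure))"
    using sets.sigma_algebra_axioms[of borel] by simp
  have "emeasure (measure_of UNIV (sets borel) (\<lambda>\<Delta>. ennreal (Re (cinner (E \<Delta> u) u)))) \<Delta>
     = ennreal (Re (cinner (E \<Delta> u) u))"
  proof (rule emeasure_measure_of_sigma[OF sa _ _ D])
    show "positive (sets borel) (\<lambda>\<Delta>. ennreal (Re (cinner (E \<Delta> u) u)))"
      by (simp add: positive_def E_empty)
    show "countably_additive (sets borel) (\<lambda>\<Delta>. ennreal (Re (cinner (E \<Delta> u) u)))"
      unfolding countably_additive_def
    proof (intro allI impI)
      fix X :: "nat \<Rightarrow> complex set"
      assume X: "range X \<subseteq> sets borel" "disjoint_family X"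
      have "(\<lambda>i. cinner (E (X i) u) u) sums cinner (E (\<Union>i. X i) u) u"
        by (rule bounded_linear.sums[OF bounded_bilinear.bounded_linear_left[OF bounded_bilinear_cinner] E_sums[OF X]])
      from bounded_linear.sums[OF bounded_linear_Re this]
      have "(\<lambda>i. Re (cinner (E (X i) u) u)) sums Re (cinner (E (\<Union>i. X i) u) u)" .
      moreover have "0 \<le> Re (cinner (E (X i) u) u)" for i
        using X(1) by (subst E_quadratic) auto
      ultimately show "(\<Sum>i. ennreal (Re (cinner (E (X i) u) u))) = ennreal (Re (cinner (E (\<Union>i. X i) u) u))"
        by (intro suminf_ennreal_eq) auto
    qed
  qed
  then show ?thesis unfolding scalar_measure_def by (simp add: E_quadratic[OF D])
qed

lemma finite_measure_mu: "finite_measure (\<mu> u)"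
  by (rule finite_measureI) (simp add: emeasure_mu)

lemma measure_mu: "\<Delta> \<in> sets borel \<Longrightarrow> measure (\<mu> u) \<Delta> = (norm (E \<Delta> u))\<^sup>2"
  by (simp add: measure_def emeasure_mu)

lemma integrable_mu: "bounded_borel f \<Longrightarrow> integrable (\<mu> u) f"
  using bounded_borel_bound[of f] bounded_borel_measurable[of f] finite_measure_mu
  by (auto intro!: finite_measure.integrable_const_bound)

lemma norm_integral_mu:
  assumes f: "bounded_borel f" and M: "\<And>z. cmod (f z) \<le> M"
  shows "cmod (integral\<^sup>L (\<mu> u) f) \<le> M * (norm u)\<^sup>2"
proof -
  have "cmod (integral\<^sup>L (\<mu> u) f) \<le> (\<integral>z. cmod (f z) \<partial>\<mu> u)" by (rule integral_norm_bound)
  also have "\<dots> \<le> (\<integral>z. M \<partial>\<mu> u)"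
    using f integrable_mu[OF f, of u] finite_measure.integrable_const[OF finite_measure_mu]
    by (intro integral_mono) (auto simp: M)
  also have "\<dots> = M * (norm u)\<^sup>2"
    using measure_mu[of UNIV u] by (simp add: E_UNIV)
  finally show ?thesis .
qed

abbreviation SI :: "(complex \<Rightarrow> complex) \<Rightarrow> ('v \<Rightarrow> 'v) \<Rightarrow> bool" where
  "SI \<equiv> has_spectral_integral E UNIV"

lemma SI_iff: "SI f X \<longleftrightarrow> bounded_clinear X \<and> (\<forall>u. cinner (X u) u = integral\<^sup>L (\<mu> u) f)"
  unfolding has_spectral_integral_def set_lebesgue_integral_def by simp

lemma SI_norm:
  assumes "SI f X" "bounded_borel f" "\<And>z. cmod (f z) \<le> M"
  shows "norm (X u) \<le> 2 * M * norm u"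
  using assms norm_integral_mu[OF assms(2,3)] unfolding SI_iff by (intro quadratic_form_bound) auto

lemma SI_add: "SI f X \<Longrightarrow> SI g Y \<Longrightarrow> bounded_borel f \<Longrightarrow> bounded_borel g \<Longrightarrow> SI (\<lambda>z. f z + g z) (\<lambda>u. X u + Y u)"
  unfolding SI_iff by (auto simp: integrable_mu cinner_add_left intro: bounded_clinear_plus)

lemma SI_scale: "SI f X \<Longrightarrow> SI (\<lambda>z. c * f z) (\<lambda>u. c *\<^sub>C X u)"
  unfolding SI_iff by (auto simp: cinner_scaleC_left intro: bounded_clinear_scale)

lemma SI_diff:
  assumes "SI f X" "SI g Y" "bounded_borel f" "bounded_borel g"
  shows "SI (\<lambda>z. f z - g z) (\<lambda>u. X u - Y u)"
  using SI_add[OF assms(1) SI_scale[OF assms(2), of "- 1"] assms(3) bounded_borel_scale[OF assms(4)]]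
  by (simp add: scaleC_one)

lemma SI_unique:
  assumes "SI f X" "SI f Y" "bounded_borel f" shows "X = Y"
proof
  fix u
  have "SI (\<lambda>z. f z - f z) (\<lambda>u. X u - Y u)" using SI_diff assms by blast
  then have "norm (X u - Y u) \<le> 2 * 0 * norm u" by (rule SI_norm) (auto intro: bounded_borel_const)
  then show "X u = Y u" by simp
qed

lemma SI_indicator:
  assumes D: "\<Delta> \<in> sets borel" shows "SI (indicator \<Delta>) (E \<Delta>)"
proof -
  have "integral\<^sup>L (\<mu> u) (indicator \<Delta>) = complex_of_real (measure (\<mu> u) \<Delta>)" for u
  proof -
    have "integral\<^sup>L (\<mu> u) (indicator \<Delta>) = (\<integral>z. complex_of_real (indicator \<Delta> z) \<partial>\<mu> u)"
      by (intro Bochner_Integration.integral_cong) (auto simp: indicator_def)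
    also have "\<dots> = complex_of_real (measure (\<mu> u) \<Delta>)" using D by simp
    finally show ?thesis .
  qed
  then show ?thesis unfolding SI_iff using D by (auto simp: E_clinear E_quadratic measure_mu)
qed

lemma SI_adj:
  assumes "SI f X" shows "SI (\<lambda>z. cnj (f z)) (adj X)"
  using assms unfolding SI_iff
  by (auto intro: bounded_clinear_adj simp: cinner_adj_left integral_cnj) (metis cinner_commute)

text \<open>
  By the bound through quadratic forms, uniformly convergent integrands have a Cauchy sequence of
  integrals.
\<close>

lemma SI_limit:
  assumes f: "bounded_borel f" and F: "\<And>n. bounded_borel (F n)" and X: "\<And>n. SI (F n) (X n)"
    and lim: "\<And>n z. cmod (F n z - f z) \<le> 2 / real (Suc n)"
  shows "\<exists>Y. SI f Y"
proof -
  have d: "norm (X m u - X n u) \<le> 2 * (2 / real (Suc m) + 2 / real (Suc n)) * norm u" for m n u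
  proof (rule SI_norm[OF SI_diff[OF X X F F] bounded_borel_diff[OF F F]])
    fix z
    show "cmod (F m z - F n z) \<le> 2 / real (Suc m) + 2 / real (Suc n)"
      using norm_triangle_ineq4[of "F m z - f z" "F n z - f z"] lim[of m z] lim[of n z] by simp
  qed
  have lim0: "(\<lambda>n. 2 * (2 / real (Suc n) + 2 / real (Suc n)) * norm u) \<longlonglongrightarrow> 2 * (0 + 0) * norm u" for u :: 'v
  proof -
    have "(\<lambda>n. 2 * (1 / real (Suc n))) \<longlonglongrightarrow> 2 * 0" by (intro tendsto_intros LIMSEQ_Suc lim_1_over_n)
    then have "(\<lambda>n. 2 / real (Suc n)) \<longlonglongrightarrow> 0" by simp
    then show ?thesis by (intro tendsto_intros)
  qed
  have "Cauchy (\<lambda>n. X n u)" for u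
  proof (rule metric_CauchyI)
    fix e :: real assume e: "0 < e"
    then obtain N where N: "2 * (2 / real (Suc N) + 2 / real (Suc N)) * norm u < e"
      using order_tendstoD(2)[OF lim0[of u], of e] by (auto simp: eventually_sequentially)
    have "dist (X m u) (X n u) < e" if "m \<ge> N" "n \<ge> N" for m n
    proof -
      have le: "2 / real (Suc k) \<le> 2 / real (Suc N)" if "k \<ge> N" for k
        using that by (intro divide_left_mono) auto
      have "2 * (2 / real (Suc m) + 2 / real (Suc n)) * norm u \<le> 2 * (2 / real (Suc N) + 2 / real (Suc N)) * norm u"
        using le[OF that(1)] le[OF that(2)] by (intro mult_right_mono mult_left_mono add_mono) auto
      then show ?thesis using d[of m u n] N unfolding dist_norm by linarith
    qed
    then show "\<exists>M. \<forall>m\<ge>M. \<forall>n\<ge>M. dist (X m u) (X n u) < e" by blast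
  qed
  then have "\<exists>y. (\<lambda>n. X n u) \<longlonglongrightarrow> y" for u using Cauchy_convergent convergent_def by blast
  then obtain Y where Y: "\<And>u. (\<lambda>n. X n u) \<longlonglongrightarrow> Y u" by metis
  have Xc: "bounded_clinear (X n)" for n using X unfolding SI_iff by blast
  obtain M where M: "0 \<le> M" "\<And>z. cmod (f z) \<le> M" using bounded_borel_bound[OF f] by blast
  have "bounded_clinear Y"
  proof (rule bounded_clinearI[of _ "2 * (M + 2)"])
    fix u v :: 'v and c
    have "(\<lambda>n. X n (u + v)) \<longlonglongrightarrow> Y u + Y v"
      unfolding bounded_clinear_add[OF Xc] by (intro tendsto_add Y)
    then show "Y (u + v) = Y u + Y v" using LIMSEQ_unique[OF Y] by blast
    have "bounded_linear (\<lambda>x::'v. c *\<^sub>C x)"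
      by (intro bounded_clinear_bounded_linear bounded_clinear_scale bounded_clinear_ident)
    from bounded_linear.tendsto[OF this Y, of u]
    have "(\<lambda>n. X n (c *\<^sub>C u)) \<longlonglongrightarrow> c *\<^sub>C Y u" by (simp add: bounded_clinear_scaleC[OF Xc])
    then show "Y (c *\<^sub>C u) = c *\<^sub>C Y u" using LIMSEQ_unique[OF Y] by blast
    have "norm (X n u) \<le> 2 * (M + 2) * norm u" for n
    proof (rule SI_norm[OF X F])
      fix z
      have "2 / real (Suc n) \<le> 2" by (simp add: divide_le_eq)
      then show "cmod (F n z) \<le> M + 2"
        using norm_triangle_ineq[of "F n z - f z" "f z"] lim[of n z] M(2)[of z] by simp
    qed
    then show "norm (Y u) \<le> 2 * (M + 2) * norm u" by (intro LIMSEQ_le_const2[OF tendsto_norm[OF Y]]) auto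
  qed
  moreover have "cinner (Y u) u = integral\<^sup>L (\<mu> u) f" for u
  proof (rule LIMSEQ_unique)
    show "(\<lambda>n. cinner (X n u) u) \<longlonglongrightarrow> cinner (Y u) u" by (intro tendsto_cinner Y tendsto_const)
    have "(\<lambda>n. integral\<^sup>L (\<mu> u) (F n)) \<longlonglongrightarrow> integral\<^sup>L (\<mu> u) f"
    proof (rule LIM_zero_cancel, rule Lim_null_comparison[where g = "\<lambda>n. 2 * (1 / real (Suc n)) * (norm u)\<^sup>2"])
      show "\<forall>\<^sub>F n in sequentially. norm (integral\<^sup>L (\<mu> u) (F n) - integral\<^sup>L (\<mu> u) f) \<le> 2 * (1 / real (Suc n)) * (norm u)\<^sup>2"
      proof (intro always_eventually allI)
        fix n
        have "integral\<^sup>L (\<mu> u) (F n) - integral\<^sup>L (\<mu> u) f = (\<integral>z. F n z - f z \<partial>\<mu> u)"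
          by (simp add: integrable_mu f F)
        then show "norm (integral\<^sup>L (\<mu> u) (F n) - integral\<^sup>L (\<mu> u) f) \<le> 2 * (1 / real (Suc n)) * (norm u)\<^sup>2"
          using norm_integral_mu[OF bounded_borel_diff[OF F f] lim] by simp
      qed
      have "(\<lambda>n. 2 * (1 / real (Suc n)) * (norm u)\<^sup>2) \<longlonglongrightarrow> 2 * 0 * (norm u)\<^sup>2"
        by (intro tendsto_intros LIMSEQ_Suc lim_1_over_n)
      then show "(\<lambda>n. 2 * (1 / real (Suc n)) * (norm u)\<^sup>2) \<longlonglongrightarrow> 0" by simp
    qed
    then show "(\<lambda>n. cinner (X n u) u) \<longlonglongrightarrow> integral\<^sup>L (\<mu> u) f" using X unfolding SI_iff by simp
  qed
  ultimately show ?thesis unfolding SI_iff by blast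
qed

abbreviation I :: "(complex \<Rightarrow> complex) \<Rightarrow> 'v \<Rightarrow> 'v" where
  "I \<equiv> spectral_integral E UNIV"

lemma SI_I: assumes "bounded_borel f" shows "SI f (I f)"
proof -
  have "\<exists>X. SI f X" using assms
  proof (induction rule: bounded_borel_induct)
    case (limit f F)
    then show ?case using SI_limit[of f F] by metis
  qed (blast intro: SI_indicator SI_add SI_scale)+
  then show ?thesis unfolding spectral_integral_def using SI_unique[OF _ _ assms] by (metis theI)
qed

lemma I_eqI: "SI f X \<Longrightarrow> bounded_borel f \<Longrightarrow> I f = X"
  using SI_unique SI_I by blast

lemma I_clinear: "bounded_borel f \<Longrightarrow> bounded_clinear (I f)"
  using SI_I unfolding SI_iff by blast

lemma I_indicator: "\<Delta> \<in> sets borel \<Longrightarrow> I (indicator \<Delta>) = E \<Delta>"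
  by (intro I_eqI SI_indicator bounded_borel_indicator)

lemma I_add: "bounded_borel f \<Longrightarrow> bounded_borel g \<Longrightarrow> I (\<lambda>z. f z + g z) u = I f u + I g u"
  using I_eqI[OF SI_add[OF SI_I SI_I]] by (simp add: bounded_borel_add)

lemma I_diff: "bounded_borel f \<Longrightarrow> bounded_borel g \<Longrightarrow> I (\<lambda>z. f z - g z) u = I f u - I g u"
  using I_eqI[OF SI_diff[OF SI_I SI_I]] by (simp add: bounded_borel_diff)

lemma I_scale: "bounded_borel f \<Longrightarrow> I (\<lambda>z. c * f z) u = c *\<^sub>C I f u"
  using I_eqI[OF SI_scale[OF SI_I]] by (simp add: bounded_borel_scale)

lemma I_one: "I (\<lambda>z. 1) u = u"
proof -
  have "indicator UNIV = (\<lambda>z::complex. 1::complex)" by auto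
  then show ?thesis using I_indicator[of UNIV] E_UNIV by simp
qed

lemma I_const: "I (\<lambda>z. c) u = c *\<^sub>C u"
  using I_scale[OF bounded_borel_const, of c 1 u] I_one by simp

lemma I_zero: "I (\<lambda>z. 0) u = 0"
  using I_const[of 0] by simp

lemma I_sum:
  "(\<And>i. i \<in> A \<Longrightarrow> bounded_borel (f i)) \<Longrightarrow> I (\<lambda>z. \<Sum>i\<in>A. f i z) u = (\<Sum>i\<in>A. I (f i) u)"
  by (induction A rule: infinite_finite_induct) (auto simp: I_zero I_add bounded_borel_sum)

lemma I_adj: "bounded_borel f \<Longrightarrow> adj (I f) = I (\<lambda>z. cnj (f z))"
  using I_eqI[OF SI_adj[OF SI_I]] by (simp add: bounded_borel_cnj)

lemma I_limit:
  assumes "bounded_borel f" "\<And>n. bounded_borel (F n)" "\<And>n z. cmod (F n z - f z) \<le> K / real (Suc n)"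
  shows "(\<lambda>n. I (F n) u) \<longlonglongrightarrow> I f u"
proof (rule LIM_zero_cancel, rule Lim_null_comparison[where g = "\<lambda>n. 2 * (K * (1 / real (Suc n))) * norm u"])
  have "norm (I (F n) u - I f u) \<le> 2 * (K * (1 / real (Suc n))) * norm u" for n
    using SI_norm[OF SI_I[OF bounded_borel_diff[OF assms(2,1)]] bounded_borel_diff[OF assms(2,1)] assms(3)]
    by (simp add: I_diff assms)
  then show "\<forall>\<^sub>F n in sequentially. norm (I (F n) u - I f u) \<le> 2 * (K * (1 / real (Suc n))) * norm u" by simp
  have "(\<lambda>n. 2 * (K * (1 / real (Suc n))) * norm u) \<longlonglongrightarrow> 2 * (K * 0) * norm u"
    by (intro tendsto_intros LIMSEQ_Suc lim_1_over_n)
  then show "(\<lambda>n. 2 * (K * (1 / real (Suc n))) * norm u) \<longlonglongrightarrow> 0" by simp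
qed

text \<open>
  Integrals are uniform limits of linear combinations of spectral projections, so identities
  pass from the projections to them: here commutation, and in the next lemma \<open>E (\<Delta>
  \<inter> \<Delta>') = E \<Delta> E \<Delta>'\<close>.
\<close>

lemma commute_E_I:
  assumes C: "bounded_clinear C" and c: "\<And>\<Delta> u. \<Delta> \<in> sets borel \<Longrightarrow> C (E \<Delta> u) = E \<Delta> (C u)"
    and f: "bounded_borel f"
  shows "C (I f u) = I f (C u)"
  using f
proof (induction f arbitrary: u rule: bounded_borel_induct)
  case (limit f F)
  have "(\<lambda>n. C (I (F n) u)) \<longlonglongrightarrow> C (I f u)"
    by (intro bounded_linear.tendsto[OF bounded_clinear_bounded_linear[OF C]] I_limit[where K = 2] limit)
  moreover have "(\<lambda>n. C (I (F n) u)) \<longlonglongrightarrow> I f (C u)" unfolding limit.IH by (intro I_limit[where K = 2] limit)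
  ultimately show ?case by (rule LIMSEQ_unique)
qed (auto simp: I_indicator c I_add I_scale bounded_clinear_simps[OF C])

lemma I_mult:
  assumes f: "bounded_borel f" and g: "bounded_borel g"
  shows "I (\<lambda>z. f z * g z) u = I f (I g u)"
proof -
  have approx: "cmod (F n z * h z - k z * h z) \<le> 2 * M / real (Suc n)"
    if "\<And>n z. cmod (F n z - k z) \<le> 2 / real (Suc n)" "\<And>z. cmod (h z) \<le> M" for F k h n z M
  proof -
    have "cmod (F n z * h z - k z * h z) = cmod (F n z - k z) * cmod (h z)"
      by (simp add: norm_mult flip: left_diff_distrib)
    also have "\<dots> \<le> 2 / real (Suc n) * M" using that by (intro mult_mono) auto
    finally show ?thesis by simp
  qed
  have ind: "I (\<lambda>z. g z * indicator \<Delta> z) u = E \<Delta> (I g u)" if D: "\<Delta> \<in> sets borel" for \<Delta> u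
    using g
  proof (induction g arbitrary: u rule: bounded_borel_induct)
    case (indicator \<Delta>')
    have "(\<lambda>z. indicator \<Delta>' z * indicator \<Delta> z :: complex) = indicator (\<Delta> \<inter> \<Delta>')"
      by (auto simp: indicator_def)
    then show ?case using indicator D by (simp add: I_indicator E_Int)
  next
    case (add f g)
    then show ?case using D
      by (simp add: distrib_right I_add bounded_borel_mult bounded_borel_indicator
          bounded_clinear_simps[OF E_clinear])
  next
    case (scale c f)
    then show ?case using D
      by (simp add: mult.assoc I_scale bounded_borel_mult bounded_borel_indicator
          bounded_clinear_simps[OF E_clinear])
  next
    case (limit f F)
    note b = bounded_borel_mult[OF _ bounded_borel_indicator[OF D]]
    have "(\<lambda>n. I (\<lambda>z. F n z * indicator \<Delta> z) u) \<longlonglongrightarrow> I (\<lambda>z. f z * indicator \<Delta> z) u"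
      by (rule I_limit[where K = "2 * 1"]) (rule b limit approx | auto simp: indicator_def)+
    moreover have "(\<lambda>n. E \<Delta> (I (F n) u)) \<longlonglongrightarrow> E \<Delta> (I f u)"
      by (intro bounded_linear.tendsto[OF bounded_clinear_bounded_linear[OF E_clinear[OF D]]] I_limit[where K = 2] limit)
    ultimately show ?case unfolding limit.IH by (rule LIMSEQ_unique)
  qed
  show ?thesis using f
  proof (induction f rule: bounded_borel_induct)
    case (indicator \<Delta>)
    then show ?case using ind[of \<Delta> u] by (simp add: I_indicator mult.commute)
  next
    case (add f g')
    then show ?case using g by (simp add: distrib_right I_add bounded_borel_mult)
  next
    case (scale c f)
    then show ?case using g by (simp add: mult.assoc I_scale bounded_borel_mult)
  next
    case (limit f F)
    obtain M where M: "\<And>z. cmod (g z) \<le> M" using bounded_borel_bound[OF g] by blast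
    have "(\<lambda>n. I (\<lambda>z. F n z * g z) u) \<longlonglongrightarrow> I (\<lambda>z. f z * g z) u"
      by (rule I_limit[where K = "2 * M"]) (rule bounded_borel_mult limit g approx M)+
    moreover have "(\<lambda>n. I (F n) (I g u)) \<longlonglongrightarrow> I f (I g u)"
      by (intro I_limit[where K = 2] limit)
    ultimately show ?case unfolding limit.IH by (rule LIMSEQ_unique)
  qed
qed

lemma I_power: "bounded_borel f \<Longrightarrow> I (\<lambda>z. f z ^ n) = I f ^^ n"
  by (induction n) (auto simp: fun_eq_iff I_one I_mult bounded_borel_power)

text \<open>
  Since \<open>\<parallel>I f u\<parallel>\<^sup>2\<close> is the integral of
  \<open>\<bar>f\<bar>\<^sup>2\<close> against the scalar measure of \<open>u\<close>, whose
  total mass is \<open>\<parallel>u\<parallel>\<^sup>2\<close>.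
\<close>

lemma norm_I_le:
  assumes f: "bounded_borel f" and M: "\<And>z. cmod (f z) \<le> M"
  shows "norm (I f u) \<le> M * norm u"
proof -
  have M0: "0 \<le> M" using M[of 0] norm_ge_zero[of "f 0"] by linarith
  note fc = bounded_borel_cnj[OF f] and ff = bounded_borel_mult[OF bounded_borel_cnj[OF f] f]
  have "complex_of_real ((norm (I f u))\<^sup>2) = cinner (I f u) (I f u)" by (rule cinner_norm[symmetric])
  also have "\<dots> = cinner (I (\<lambda>z. cnj (f z) * f z) u) u"
    using cinner_adj_left[OF I_clinear[OF f], of "I f u" u] by (simp add: I_adj f I_mult fc)
  also have "\<dots> = (\<integral>z. cnj (f z) * f z \<partial>\<mu> u)" using SI_I[OF ff] unfolding SI_iff by blast
  finally have "(norm (I f u))\<^sup>2 = cmod (\<integral>z. cnj (f z) * f z \<partial>\<mu> u)"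
    by (metis abs_of_nonneg norm_of_real zero_le_power2)
  also have "\<dots> \<le> (M * M) * (norm u)\<^sup>2"
    using M0 by (intro norm_integral_mu ff) (auto simp: norm_mult intro!: mult_mono M)
  finally have "(norm (I f u))\<^sup>2 \<le> (M * norm u)\<^sup>2" by (simp add: power2_eq_square mult_ac)
  then show ?thesis by (rule power2_le_imp_le) (use M0 in simp)
qed

lemma I_cong_on:
  assumes "bounded_borel f" "bounded_borel g" "\<Delta> \<in> sets borel" "\<And>z. z \<in> \<Delta> \<Longrightarrow> f z = g z"
  shows "I f (E \<Delta> u) = I g (E \<Delta> u)"
proof -
  have "(\<lambda>z. f z * indicator \<Delta> z) = (\<lambda>z. g z * indicator \<Delta> z)" using assms(4) by (auto simp: indicator_def)
  then show ?thesis
    using I_mult[OF assms(1) bounded_borel_indicator[OF assms(3)], of u]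
      I_mult[OF assms(2) bounded_borel_indicator[OF assms(3)], of u] assms(3)
    by (simp add: I_indicator)
qed

lemma I_E_commute:
  assumes "bounded_borel f" "\<Delta> \<in> sets borel" shows "I f (E \<Delta> u) = E \<Delta> (I f u)"
proof -
  have "I (\<lambda>z. f z * indicator \<Delta> z) u = I (\<lambda>z. indicator \<Delta> z * f z) u"
    by (simp only: mult.commute)
  then show ?thesis
    unfolding I_mult[OF assms(1) bounded_borel_indicator[OF assms(2)]]
      I_mult[OF bounded_borel_indicator[OF assms(2)] assms(1)] I_indicator[OF assms(2)] .
qed

text \<open>Where \<open>f\<close> stays away from \<open>0\<close> its integral is bounded below: integrate \<open>1 / f\<close>.\<close>

lemma norm_I_ge:
  assumes f: "bounded_borel f" and D: "\<Delta> \<in> sets borel" and a: "0 < a" "\<And>z. z \<in> \<Delta> \<Longrightarrow> a \<le> cmod (f z)"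
  shows "a * norm (E \<Delta> u) \<le> norm (I f (E \<Delta> u))"
proof -
  have nz: "f z \<noteq> 0" if "z \<in> \<Delta>" for z using a that by fastforce
  define g where "g z = indicator \<Delta> z * inverse (f z)" for z
  have g: "bounded_borel g"
  proof (rule bounded_borelI[of _ "1 / a"])
    show "g \<in> borel_measurable borel"
      unfolding g_def using D bounded_borel_measurable[OF f] by measurable
    show "cmod (g z) \<le> 1 / a" for z
      using a unfolding g_def by (auto simp: indicator_def norm_divide inverse_eq_divide intro!: frac_le)
  qed
  have gle: "cmod (g z) \<le> 1 / a" for z
    using a unfolding g_def by (auto simp: indicator_def norm_divide inverse_eq_divide intro!: frac_le)
  have "I g (I f (E \<Delta> u)) = I (\<lambda>z. g z * f z) (E \<Delta> u)" by (simp add: I_mult f g)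
  also have "\<dots> = I (\<lambda>z. 1) (E \<Delta> u)"
    using nz by (intro I_cong_on bounded_borel_mult f g bounded_borel_const D) (auto simp: g_def)
  finally have "norm (E \<Delta> u) \<le> 1 / a * norm (I f (E \<Delta> u))"
    using norm_I_le[OF g gle, of "I f (E \<Delta> u)"] by (simp add: I_one)
  then show ?thesis using a(1) by (simp add: field_simps)
qed

lemma E_countable_UN_zero:
  assumes "\<And>n::nat. X n \<in> sets borel" "\<And>n. E (X n) u = 0"
  shows "E (\<Union>n. X n) u = 0"
proof -
  have "emeasure (\<mu> u) (\<Union>n. X n) = 0"
    by (rule emeasure_UN_eq_0) (use assms in \<open>auto simp: emeasure_mu\<close>)
  then show ?thesis using assms(1) by (simp add: emeasure_mu sets.countable_UN)
qed

text \<open>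
  The set where \<open>f\<close> does not vanish is a countable union of sets on which \<open>I
  f\<close> is bounded below.
\<close>

lemma E_support_zero:
  assumes f: "bounded_borel f" and u: "I f u = 0"
  shows "E {z. f z \<noteq> 0} u = 0"
proof -
  define X where "X n = {z. 1 / real (Suc n) \<le> cmod (f z)}" for n
  have Xb: "X n \<in> sets borel" for n unfolding X_def by (rule superlevel_set_borel[OF f])
  have "E (X n) u = 0" for n
  proof -
    have "1 / real (Suc n) * norm (E (X n) u) \<le> norm (I f (E (X n) u))"
      by (rule norm_I_ge[OF f Xb]) (auto simp: X_def)
    also have "I f (E (X n) u) = 0"
      using I_E_commute[OF f Xb] u bounded_clinear_zero[OF E_clinear[OF Xb]] by simp
    finally show ?thesis by (simp add: divide_le_0_iff)
  qed
  then have "E (\<Union>n. X n) u = 0" using Xb by (rule E_countable_UN_zero[rotated])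
  also have "(\<Union>n. X n) = {z. f z \<noteq> 0}"
  proof (intro equalityI subsetI)
    fix z assume "z \<in> {z. f z \<noteq> 0}"
    then obtain n where "inverse (real (Suc n)) < cmod (f z)" using reals_Archimedean[of "cmod (f z)"] by auto
    then show "z \<in> (\<Union>n. X n)" unfolding X_def by (auto simp: inverse_eq_divide intro!: exI[of _ n])
  next
    fix z assume "z \<in> (\<Union>n. X n)"
    then obtain n where "1 / real (Suc n) \<le> cmod (f z)" unfolding X_def by blast
    moreover have "0 < 1 / real (Suc n)" by simp
    ultimately have "0 < cmod (f z)" by linarith
    then show "z \<in> {z. f z \<noteq> 0}" by simp
  qed
  finally show ?thesis .
qed

section \<open>Operators commuting with a normal operator\<close>

text \<open>
  The range of \<open>E {\<bar>f\<bar> \<le> r}\<close> consists of the vectors on which the powers of \<open>\<integral> f dE\<close> grow at most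
  like \<open>r\<^sup>n\<close>; an operator commuting with \<open>\<integral> f dE\<close> preserves this growth.
\<close>

lemma commutant_preserves_growth:
  assumes f: "bounded_borel f" and C: "bounded_clinear C" and c: "\<And>u. C (I f u) = I f (C u)" and r: "0 \<le> r"
  shows "E {z. r < cmod (f z)} (C (E {z. cmod (f z) \<le> r} u)) = 0"
proof -
  define w where "w = C (E {z. cmod (f z) \<le> r} u)"
  define Y where "Y = {z. cmod (f z) \<le> r}"
  define X where "X n = {z. r + 1 / real (Suc n) \<le> cmod (f z)}" for n
  have Y: "Y \<in> sets borel" unfolding Y_def by (rule sublevel_set_borel[OF f])
  have Xb: "X n \<in> sets borel" for n unfolding X_def by (rule superlevel_set_borel[OF f])
  obtain K where K: "\<And>x. norm (C x) \<le> K * norm x" "0 \<le> K" using bounded_clinear_bound[OF C] by blast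
  have cn: "C ((I f ^^ n) u) = (I f ^^ n) (C u)" for n u by (induction n) (auto simp: c)
  have up: "norm ((I f ^^ n) w) \<le> K * (r ^ n * norm (E Y u))" for n
  proof -
    define g where "g z = f z ^ n * indicator Y z" for z
    have g: "bounded_borel g"
      unfolding g_def by (intro bounded_borel_mult bounded_borel_power f bounded_borel_indicator Y)
    have "(I f ^^ n) (E Y u) = I g (E Y u)"
      unfolding I_power[OF f, symmetric]
      by (rule I_cong_on[OF bounded_borel_power[OF f] g Y]) (simp add: g_def)
    moreover have "norm (I g (E Y u)) \<le> r ^ n * norm (E Y u)"
      by (rule norm_I_le[OF g]) (auto simp: g_def Y_def indicator_def norm_power r intro: power_mono)
    ultimately show ?thesis
      unfolding w_def Y_def[symmetric] cn[symmetric]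
      using K(1)[of "(I f ^^ n) (E Y u)"] mult_left_mono[OF _ K(2)] order_trans by metis
  qed
  have "E (X k) w = 0" for k
  proof (rule ccontr)
    assume nz: "E (X k) w \<noteq> 0"
    \<comment> \<open>On this spectral subspace \<open>I f\<close> grows at rate \<open>s\<close>, faster than the rate \<open>r\<close> that \<open>C\<close> transports.\<close>
    define s where "s = r + 1 / real (Suc k)"
    have s: "r < s" "0 < s" using r unfolding s_def by (auto intro: add_nonneg_pos)
    have lo: "s ^ n * norm (E (X k) w) \<le> K * (r ^ n * norm (E Y u))" for n
    proof -
      have "s ^ n * norm (E (X k) w) \<le> norm (I (\<lambda>z. f z ^ n) (E (X k) w))"
        using s(2) by (intro norm_I_ge[OF bounded_borel_power[OF f] Xb])
          (auto simp: X_def s_def norm_power r intro!: power_mono)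
      also have "\<dots> = norm (E (X k) ((I f ^^ n) w))"
        by (subst I_E_commute[OF bounded_borel_power[OF f] Xb]) (simp add: I_power f)
      also have "\<dots> \<le> 1 * norm ((I f ^^ n) w)"
        unfolding I_indicator[OF Xb, symmetric]
        by (rule norm_I_le[OF bounded_borel_indicator[OF Xb]]) (auto simp: indicator_def)
      finally show ?thesis using up[of n] by simp
    qed
    have "norm (E (X k) w) \<le> K * norm (E Y u) * (r / s) ^ n" for n
      using lo[of n] s(2) by (simp add: power_divide field_simps)
    moreover have "(\<lambda>n. K * norm (E Y u) * (r / s) ^ n) \<longlonglongrightarrow> K * norm (E Y u) * 0"
      using r s by (intro tendsto_intros LIMSEQ_power_zero) auto
    ultimately have "norm (E (X k) w) \<le> 0" by (intro LIMSEQ_le_const) auto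
    then show False using nz by simp
  qed
  then have "E (\<Union>k. X k) w = 0" using Xb by (rule E_countable_UN_zero[rotated])
  also have "(\<Union>k. X k) = {z. r < cmod (f z)}"
  proof (intro equalityI subsetI)
    fix z assume "z \<in> {z. r < cmod (f z)}"
    then obtain n where "inverse (real (Suc n)) < cmod (f z) - r"
      using reals_Archimedean[of "cmod (f z) - r"] by auto
    then show "z \<in> (\<Union>k. X k)" unfolding X_def by (auto simp: inverse_eq_divide intro!: exI[of _ n])
  next
    fix z assume "z \<in> (\<Union>k. X k)"
    then obtain n where "r + 1 / real (Suc n) \<le> cmod (f z)" unfolding X_def by blast
    moreover have "0 < 1 / real (Suc n)" by simp
    ultimately have "r < cmod (f z)" by linarith
    then show "z \<in> {z. r < cmod (f z)}" by simp
  qed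
  finally show ?thesis unfolding w_def .
qed

lemma E_Compl: assumes "\<Delta> \<in> sets borel" shows "E (- \<Delta>) u = u - E \<Delta> u"
proof -
  have "(\<lambda>z. indicator (- \<Delta>) z + indicator \<Delta> z :: complex) = (\<lambda>z. 1)" by (auto simp: indicator_def)
  then have "E (- \<Delta>) u + E \<Delta> u = u"
    using I_add[OF bounded_borel_indicator bounded_borel_indicator, of "- \<Delta>" \<Delta> u] assms
    by (simp add: I_indicator I_one borel_comp)
  then show ?thesis by (simp add: algebra_simps)
qed

text \<open>
  \<open>C\<close> and \<open>C\<^sup>*\<close> both map the range of the projection into
  itself, hence \<open>C\<close> preserves its orthogonal complement too.
\<close>

lemma commutes_with_level_set:
  assumes f: "bounded_borel f" and C: "bounded_clinear C"
    and c: "\<And>u. C (I f u) = I f (C u)" "\<And>u. adj C (I f u) = I f (adj C u)" and r: "0 \<le> r"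
  shows "C (E {z. cmod (f z) \<le> r} u) = E {z. cmod (f z) \<le> r} (C u)"
proof -
  define Y where "Y = {z. cmod (f z) \<le> r}"
  have Y: "Y \<in> sets borel" unfolding Y_def by (rule sublevel_set_borel[OF f])
  have cY: "- Y = {z. r < cmod (f z)}" unfolding Y_def by auto
  have Y': "- Y \<in> sets borel" using Y by (rule borel_comp)
  have 1: "E (- Y) (C (E Y u)) = 0" for u
    using commutant_preserves_growth[OF f C c(1) r] by (subst cY) (simp only: Y_def)
  have 2: "E (- Y) (adj C (E Y u)) = 0" for u
    using commutant_preserves_growth[OF f bounded_clinear_adj[OF C] c(2) r] by (subst cY) (simp only: Y_def)
  have 3: "E Y (C (E (- Y) u)) = 0"
  proof (rule cinner_eqI)
    fix z
    have "cinner z (E Y (C (E (- Y) u))) = cinner (E (- Y) (adj C (E Y z))) u"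
      by (metis E_adj E_clinear Y Y' C cinner_adj_left)
    then show "cinner z (E Y (C (E (- Y) u))) = cinner z 0" by (simp add: 2)
  qed
  have "C u = C (E Y u) + C (E (- Y) u)" by (simp add: E_Compl Y bounded_clinear_simps[OF C])
  then have "E Y (C u) = E Y (C (E Y u))" by (simp add: bounded_clinear_simps[OF E_clinear[OF Y]] 3)
  also have "\<dots> = C (E Y u)" using 1[of u] E_Compl[OF Y, of "C (E Y u)"] by simp
  finally show ?thesis unfolding Y_def by simp
qed

end

text \<open>
  Only discs need to be treated: the sets \<open>\<Delta>\<close> with \<open>C (E \<Delta>) = (E \<Delta>) C\<close> form a \<open>\<sigma>\<close>-algebra, since
  \<open>E\<close> turns intersections into products.
\<close>

theorem (in spectral_resolution) commutes_with_spectral_measure: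
  assumes S: "S \<in> sets borel" "bounded S" "\<And>u. E S u = u" and C: "bounded_clinear C"
    and c: "\<And>u. C (I (\<lambda>z. indicator S z * z) u) = I (\<lambda>z. indicator S z * z) (C u)"
      "\<And>u. adj C (I (\<lambda>z. indicator S z * z) u) = I (\<lambda>z. indicator S z * z) (adj C u)"
    and D: "\<Delta> \<in> sets borel"
  shows "C (E \<Delta> u) = E \<Delta> (C u)"
proof -
  define G where "G = {\<Delta> \<in> sets borel. \<forall>u. C (E \<Delta> u) = E \<Delta> (C u)}"
  obtain M where M: "\<And>z. z \<in> S \<Longrightarrow> cmod z \<le> M" using S(2) unfolding bounded_iff by blast
  have b: "bounded_borel (\<lambda>z. indicator S z * z)"
  proof (rule bounded_borelI[of _ "max M 0"])
    show "(\<lambda>z. indicator S z * z :: complex) \<in> borel_measurable borel" using S(1) by measurable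
    show "cmod (indicator S z * z) \<le> max M 0" for z using M[of z] by (auto simp: indicator_def)
  qed
  note C' = bounded_clinear_adj[OF C]
  have disc: "cball a r \<in> G" if r: "0 \<le> r" for a r
  proof -
    define f where "f z = indicator S z * z - a" for z
    have f: "bounded_borel f" unfolding f_def by (intro bounded_borel_diff b bounded_borel_const)
    have If: "I f u = I (\<lambda>z. indicator S z * z) u - a *\<^sub>C u" for u
      unfolding f_def by (simp add: I_diff b bounded_borel_const I_const)
    note lev = sublevel_set_borel[OF f, of r]
    have eq: "E (cball a r) u = E {z. cmod (f z) \<le> r} u" for u
    proof -
      have "E (cball a r) (E S u) = E {z. cmod (f z) \<le> r} (E S u)"
        using lev S(1) by (simp add: E_Int) (rule arg_cong[where f = "\<lambda>X. E X u"],
          auto simp: f_def dist_norm norm_minus_commute indicator_def)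
      then show ?thesis by (simp add: S(3))
    qed
    have "C (E {z. cmod (f z) \<le> r} u) = E {z. cmod (f z) \<le> r} (C u)" for u
      by (rule commutes_with_level_set[OF f C _ _ r])
        (simp_all add: If c bounded_clinear_simps[OF C] bounded_clinear_simps[OF C'])
    then show ?thesis unfolding G_def by (simp add: eq)
  qed
  have GU: "(\<Union>n. X n) \<in> G" if X: "range X \<subseteq> G" for X :: "nat \<Rightarrow> complex set"
  proof -
    have diff: "A - B \<in> G" if "A \<in> G" "B \<in> G" for A B
    proof -
      have "E (A - B) u = E A (u - E B u)" for u
        using that E_Int[of A "- B" u] unfolding G_def by (auto simp: E_Compl Diff_eq)
      then show ?thesis using that unfolding G_def by (auto simp: bounded_clinear_simps[OF C])
    qed
    have fin: "(\<Union>i<n. X i) \<in> G" for n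
    proof (induction n)
      case 0
      show ?case unfolding G_def by (simp add: E_empty bounded_clinear_zero[OF C])
    next
      case (Suc n)
      have "UNIV \<in> G" unfolding G_def by (simp add: E_UNIV)
      \<comment> \<open>A union of two sets, written with differences only.\<close>
      then have "UNIV - ((UNIV - (\<Union>i<n. X i)) - X n) \<in> G" using Suc X by (intro diff) auto
      moreover have "UNIV - ((UNIV - (\<Union>i<n. X i)) - X n) = (\<Union>i<Suc n. X i)" by (auto simp: less_Suc_eq)
      ultimately show ?case by simp
    qed
    have dj: "disjointed X n \<in> G" for n
      using diff[of "X n" "\<Union>i<n. X i"] fin[of n] X by (auto simp: disjointed_def atLeast0LessThan)
    have sub: "range (disjointed X) \<subseteq> sets borel" using dj unfolding G_def by auto
    have "C (E (\<Union>n. X n) u) = E (\<Union>n. X n) (C u)" for u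
    proof (rule sums_unique2)
      have "(\<lambda>n. C (E (disjointed X n) u)) sums C (E (\<Union>n. disjointed X n) u)"
        by (intro bounded_linear.sums[OF bounded_clinear_bounded_linear[OF C]] E_sums sub disjoint_family_disjointed)
      then show "(\<lambda>n. C (E (disjointed X n) u)) sums C (E (\<Union>n. X n) u)" by (simp add: UN_disjointed_eq)
      have "(\<lambda>n. E (disjointed X n) (C u)) sums E (\<Union>n. disjointed X n) (C u)"
        by (intro E_sums sub disjoint_family_disjointed)
      moreover have "C (E (disjointed X n) u) = E (disjointed X n) (C u)" for n using dj[of n] unfolding G_def by blast
      ultimately show "(\<lambda>n. C (E (disjointed X n) u)) sums E (\<Union>n. X n) (C u)" by (simp add: UN_disjointed_eq)
    qed
    moreover have "(\<Union>n. X n) \<in> sets borel" using X unfolding G_def by auto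
    ultimately show ?thesis unfolding G_def by blast
  qed
  have G0: "{} \<in> G" unfolding G_def by (simp add: E_empty bounded_clinear_zero[OF C])
  have "U \<in> G" if U: "open U" for U
  proof -
    obtain e where e: "\<And>x. x \<in> U \<Longrightarrow> 0 < e x \<and> cball x (e x) \<subseteq> U"
      using U unfolding open_contains_cball by metis
    have "\<exists>\<F>'\<subseteq>(\<lambda>x. ball x (e x)) ` U. countable \<F>' \<and> \<Union>\<F>' = \<Union>((\<lambda>x. ball x (e x)) ` U)"
      by (rule Lindelof[of "(\<lambda>x. ball x (e x)) ` U"]) auto
    then obtain \<F>' where F': "\<F>' \<subseteq> (\<lambda>x. ball x (e x)) ` U" "countable \<F>'"
      "\<Union>\<F>' = (\<Union>x\<in>U. ball x (e x))" by blast
    then obtain V where V: "countable V" "V \<subseteq> U" "\<F>' = (\<lambda>x. ball x (e x)) ` V"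
      using countable_subset_image[of \<F>' "\<lambda>x. ball x (e x)" U] by blast
    have UV: "U = (\<Union>x\<in>V. cball x (e x))"
    proof (intro equalityI subsetI)
      fix x assume "x \<in> U"
      then have "x \<in> ball x (e x)" using e by simp
      then have "x \<in> (\<Union>x\<in>U. ball x (e x))" using \<open>x \<in> U\<close> by blast
      then have "x \<in> (\<Union>x\<in>V. ball x (e x))" unfolding F'(3)[symmetric] V(3) .
      then show "x \<in> (\<Union>x\<in>V. cball x (e x))" by (auto intro: less_imp_le)
    qed (use V(2) e in blast)
    show ?thesis
    proof (cases "V = {}")
      case True
      then show ?thesis using UV G0 by simp
    next
      case False
      have "(\<Union>n. cball (from_nat_into V n) (e (from_nat_into V n))) = U"
        unfolding UV by (subst (2) range_from_nat_into[OF False V(1), symmetric]) simp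
      moreover have "cball (from_nat_into V n) (e (from_nat_into V n)) \<in> G" for n
        using disc e V(2) from_nat_into[OF False, of n] by (meson less_imp_le subsetD)
      ultimately show ?thesis using GU[of "\<lambda>n. cball (from_nat_into V n) (e (from_nat_into V n))"] by auto
    qed
  qed
  then have op: "{U. open U} \<subseteq> G" by blast
  have "\<Delta> \<in> sigma_sets UNIV {U. open U}" using D unfolding borel_def by simp
  then have "\<Delta> \<in> G"
  proof (induction rule: sigma_sets.induct)
    case (Compl A)
    then show ?case unfolding G_def
      by (auto simp: E_Compl Compl_eq_Diff_UNIV[symmetric] bounded_clinear_simps[OF C] borel_comp)
  next
    case (Union X)
    then show ?case using GU[of X] by auto
  qed (use op G0 in auto)
  then show ?thesis unfolding G_def by blast
qed

section \<open>Polynomials in two variables\<close>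

abbreviation eval2 :: "complex poly poly \<Rightarrow> complex \<Rightarrow> complex \<Rightarrow> complex" where
  "eval2 s x y \<equiv> poly (poly s [:y:]) x"

abbreviation ev :: "complex poly poly \<Rightarrow> complex \<Rightarrow> complex" where
  "ev s z \<equiv> eval2 s (complex_of_real (Re z)) (complex_of_real (Im z))"

text \<open>
  \<open>smult [:0, 1:]\<close> multiplies by \<open>z\<close> and \<open>pCons 0\<close> by \<open>w\<close>; every identity below that is linear in the
  polynomial is checked on these two operations.
\<close>

lemma bipoly_induct [case_names const add timesZ timesW]:
  fixes s :: "complex poly poly"
  assumes const: "\<And>c. P [:[:c:]:]" and add: "\<And>s t. P s \<Longrightarrow> P t \<Longrightarrow> P (s + t)"
    and Z: "\<And>s. P s \<Longrightarrow> P (smult [:0, 1:] s)" and W: "\<And>s. P s \<Longrightarrow> P (pCons 0 s)"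
  shows "P s"
proof (induction s)
  case 0
  then show ?case using const[of 0] by simp
next
  case (pCons a s)
  have "P [:a:]"
  proof (induction a)
    case 0
    then show ?case using const[of 0] by simp
  next
    case (pCons c a)
    then show ?case using add[OF const[of c] Z[OF pCons(2)]] by simp
  qed
  then show ?case using add[OF _ W[OF pCons(2)], of "[:a:]"] by simp
qed

lemma op_poly2_superset:
  "\<exists>N. \<forall>M\<ge>N. \<forall>x. op_poly2 s A B x = (\<Sum>l\<le>M. \<Sum>k\<le>M. coeff (coeff s l) k *\<^sub>C (A ^^ k) ((B ^^ l) x))"
proof -
  define N where "N = degree s + (\<Sum>l\<le>degree s. degree (coeff s l))"
  have "op_poly2 s A B x = (\<Sum>l\<le>M. \<Sum>k\<le>M. coeff (coeff s l) k *\<^sub>C (A ^^ k) ((B ^^ l) x))" if M: "M \<ge> N" for M x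
  proof -
    have dM: "degree (coeff s l) \<le> M" if "l \<le> degree s" for l
      using member_le_sum[of l "{..degree s}" "\<lambda>l. degree (coeff s l)"] that M unfolding N_def by simp
    have "op_poly2 s A B x = (\<Sum>l\<le>degree s. \<Sum>k\<le>M. coeff (coeff s l) k *\<^sub>C (A ^^ k) ((B ^^ l) x))"
      unfolding op_poly2_def
      by (intro sum.cong sum.mono_neutral_left) (auto simp: coeff_eq_0 dest: dM)
    also have "\<dots> = (\<Sum>l\<le>M. \<Sum>k\<le>M. coeff (coeff s l) k *\<^sub>C (A ^^ k) ((B ^^ l) x))"
      using M unfolding N_def by (intro sum.mono_neutral_left) (auto simp: coeff_eq_0)
    finally show ?thesis .
  qed
  then show ?thesis by blast
qed

lemma op_poly2_const: "op_poly2 [:[:c:]:] A B x = c *\<^sub>C x"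
  unfolding op_poly2_def by simp

lemma op_poly2_add: "op_poly2 (s + t) A B x = op_poly2 s A B x + op_poly2 t A B x"
proof -
  note superset = op_poly2_superset[of _ A B]
  obtain K where K: "\<And>n x. n \<ge> K \<Longrightarrow> op_poly2 s A B x = (\<Sum>l\<le>n. \<Sum>k\<le>n. coeff (coeff s l) k *\<^sub>C (A ^^ k) ((B ^^ l) x))"
    using superset[of s] by blast
  obtain L where L: "\<And>n x. n \<ge> L \<Longrightarrow> op_poly2 t A B x = (\<Sum>l\<le>n. \<Sum>k\<le>n. coeff (coeff t l) k *\<^sub>C (A ^^ k) ((B ^^ l) x))"
    using superset[of t] by blast
  obtain M where M: "\<And>n x. n \<ge> M \<Longrightarrow> op_poly2 (s + t) A B x = (\<Sum>l\<le>n. \<Sum>k\<le>n. coeff (coeff (s + t) l) k *\<^sub>C (A ^^ k) ((B ^^ l) x))"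
    using superset[of "s + t"] by blast
  from K[of "K + L + M" x] L[of "K + L + M" x] M[of "K + L + M" x] show ?thesis by (simp add: scaleC_add_left sum.distrib)
qed

lemma op_poly2_timesW: "op_poly2 (pCons 0 s) A B x = op_poly2 s A B (B x)"
proof -
  obtain K where K: "\<And>n x. n \<ge> K \<Longrightarrow> op_poly2 s A B x = (\<Sum>l\<le>n. \<Sum>k\<le>n. coeff (coeff s l) k *\<^sub>C (A ^^ k) ((B ^^ l) x))"
    using op_poly2_superset[of s A B] by blast
  obtain M where M: "\<And>n x. n \<ge> M \<Longrightarrow> op_poly2 (pCons 0 s) A B x = (\<Sum>l\<le>n. \<Sum>k\<le>n. coeff (coeff (pCons 0 s) l) k *\<^sub>C (A ^^ k) ((B ^^ l) x))"
    using op_poly2_superset[of "pCons 0 s" A B] by blast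
  define n where "n = K + M + degree s + (\<Sum>l\<le>degree s. degree (coeff s l))"
  have dM: "degree (coeff s l) \<le> n" for l
  proof (cases "l \<le> degree s")
    case True
    then show ?thesis
      using member_le_sum[of l "{..degree s}" "\<lambda>l. degree (coeff s l)"] unfolding n_def by simp
  qed (simp add: coeff_eq_0)
  have "op_poly2 (pCons 0 s) A B x = (\<Sum>l\<le>n. \<Sum>k\<le>Suc n. coeff (coeff s l) k *\<^sub>C (A ^^ k) ((B ^^ l) (B x)))"
    using M[of "Suc n" x] by (simp add: n_def sum.atMost_Suc_shift funpow_swap1 del: sum.atMost_Suc)
  also have "\<dots> = (\<Sum>l\<le>n. \<Sum>k\<le>n. coeff (coeff s l) k *\<^sub>C (A ^^ k) ((B ^^ l) (B x)))"
    using dM by (simp add: coeff_eq_0 le_imp_less_Suc)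
  also have "\<dots> = op_poly2 s A B (B x)" using K[of n "B x"] by (simp add: n_def)
  finally show ?thesis .
qed

lemma op_poly2_timesZ:
  fixes A B :: "'a::krein_space \<Rightarrow> 'a"
  assumes A: "bounded_clinear A"
  shows "op_poly2 (smult [:0, 1:] s) A B x = A (op_poly2 s A B x)"
proof -
  obtain K where K: "\<And>n x. n \<ge> K \<Longrightarrow> op_poly2 s A B x = (\<Sum>l\<le>n. \<Sum>k\<le>n. coeff (coeff s l) k *\<^sub>C (A ^^ k) ((B ^^ l) x))"
    using op_poly2_superset[of s A B] by blast
  obtain M where M: "\<And>n x. n \<ge> M \<Longrightarrow> op_poly2 (smult [:0, 1:] s) A B x = (\<Sum>l\<le>n. \<Sum>k\<le>n. coeff (coeff (smult [:0, 1:] s) l) k *\<^sub>C (A ^^ k) ((B ^^ l) x))"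
    using op_poly2_superset[of "smult [:0, 1:] s" A B] by blast
  define n where "n = K + M + degree s"
  have "op_poly2 (smult [:0, 1:] s) A B x
      = (\<Sum>l\<le>Suc n. \<Sum>k\<le>n. coeff (coeff s l) k *\<^sub>C (A ((A ^^ k) ((B ^^ l) x))))"
    using M[of "Suc n" x] by (simp add: n_def sum.atMost_Suc_shift del: sum.atMost_Suc)
  also have "\<dots> = (\<Sum>l\<le>n. \<Sum>k\<le>n. coeff (coeff s l) k *\<^sub>C (A ((A ^^ k) ((B ^^ l) x))))"
    by (simp add: coeff_eq_0 n_def)
  also have "\<dots> = A (op_poly2 s A B x)"
    using K[of n x] by (simp add: n_def bounded_clinear_sum[OF A] bounded_clinear_scaleC[OF A])
  finally show ?thesis .
qed

context
  fixes A B :: "'a::krein_space \<Rightarrow> 'a"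
  assumes A: "bounded_clinear A" and B: "bounded_clinear B"
begin

lemma bounded_clinear_op_poly2: "bounded_clinear (op_poly2 s A B)"
proof (induction s rule: bipoly_induct)
  case (const c)
  have e: "op_poly2 [:[:c:]:] A B = (\<lambda>x. c *\<^sub>C x)" by (rule ext) (rule op_poly2_const)
  show ?case unfolding e by (rule bounded_clinear_scale[OF bounded_clinear_ident])
next
  case (add s t)
  then show ?case using bounded_clinear_plus[OF add] by (simp add: op_poly2_add[abs_def])
next
  case (timesZ s)
  then show ?case using bounded_clinear_compose[OF A timesZ] by (simp add: op_poly2_timesZ[OF A, abs_def])
next
  case (timesW s)
  then show ?case using bounded_clinear_compose[OF timesW B] by (simp add: op_poly2_timesW[abs_def])
qed

text \<open>
  For \<open>V = T\<close> this passes between \<open>\<K>\<close> and \<open>\<V>\<close>, and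
  for an operator \<open>V = C\<close> commuting with \<open>A\<close> and \<open>B\<close> it
  says that \<open>C\<close> commutes with \<open>s(A, B)\<close>.
\<close>

lemma op_poly2_intertwine:
  fixes A' B' :: "'v::krein_space \<Rightarrow> 'v"
  assumes V: "bounded_clinear V" and A': "bounded_clinear A'" and B': "bounded_clinear B'"
    and i: "\<And>v. V (A' v) = A (V v)" "\<And>v. V (B' v) = B (V v)"
  shows "V (op_poly2 s A' B' v) = op_poly2 s A B (V v)"
proof (induction s arbitrary: v rule: bipoly_induct)
  case (timesZ s)
  then show ?case by (simp add: op_poly2_timesZ[OF A'] op_poly2_timesZ[OF A] i)
qed (simp_all add: op_poly2_const op_poly2_add op_poly2_timesW bounded_clinear_simps[OF V] i)

lemma op_poly2_mult:
  assumes AB: "\<And>x. A (B x) = B (A x)"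
  shows "op_poly2 (s * t) A B x = op_poly2 s A B (op_poly2 t A B x)"
proof (induction s arbitrary: x rule: bipoly_induct)
  case (const c)
  have "op_poly2 (smult [:c:] t) A B x = c *\<^sub>C op_poly2 t A B x" for x
  proof (induction t arbitrary: x rule: bipoly_induct)
    case (const d)
    then show ?case using op_poly2_const[of "c * d" A B x] by (simp add: op_poly2_const scaleC_scaleC mult.commute)
  next
    case (add s t)
    then show ?case by (simp add: smult_add_right op_poly2_add scaleC_add_right)
  next
    case (timesZ s)
    have "smult [:c:] (smult [:0, 1:] s) = smult [:0, 1:] (smult [:c:] s)" by (simp add: mult.commute)
    then show ?case by (simp add: op_poly2_timesZ[OF A] timesZ bounded_clinear_scaleC[OF A] del: smult_smult)
  next
    case (timesW s)
    then show ?case using op_poly2_timesW[of "smult [:c:] s" A B x] by (simp add: op_poly2_timesW)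
  qed
  then show ?case by (simp add: op_poly2_const)
next
  case (add s s')
  then show ?case by (simp add: distrib_right op_poly2_add)
next
  case (timesZ s)
  then show ?case by (simp add: op_poly2_timesZ[OF A])
next
  case (timesW s)
  have "op_poly2 t A B (B x) = B (op_poly2 t A B x)"
    by (rule op_poly2_intertwine[OF B A B, symmetric]) (simp_all add: AB)
  then show ?case using op_poly2_timesW[of "s * t" A B x] by (simp add: op_poly2_timesW timesW)
qed

end

definition conj_poly2 :: "complex poly poly \<Rightarrow> complex poly poly" where
  "conj_poly2 = map_poly (map_poly cnj)"

lemma conj_poly2_simps:
  "conj_poly2 [:[:c:]:] = [:[:cnj c:]:]" "conj_poly2 (s + t) = conj_poly2 s + conj_poly2 t"
  "conj_poly2 (smult [:0, 1:] s) = smult [:0, 1:] (conj_poly2 s)" "conj_poly2 (pCons 0 s) = pCons 0 (conj_poly2 s)"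
  unfolding conj_poly2_def
  by (auto simp: map_poly_pCons poly_eq_iff coeff_map_poly coeff_pCons split: nat.splits)

lemma adj_op_poly2:
  assumes A: "bounded_clinear A" and B: "bounded_clinear B" and AB: "\<And>x. A (B x) = B (A x)"
    and s: "adj A = A" "adj B = (B :: 'a::krein_space \<Rightarrow> 'a)"
  shows "adj (op_poly2 p A B) = op_poly2 (conj_poly2 p) A B"
proof (rule adj_eqI)
  have A': "cinner (A x) y = cinner x (A y)" and B': "cinner (B x) y = cinner x (B y)" for x y
    using cinner_adj_right[OF A, of x y] cinner_adj_right[OF B, of x y] s by simp_all
  show "cinner (op_poly2 p A B x) y = cinner x (op_poly2 (conj_poly2 p) A B y)" for x y
  proof (induction p arbitrary: x y rule: bipoly_induct)
    case (timesW p)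
    have "op_poly2 (conj_poly2 p) A B (B y) = B (op_poly2 (conj_poly2 p) A B y)"
      by (rule op_poly2_intertwine[OF A B B A B, symmetric]) (simp_all add: AB)
    then show ?case by (simp add: conj_poly2_simps op_poly2_timesW timesW B')
  next
    case (timesZ p)
    have "op_poly2 (conj_poly2 p) A B (A y) = A (op_poly2 (conj_poly2 p) A B y)"
      by (rule op_poly2_intertwine[OF A B A A B, symmetric]) (simp_all add: AB)
    then show ?case using timesZ[of x "A y"] by (simp add: conj_poly2_simps op_poly2_timesZ[OF A] A')
  qed (simp_all add: conj_poly2_simps op_poly2_const op_poly2_add cinner_simps)
qed

lemma op_poly2_poly_z: "op_poly2 (poly_z p) A B = op_poly p A"
  by (rule ext) (simp add: op_poly2_def op_poly_def poly_z_def degree_map_poly coeff_map_poly scaleR_scaleC)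

lemma op_poly2_poly_w: "op_poly2 (poly_w q) A B = op_poly q B"
  by (rule ext) (simp add: op_poly2_def op_poly_def poly_w_def degree_map_poly coeff_map_poly scaleR_scaleC)

subsection \<open>Taylor expansion\<close>

text \<open>
  The polynomial \<open>s(\<xi> + z, \<eta> + w)\<close>. Its coefficients are the Taylor
  coefficients of \<open>s\<close> at \<open>(\<xi>, \<eta>)\<close>, which makes the product
  rule an instance of polynomial multiplication.
\<close>

definition taylor_shift :: "complex \<Rightarrow> complex \<Rightarrow> complex poly poly \<Rightarrow> complex poly poly" where
  "taylor_shift \<xi> \<eta> s = pcompose (map_poly (\<lambda>a. pcompose a [:\<xi>, 1:]) s) [:[:\<eta>:], 1:]"

lemma taylor_shift_0: "taylor_shift \<xi> \<eta> 0 = 0"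
  and taylor_shift_pCons: "taylor_shift \<xi> \<eta> (pCons a s) = [:pcompose a [:\<xi>, 1:]:] + [:[:\<eta>:], 1:] * taylor_shift \<xi> \<eta> s"
  unfolding taylor_shift_def by (simp_all add: map_poly_pCons pcompose_pCons)

lemma taylor_shift_add: "taylor_shift \<xi> \<eta> (s + t) = taylor_shift \<xi> \<eta> s + taylor_shift \<xi> \<eta> t"
proof -
  have "map_poly (\<lambda>a. pcompose a [:\<xi>, 1:]) (s + t) = map_poly (\<lambda>a. pcompose a [:\<xi>, 1:]) s + map_poly (\<lambda>a. pcompose a [:\<xi>, 1:]) t"
    by (simp add: poly_eq_iff coeff_map_poly pcompose_add)
  then show ?thesis unfolding taylor_shift_def by (simp add: pcompose_add)
qed

lemma taylor_shift_smult: "taylor_shift \<xi> \<eta> (smult a s) = smult (pcompose a [:\<xi>, 1:]) (taylor_shift \<xi> \<eta> s)"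
  by (induction s) (simp_all add: taylor_shift_0 taylor_shift_pCons pcompose_mult smult_add_right del: mult_pCons_left)

lemma taylor_shift_mult: "taylor_shift \<xi> \<eta> (s * t) = taylor_shift \<xi> \<eta> s * taylor_shift \<xi> \<eta> t"
proof (induction s)
  case (pCons a s)
  have "taylor_shift \<xi> \<eta> (pCons a s * t) = smult (pcompose a [:\<xi>, 1:]) (taylor_shift \<xi> \<eta> t)
      + [:[:\<eta>:], 1:] * (taylor_shift \<xi> \<eta> s * taylor_shift \<xi> \<eta> t)"
    unfolding mult_pCons_left taylor_shift_add taylor_shift_smult by (simp only: taylor_shift_pCons pCons) simp
  then show ?case unfolding taylor_shift_pCons by (simp add: distrib_right mult.assoc del: mult_pCons_left) simp
qed (simp add: taylor_shift_0)

lemma eval2_taylor_shift: "eval2 (taylor_shift \<xi> \<eta> s) x y = eval2 s (\<xi> + x) (\<eta> + y)"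
  by (induction s) (simp_all add: taylor_shift_0 taylor_shift_pCons poly_pcompose algebra_simps)

lemma map_poly_pderiv_add: "map_poly pderiv (s + t) = map_poly pderiv s + map_poly pderiv (t :: complex poly poly)"
  by (simp add: poly_eq_iff coeff_map_poly pderiv_add)

lemma map_poly_pderiv_timesZ: "map_poly pderiv (smult [:0, 1:] s) = smult [:0, 1:] (map_poly pderiv s) + (s :: complex poly poly)"
  by (simp add: poly_eq_iff coeff_map_poly pderiv_pCons coeff_pCons algebra_simps split: nat.splits)

lemma map_poly_pderiv_scale: "map_poly pderiv (smult [:c:] s) = smult [:c:] (map_poly pderiv (s :: complex poly poly))"
  by (simp add: poly_eq_iff coeff_map_poly pderiv_smult)

lemma D_add: "(map_poly pderiv ^^ k) (s + t) = (map_poly pderiv ^^ k) s + (map_poly pderiv ^^ k) (t :: complex poly poly)"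
  by (induction k) (simp_all add: map_poly_pderiv_add)

lemma D_scale: "(map_poly pderiv ^^ k) (smult [:c:] s) = smult [:c:] ((map_poly pderiv ^^ k) (s :: complex poly poly))"
  by (induction k) (simp_all add: map_poly_pderiv_scale)

lemma D_timesW: "(map_poly pderiv ^^ k) (pCons 0 s) = pCons 0 ((map_poly pderiv ^^ k) (s :: complex poly poly))"
  by (induction k) (simp_all add: map_poly_pCons)

text \<open>Both partial derivatives are derivations \<open>\<delta>\<close>; Leibniz' rule for a factor \<open>X\<close> with \<open>\<delta> X = 1\<close>.\<close>

lemma iterated_derivation:
  fixes \<delta> X :: "complex poly poly \<Rightarrow> complex poly poly"
  assumes "\<And>s t. \<delta> (s + t) = \<delta> s + \<delta> t" "\<And>c s. \<delta> (smult [:c:] s) = smult [:c:] (\<delta> s)"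
    and "\<And>s. \<delta> (X s) = X (\<delta> s) + s"
  shows "(\<delta> ^^ Suc k) (X s) = X ((\<delta> ^^ Suc k) s) + smult [:of_nat (Suc k):] ((\<delta> ^^ k) s)"
proof (induction k)
  case 0
  then show ?case using assms(3) by (simp flip: one_pCons)
next
  case (Suc k)
  have e: "[:of_nat (Suc (Suc k)):] = [:1:] + [:of_nat (Suc k) :: complex:]" by simp
  have "(\<delta> ^^ Suc (Suc k)) (X s) = \<delta> (X ((\<delta> ^^ Suc k) s) + smult [:of_nat (Suc k):] ((\<delta> ^^ k) s))"
    using Suc by simp
  also have "\<dots> = X ((\<delta> ^^ Suc (Suc k)) s) + smult ([:1:] + [:of_nat (Suc k):]) ((\<delta> ^^ Suc k) s)"
    unfolding assms smult_add_left by (simp add: add.assoc flip: one_pCons)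
  finally show ?case unfolding e .
qed

lemma D_timesZ:
  "(map_poly pderiv ^^ Suc k) (smult [:0, 1:] s) =
     smult [:0, 1:] ((map_poly pderiv ^^ Suc k) s) + smult [:of_nat (Suc k):] ((map_poly pderiv ^^ k) (s :: complex poly poly))"
  by (rule iterated_derivation[where \<delta> = "map_poly pderiv" and X = "smult [:0, 1:]"])
    (rule map_poly_pderiv_add map_poly_pderiv_scale map_poly_pderiv_timesZ)+

lemma pderiv_timesW:
  "(pderiv ^^ Suc l) (pCons 0 s) =
     pCons 0 ((pderiv ^^ Suc l) s) + smult [:of_nat (Suc l):] ((pderiv ^^ l) (s :: complex poly poly))"
  by (rule iterated_derivation[where \<delta> = pderiv and X = "pCons 0"])
    (simp_all add: pderiv_add pderiv_smult pderiv_pCons)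

lemma pderiv_funpow_add: "(pderiv ^^ l) (s + t) = (pderiv ^^ l) s + (pderiv ^^ l) (t :: complex poly poly)"
  by (induction l) (simp_all add: pderiv_add)

lemma pderiv_funpow_smult: "(pderiv ^^ l) (smult a s) = smult a ((pderiv ^^ l) (s :: complex poly poly))"
  by (induction l) (simp_all add: pderiv_smult)

lemma taylor_coeff_const: "taylor_coeff [:[:c:]:] \<xi> \<eta> k l = (if k = 0 \<and> l = 0 then c else 0)"
proof -
  have "(pderiv ^^ l) [:[:c:]:] = (if l = 0 then [:[:c:]:] else 0)" for l
    by (induction l) auto
  moreover have "(map_poly pderiv ^^ k) [:[:c:]:] = (if k = 0 then [:[:c:]:] else 0)" for k
    by (induction k) (auto simp: map_poly_pCons)
  moreover have "(map_poly pderiv ^^ k) 0 = (0 :: complex poly poly)" by (induction k) auto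
  ultimately show ?thesis unfolding taylor_coeff_def by simp
qed

lemma taylor_coeff_add: "taylor_coeff (s + t) \<xi> \<eta> k l = taylor_coeff s \<xi> \<eta> k l + taylor_coeff t \<xi> \<eta> k l"
  unfolding taylor_coeff_def by (simp add: pderiv_funpow_add D_add add_divide_distrib)

lemma taylor_coeff_timesZ:
  "taylor_coeff (smult [:0, 1:] s) \<xi> \<eta> k l =
     \<xi> * taylor_coeff s \<xi> \<eta> k l + (case k of 0 \<Rightarrow> 0 | Suc k' \<Rightarrow> taylor_coeff s \<xi> \<eta> k' l)"
proof (cases k)
  case 0
  then show ?thesis unfolding taylor_coeff_def pderiv_funpow_smult by simp
next
  case (Suc k')
  then show ?thesis
    unfolding taylor_coeff_def pderiv_funpow_smult Suc D_timesZ
    by (simp add: add_divide_distrib del: of_nat_Suc funpow.simps)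
qed

lemma taylor_coeff_timesW:
  "taylor_coeff (pCons 0 s) \<xi> \<eta> k l =
     \<eta> * taylor_coeff s \<xi> \<eta> k l + (case l of 0 \<Rightarrow> 0 | Suc l' \<Rightarrow> taylor_coeff s \<xi> \<eta> k l')"
proof (cases l)
  case 0
  then show ?thesis unfolding taylor_coeff_def by (simp add: D_timesW)
next
  case (Suc l')
  then show ?thesis
    unfolding taylor_coeff_def Suc pderiv_timesW D_add D_scale D_timesW
    by (simp add: add_divide_distrib del: of_nat_Suc funpow.simps)
qed

lemma coeff_taylor_shift: "coeff (coeff (taylor_shift \<xi> \<eta> s) l) k = taylor_coeff s \<xi> \<eta> k l"
proof (induction s arbitrary: k l rule: bipoly_induct)
  case (const c)
  then show ?case
    by (auto simp: taylor_shift_pCons taylor_shift_0 taylor_coeff_const coeff_pCons split: nat.splits)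
next
  case (add s t)
  then show ?case by (simp add: taylor_shift_add taylor_coeff_add)
next
  case (timesZ s)
  have "taylor_shift \<xi> \<eta> (smult [:0, 1:] s) = smult [:\<xi>, 1:] (taylor_shift \<xi> \<eta> s)"
    by (simp add: taylor_shift_smult pcompose_pCons)
  then show ?case by (auto simp: taylor_coeff_timesZ timesZ coeff_pCons split: nat.splits)
next
  case (timesW s)
  have "taylor_shift \<xi> \<eta> (pCons 0 s) = smult [:\<eta>:] (taylor_shift \<xi> \<eta> s) + pCons 0 (taylor_shift \<xi> \<eta> s)"
    by (simp add: taylor_shift_pCons)
  then show ?case by (auto simp: taylor_coeff_timesW timesW coeff_pCons split: nat.splits)
qed

lemma taylor_coeff_mult:
  "taylor_coeff (s * t) \<xi> \<eta> k l =
     (\<Sum>c\<le>k. \<Sum>d\<le>l. taylor_coeff s \<xi> \<eta> c d * taylor_coeff t \<xi> \<eta> (k - c) (l - d))"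
  unfolding coeff_taylor_shift[symmetric] taylor_shift_mult
  by (simp add: coeff_mult coeff_sum) (rule sum.swap)

lemma taylor_coeff_0_0: "taylor_coeff s \<xi> \<eta> 0 0 = eval2 s \<xi> \<eta>"
  unfolding taylor_coeff_def by simp

lemma taylor_coeff_zero [simp]: "taylor_coeff 0 \<xi> \<eta> k l = 0"
  using taylor_coeff_const[of 0] by simp

lemma taylor_coeff_conj: "taylor_coeff (conj_poly2 s) \<xi> \<eta> k l = cnj (taylor_coeff s (cnj \<xi>) (cnj \<eta>) k l)"
  by (induction s arbitrary: k l rule: bipoly_induct)
    (auto simp: conj_poly2_simps taylor_coeff_const taylor_coeff_add taylor_coeff_timesZ taylor_coeff_timesW
      split: nat.splits)

lemma eval2_taylor:
  "\<exists>N. \<forall>M\<ge>N. \<forall>x y. eval2 s (\<xi> + x) (\<eta> + y) = (\<Sum>l\<le>M. \<Sum>k\<le>M. taylor_coeff s \<xi> \<eta> k l * x ^ k * y ^ l)"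
proof -
  define t where "t = taylor_shift \<xi> \<eta> s"
  define N where "N = degree t + (\<Sum>l\<le>degree t. degree (coeff t l))"
  have "eval2 s (\<xi> + x) (\<eta> + y) = (\<Sum>l\<le>M. \<Sum>k\<le>M. taylor_coeff s \<xi> \<eta> k l * x ^ k * y ^ l)" if M: "M \<ge> N" for M x y
  proof -
    have dM: "degree (coeff t l) \<le> M" if "l \<le> degree t" for l
      using member_le_sum[of l "{..degree t}" "\<lambda>l. degree (coeff t l)"] that M unfolding N_def by simp
    have "eval2 s (\<xi> + x) (\<eta> + y) = (\<Sum>l\<le>degree t. poly (coeff t l) x * y ^ l)"
      unfolding eval2_taylor_shift[symmetric] t_def[symmetric]
      by (subst poly_altdef) (simp add: poly_sum poly_power)
    also have "\<dots> = (\<Sum>l\<le>degree t. \<Sum>k\<le>M. coeff (coeff t l) k * x ^ k * y ^ l)"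
    proof (rule sum.cong)
      fix l assume "l \<in> {..degree t}"
      then have "poly (coeff t l) x = (\<Sum>k\<le>M. coeff (coeff t l) k * x ^ k)"
        unfolding poly_altdef using dM[of l] by (intro sum.mono_neutral_left) (auto simp: coeff_eq_0)
      then show "poly (coeff t l) x * y ^ l = (\<Sum>k\<le>M. coeff (coeff t l) k * x ^ k * y ^ l)"
        by (simp add: sum_distrib_right)
    qed simp
    also have "\<dots> = (\<Sum>l\<le>M. \<Sum>k\<le>M. coeff (coeff t l) k * x ^ k * y ^ l)"
      using M unfolding N_def by (intro sum.mono_neutral_left) (auto simp: coeff_eq_0)
    finally show ?thesis unfolding t_def coeff_taylor_shift .
  qed
  then show ?thesis by blast
qed

subsection \<open>Jets at the zeros and the ideal generated by two polynomials\<close>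

abbreviation jet :: "complex poly \<Rightarrow> complex \<Rightarrow> nat \<Rightarrow> complex" where
  "jet a \<xi> k \<equiv> coeff (pcompose a [:\<xi>, 1:]) k"

lemma pcompose_shift_factor: "pcompose ([:- \<xi>, 1:] ^ n * r) [:\<xi>, 1:] = monom (1::complex) n * pcompose r [:\<xi>, 1:]"
proof -
  have "pcompose [:- \<xi>, 1:] [:\<xi>, 1:] = [:0, 1::complex:]" by (simp add: pcompose_pCons)
  moreover have "pcompose ([:- \<xi>, 1:] ^ n) [:\<xi>, 1:] = pcompose [:- \<xi>, 1:] [:\<xi>, 1:] ^ n"
    by (induction n) (simp_all only: power_0 power_Suc pcompose_1 pcompose_mult)
  ultimately show ?thesis by (simp add: pcompose_mult monom_altdef)
qed

lemma jet_factor: "jet ([:- \<xi>, 1:] ^ n * r) \<xi> k = (if k < n then 0 else jet r \<xi> (k - n))"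
  by (simp add: pcompose_shift_factor coeff_monom_mult)

lemma jet_0: "jet a \<xi> 0 = poly a \<xi>"
  by (simp add: pcompose_coeff_0)

lemma jet_below_order: "a \<noteq> 0 \<Longrightarrow> k < order \<xi> a \<Longrightarrow> jet a \<xi> k = 0"
  using order_decomp[of a \<xi>] jet_factor by metis

lemma jet_at_order: assumes "a \<noteq> 0" shows "jet a \<xi> (order \<xi> a) \<noteq> 0"
proof -
  obtain r where "a = [:- \<xi>, 1:] ^ order \<xi> a * r" "\<not> [:- \<xi>, 1:] dvd r" using order_decomp[OF assms] by blast
  then show ?thesis using jet_factor[of \<xi> "order \<xi> a" r "order \<xi> a"] jet_0[of r \<xi>]
    by (simp add: poly_eq_0_iff_dvd)
qed

lemma order_ge_if_jet_zero:
  assumes "a \<noteq> 0" "\<And>k. k < n \<Longrightarrow> jet a \<xi> k = 0" shows "n \<le> order \<xi> a"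
  using jet_at_order[OF assms(1)] assms(2) leI by blast

text \<open>
  Split off one common root at a time.
\<close>

lemma poly_dvd_if_order_le:
  fixes P a :: "complex poly"
  assumes "P \<noteq> 0" "a \<noteq> 0" "\<And>\<xi>. order \<xi> P \<le> order \<xi> a"
  shows "P dvd a"
  using assms
proof (induction "degree P" arbitrary: P a)
  case 0
  then obtain c where c: "P = [:c:]" using degree_eq_zeroE by metis
  then have "is_unit P" using 0(2) unfolding c by (intro is_unit_triv) auto
  then show ?case by (rule unit_imp_dvd)
next
  case (Suc n)
  have "\<not> constant (poly P)" using Suc(2) by (simp add: constant_degree)
  then obtain \<xi> where \<xi>: "poly P \<xi> = 0" using fundamental_theorem_of_algebra by blast
  then obtain P' where P': "P = [:- \<xi>, 1:] * P'" using poly_eq_0_iff_dvd by (metis dvdE)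
  have "order \<xi> P \<noteq> 0" using \<xi> Suc(3) order_root by blast
  then have "order \<xi> a \<noteq> 0" using Suc(5)[of \<xi>] by simp
  then have "poly a \<xi> = 0" using order_root Suc(4) by blast
  then obtain a' where a': "a = [:- \<xi>, 1:] * a'" using poly_eq_0_iff_dvd by (metis dvdE)
  have "P' dvd a'"
  proof (rule Suc(1))
    show "P' \<noteq> 0" "a' \<noteq> 0" using P' a' Suc(3,4) by auto
    then show "n = degree P'" using Suc(2) unfolding P' by (simp add: degree_mult_eq del: mult_pCons_left)
    show "order \<zeta> P' \<le> order \<zeta> a'" for \<zeta>
      using Suc(5)[of \<zeta>] Suc(3,4) unfolding P' a' by (simp add: order_mult del: mult_pCons_left)
  qed
  then show ?case unfolding P' a' by (intro mult_dvd_mono) auto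
qed

text \<open>
  Inversion of a power series up to order \<open>m\<close>. The dual basis below needs to invert
  the cofactor of \<open>(z - \<xi>)\<^sup>m\<close> near \<open>\<xi>\<close> in this sense.
\<close>

lemma truncated_inverse:
  fixes b :: "complex poly"
  assumes "coeff b 0 \<noteq> 0"
  shows "\<exists>r. \<forall>j<m. coeff (b * r) j = (if j = 0 then 1 else 0)"
proof (induction m)
  case (Suc m)
  then obtain r where r: "\<And>j. j < m \<Longrightarrow> coeff (b * r) j = (if j = 0 then 1 else 0)" by blast
  define c where "c = ((if m = 0 then 1 else 0) - coeff (b * r) m) / coeff b 0"
  have e: "coeff (b * (r + monom c m)) j = coeff (b * r) j + (if j < m then 0 else c * coeff b (j - m))" for j
    using coeff_monom_mult[of c m b j] by (simp add: distrib_left mult.commute)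
  have "coeff (b * (r + monom c m)) j = (if j = 0 then 1 else 0)" if "j < Suc m" for j
  proof (cases "j = m")
    case True
    then show ?thesis unfolding e using assms by (simp add: c_def)
  next
    case False
    then show ?thesis unfolding e using that r by simp
  qed
  then show ?case by blast
qed simp

definition zero_jets :: "complex poly \<Rightarrow> (complex \<times> nat) set" where
  "zero_jets P = (SIGMA \<xi>:{\<xi>. poly P \<xi> = 0}. {..<order \<xi> P})"

lemma finite_zero_jets: "P \<noteq> 0 \<Longrightarrow> finite (zero_jets P)"
  unfolding zero_jets_def by (intro finite_SigmaI poly_roots_finite) auto

lemma zero_jets_iff: "P \<noteq> 0 \<Longrightarrow> (\<xi>, k) \<in> zero_jets P \<longleftrightarrow> k < order \<xi> P"
  unfolding zero_jets_def by (auto simp: order_root)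

text \<open>Hermite interpolation: polynomials dual to the jets at the zeros of \<open>P\<close>.\<close>

lemma hermite_basis_exists:
  fixes P :: "complex poly"
  assumes P: "P \<noteq> 0"
  shows "\<exists>e. \<forall>(\<xi>, k)\<in>zero_jets P. \<forall>(\<zeta>, j)\<in>zero_jets P. jet (e \<xi> k) \<zeta> j = (if \<zeta> = \<xi> \<and> j = k then 1 else 0)"
proof -
  have "\<exists>e. \<forall>(\<zeta>, j)\<in>zero_jets P. jet e \<zeta> j = (if \<zeta> = \<xi> \<and> j = k then 1 else 0)" if k: "k < order \<xi> P" for \<xi> k
  proof -
    obtain Q where Q: "P = [:- \<xi>, 1:] ^ order \<xi> P * Q" "\<not> [:- \<xi>, 1:] dvd Q" using order_decomp[OF P] by blast
    define b where "b = pcompose Q [:\<xi>, 1:]"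
    have "coeff b 0 \<noteq> 0" using Q(2) unfolding b_def by (simp add: pcompose_coeff_0 poly_eq_0_iff_dvd)
    then obtain r where r: "\<And>j. j < order \<xi> P \<Longrightarrow> coeff (b * r) j = (if j = 0 then 1 else 0)"
      using truncated_inverse by blast
    \<comment> \<open>\<open>Q\<close> carries the other zeros of \<open>P\<close>; the truncated inverse \<open>r\<close> makes the expansion at \<open>\<xi>\<close> start with \<open>(z - \<xi>)\<^sup>k\<close> alone.\<close>
    define e where "e = [:- \<xi>, 1:] ^ k * (Q * pcompose r [:- \<xi>, 1:])"
    have "jet e \<zeta> j = (if \<zeta> = \<xi> \<and> j = k then 1 else 0)" if j: "j < order \<zeta> P" for \<zeta> j
    proof (cases "\<zeta> = \<xi>")
      case True
      have "pcompose [:- \<xi>, 1:] [:\<xi>, 1:] = [:0, 1::complex:]" by (simp add: pcompose_pCons)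
      then have "pcompose (Q * pcompose r [:- \<xi>, 1:]) [:\<xi>, 1:] = b * r"
        unfolding b_def by (simp add: pcompose_mult flip: pcompose_assoc)
      then have "jet e \<xi> j = (if j < k then 0 else coeff (b * r) (j - k))"
        unfolding e_def jet_factor by simp
      then show ?thesis using j r[of "j - k"] True by auto
    next
      case False
      have "order \<zeta> ([:- \<xi>, 1:] ^ order \<xi> P) = 0" using False by (simp add: order_0I)
      then have "order \<zeta> P = order \<zeta> Q" using P order_mult[of "[:- \<xi>, 1:] ^ order \<xi> P" Q \<zeta>] Q(1) by simp
      moreover obtain Q' where "Q = [:- \<zeta>, 1:] ^ order \<zeta> Q * Q'" using order_1 by (metis dvdE)
      ultimately have Q': "Q = [:- \<zeta>, 1:] ^ order \<zeta> P * Q'" by simp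
      have "e = [:- \<zeta>, 1:] ^ order \<zeta> P * (Q' * ([:- \<xi>, 1:] ^ k * pcompose r [:- \<xi>, 1:]))"
        unfolding e_def by (subst Q') (simp only: mult_ac)
      then show ?thesis using jet_factor j False by simp
    qed
    then show ?thesis using zero_jets_iff[OF P] by (intro exI[of _ e]) auto
  qed
  note ex = this
  define e where "e \<xi> k = (SOME e. \<forall>(\<zeta>, j)\<in>zero_jets P. jet e \<zeta> j = (if \<zeta> = \<xi> \<and> j = k then 1 else 0))" for \<xi> k
  have "\<forall>(\<zeta>, j)\<in>zero_jets P. jet (e \<xi> k) \<zeta> j = (if \<zeta> = \<xi> \<and> j = k then 1 else 0)" if "k < order \<xi> P" for \<xi> k
    unfolding e_def by (rule someI_ex) (rule ex[OF that])
  then show ?thesis using zero_jets_iff[OF P] by (intro exI[of _ e]) blast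
qed

definition hermite_basis :: "complex poly \<Rightarrow> complex \<Rightarrow> nat \<Rightarrow> complex poly" where
  "hermite_basis P = (SOME e. \<forall>(\<xi>, k)\<in>zero_jets P. \<forall>(\<zeta>, j)\<in>zero_jets P. jet (e \<xi> k) \<zeta> j = (if \<zeta> = \<xi> \<and> j = k then 1 else 0))"

lemma jet_hermite_basis:
  assumes "P \<noteq> 0" "k < order \<xi> P" "j < order \<zeta> P"
  shows "jet (hermite_basis P \<xi> k) \<zeta> j = (if \<zeta> = \<xi> \<and> j = k then 1 else 0)"
  using someI_ex[OF hermite_basis_exists[OF assms(1)]] assms(2,3) zero_jets_iff[OF assms(1)]
  unfolding hermite_basis_def[symmetric] by blast

lemma jet_sum: "jet (\<Sum>i\<in>X. smult (c i) (f i)) \<zeta> j = (\<Sum>i\<in>X. c i * jet (f i) \<zeta> j)"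
  by (simp add: pcompose_sum coeff_sum pcompose_smult)

lemma hermite_remainder:
  fixes P a :: "complex poly"
  assumes P: "P \<noteq> 0"
  shows "P dvd a - (\<Sum>(\<xi>, k)\<in>zero_jets P. smult (jet a \<xi> k) (hermite_basis P \<xi> k))" (is "P dvd a - ?r")
proof (cases "a - ?r = 0")
  case False
  have "jet (a - ?r) \<zeta> j = 0" if j: "j < order \<zeta> P" for \<zeta> j
  proof -
    have "jet ?r \<zeta> j = (\<Sum>x\<in>zero_jets P. case x of (\<xi>, k) \<Rightarrow> jet a \<xi> k * jet (hermite_basis P \<xi> k) \<zeta> j)"
      using jet_sum[of "\<lambda>x. jet a (fst x) (snd x)" "\<lambda>x. hermite_basis P (fst x) (snd x)" "zero_jets P" \<zeta> j]
      by (simp add: case_prod_beta)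
    also have "\<dots> = (\<Sum>x\<in>zero_jets P. if x = (\<zeta>, j) then jet a \<zeta> j else 0)"
      using j by (intro sum.cong) (auto simp: zero_jets_iff[OF P] jet_hermite_basis[OF P] split: if_splits)
    also have "\<dots> = jet a \<zeta> j" using j finite_zero_jets[OF P] by (simp add: zero_jets_iff[OF P])
    finally show ?thesis by (simp add: pcompose_diff)
  qed
  then show ?thesis using poly_dvd_if_order_le[OF P False] order_ge_if_jet_zero[OF False] by blast
qed simp

abbreviation in_w :: "complex poly \<Rightarrow> complex poly poly" where
  "in_w \<equiv> map_poly (\<lambda>c. [:c:])"

lemma in_w_pCons: "in_w (pCons c b) = pCons [:c:] (in_w b)"
  by (simp add: map_poly_pCons)

lemma in_w_add: "in_w (a + b) = in_w a + in_w b"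
  by (simp add: poly_eq_iff coeff_map_poly)

lemma in_w_smult: "in_w (smult c b) = smult [:c:] (in_w b)"
  by (simp add: poly_eq_iff coeff_map_poly mult.commute)

lemma in_w_mult: "in_w (a * b) = in_w a * in_w b"
  by (induction a) (simp_all add: in_w_pCons in_w_add in_w_smult)

lemma in_w_sum: "in_w (sum f X) = (\<Sum>i\<in>X. in_w (f i))"
  by (induction X rule: infinite_finite_induct) (auto simp: in_w_add)

lemma taylor_shift_in_w: "taylor_shift \<xi> \<eta> (in_w b) = in_w (pcompose b [:\<eta>, 1:])"
  by (induction b) (simp_all add: taylor_shift_0 in_w_pCons taylor_shift_pCons pcompose_pCons in_w_add in_w_mult in_w_smult)

lemma taylor_coeff_product: "taylor_coeff ([:a:] * in_w b) \<xi> \<eta> k l = jet a \<xi> k * jet b \<eta> l"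
  unfolding coeff_taylor_shift[symmetric] taylor_shift_mult
  by (simp add: taylor_shift_pCons taylor_shift_0 taylor_shift_in_w coeff_map_poly)

lemma taylor_coeff_in_z: "taylor_coeff [:a:] \<xi> \<eta> k l = (if l = 0 then jet a \<xi> k else 0)"
  using taylor_coeff_product[of a 1 \<xi> \<eta> k l] by (simp add: pcompose_1 map_poly_1)

lemma taylor_coeff_in_w: "taylor_coeff (in_w b) \<xi> \<eta> k l = (if k = 0 then jet b \<eta> l else 0)"
  using taylor_coeff_product[of 1 b \<xi> \<eta> k l] by (simp add: pcompose_1 flip: one_pCons)

lemma taylor_coeff_sum: "taylor_coeff (sum f X) \<xi> \<eta> k l = (\<Sum>i\<in>X. taylor_coeff (f i) \<xi> \<eta> k l)"
  by (induction X rule: infinite_finite_induct) (auto simp: taylor_coeff_add)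

lemma taylor_coeff_scale: "taylor_coeff (smult [:c:] s) \<xi> \<eta> k l = c * taylor_coeff s \<xi> \<eta> k l"
  unfolding coeff_taylor_shift[symmetric] taylor_shift_smult by simp

text \<open>
  Both sides are additive in \<open>s\<close>, so it suffices to treat products \<open>a(z) b(w)\<close>, and for these one
  divides \<open>a\<close> by \<open>P\<close> and \<open>b\<close> by \<open>Q\<close>: the jets of a product are products of jets.
\<close>

lemma bivariate_hermite_remainder:
  fixes P Q :: "complex poly" and s :: "complex poly poly"
  assumes P: "P \<noteq> 0" and Q: "Q \<noteq> 0"
  shows "\<exists>u v. s = [:P:] * u + in_w Q * v +
    (\<Sum>(\<xi>, k)\<in>zero_jets P. \<Sum>(\<eta>, l)\<in>zero_jets Q.
       smult [:taylor_coeff s \<xi> \<eta> k l:] ([:hermite_basis P \<xi> k:] * in_w (hermite_basis Q \<eta> l)))"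
    (is "\<exists>u v. s = _ * u + _ * v + ?r s")
proof -
  have radd: "?r (s + t) = ?r s + ?r t" for s t
  proof -
    have "smult [:x + y:] b = smult [:x:] b + smult [:y:] b" for x y :: complex and b :: "complex poly poly"
      by (metis add_pCons add.left_neutral smult_add_left)
    then show ?thesis by (simp only: taylor_coeff_add sum.distrib case_prod_beta)
  qed
  have add: "\<exists>u v. s + t = [:P:] * u + in_w Q * v + ?r (s + t)"
    if "\<exists>u v. s = [:P:] * u + in_w Q * v + ?r s" "\<exists>u v. t = [:P:] * u + in_w Q * v + ?r t" for s t
  proof -
    note st = that
    obtain u v where s: "s = [:P:] * u + in_w Q * v + ?r s" using st(1) by (elim exE)
    obtain u' v' where t: "t = [:P:] * u' + in_w Q * v' + ?r t" using st(2) by (elim exE)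
    have "s + t = ([:P:] * u + in_w Q * v + ?r s) + ([:P:] * u' + in_w Q * v' + ?r t)"
      by (rule arg_cong2[where f = "(+)", OF s t])
    also have "\<dots> = [:P:] * (u + u') + in_w Q * (v + v') + ?r (s + t)"
      unfolding radd distrib_left by (simp only: add_ac)
    finally show ?thesis by (intro exI)
  qed
  have prod: "\<exists>u v. [:a:] * in_w b = [:P:] * u + in_w Q * v + ?r ([:a:] * in_w b)" for a b
  proof -
    define ra where "ra = (\<Sum>(\<xi>, k)\<in>zero_jets P. smult (jet a \<xi> k) (hermite_basis P \<xi> k))"
    define rb where "rb = (\<Sum>(\<eta>, l)\<in>zero_jets Q. smult (jet b \<eta> l) (hermite_basis Q \<eta> l))"
    obtain a1 where "a - ra = P * a1" using hermite_remainder[OF P, of a] unfolding ra_def by (rule dvdE)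
    then have a1: "a = P * a1 + ra" by (simp add: algebra_simps)
    obtain b1 where "b - rb = Q * b1" using hermite_remainder[OF Q, of b] unfolding rb_def by (rule dvdE)
    then have b1: "b = Q * b1 + rb" by (simp add: algebra_simps)
    have cm: "[:x * y:] = [:x:] * [:y:]" and ca: "[:x + y:] = [:x:] + [:y:]" for x y :: "complex poly" by simp_all
    have cs: "[:sum f X:] = (\<Sum>i\<in>X. [:f i:])" for f :: "complex \<times> nat \<Rightarrow> complex poly" and X
      by (induction X rule: infinite_finite_induct) (auto simp: ca)
    have "[:a:] * in_w b = [:P:] * ([:a1:] * in_w b) + [:ra:] * in_w b"
      by (subst a1) (simp only: ca cm distrib_right mult.assoc)
    also have "[:ra:] * in_w b = in_w Q * ([:ra:] * in_w b1) + [:ra:] * in_w rb"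
      by (subst b1) (simp only: in_w_add in_w_mult distrib_left mult.left_commute)
    also have "[:ra:] * in_w rb = ?r ([:a:] * in_w b)"
    proof -
      have sm: "[:smult x f:] * smult [:y:] g = smult [:x * y:] ([:f:] * g)" for x y :: complex and f g
      proof -
        have "[:smult x f:] = smult [:x:] [:f:]" by simp
        then show ?thesis by (simp only: mult_smult_left mult_smult_right smult_smult) simp
      qed
      have "[:ra:] * in_w rb = (\<Sum>i\<in>zero_jets P. [:smult (jet a (fst i) (snd i)) (hermite_basis P (fst i) (snd i)):])
        * (\<Sum>j\<in>zero_jets Q. smult [:jet b (fst j) (snd j):] (in_w (hermite_basis Q (fst j) (snd j))))"
        unfolding ra_def rb_def cs in_w_sum by (simp only: case_prod_beta in_w_smult cs)
      also have "\<dots> = ?r ([:a:] * in_w b)"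
        unfolding sum_product taylor_coeff_product case_prod_beta sm ..
      finally show ?thesis .
    qed
    finally show ?thesis unfolding add.assoc by (intro exI)
  qed
  have all: "\<exists>u v. (\<Sum>l\<in>X. [:coeff s l:] * in_w (monom 1 l)) = [:P:] * u + in_w Q * v + ?r (\<Sum>l\<in>X. [:coeff s l:] * in_w (monom 1 l))"
    for X
  proof (induction X rule: infinite_finite_induct)
    case (insert x X)
    then show ?case using add[OF prod[of "coeff s x" "monom 1 x"] insert(3)] by simp
  qed (use prod[of 0 0] in simp_all)
  have eq: "(\<Sum>l\<le>degree s. [:coeff s l:] * in_w (monom 1 l)) = s"
  proof -
    have "[:coeff s l:] * in_w (monom 1 l) = monom (coeff s l) l" for l
      by (simp add: map_poly_monom smult_monom flip: one_pCons)
    then show ?thesis by (simp add: poly_as_sum_of_monoms)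
  qed
  show ?thesis using all[of "{..degree s}"] unfolding eq .
qed

text \<open>
  Used to compare two decompositions of one function, whereas the interpolation lemma that
  follows produces a decomposition.
\<close>

corollary in_ideal_if_jets_vanish:
  fixes P Q :: "complex poly"
  assumes P: "P \<noteq> 0" and Q: "Q \<noteq> 0"
    and z: "\<And>\<xi> \<eta> k l. k < order \<xi> P \<Longrightarrow> l < order \<eta> Q \<Longrightarrow> taylor_coeff s \<xi> \<eta> k l = 0"
  shows "\<exists>u v. s = [:P:] * u + in_w Q * v"
proof -
  have "(\<Sum>(\<xi>, k)\<in>zero_jets P. \<Sum>(\<eta>, l)\<in>zero_jets Q.
       smult [:taylor_coeff s \<xi> \<eta> k l:] ([:hermite_basis P \<xi> k:] * in_w (hermite_basis Q \<eta> l))) = 0"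
    by (intro sum.neutral ballI) (auto simp: zero_jets_iff P Q z intro!: sum.neutral)
  then show ?thesis using bivariate_hermite_remainder[OF P Q, of s] by simp
qed

lemma bivariate_interpolation:
  fixes P Q :: "complex poly" and c :: "complex \<Rightarrow> complex \<Rightarrow> nat \<Rightarrow> nat \<Rightarrow> complex"
  assumes P: "P \<noteq> 0" and Q: "Q \<noteq> 0"
  shows "\<exists>s. \<forall>\<xi> \<eta> k l. k < order \<xi> P \<longrightarrow> l < order \<eta> Q \<longrightarrow> taylor_coeff s \<xi> \<eta> k l = c \<xi> \<eta> k l"
proof -
  define s where "s = (\<Sum>i\<in>zero_jets P. \<Sum>j\<in>zero_jets Q. smult [:c (fst i) (fst j) (snd i) (snd j):]
     ([:hermite_basis P (fst i) (snd i):] * in_w (hermite_basis Q (fst j) (snd j))))"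
  have "taylor_coeff s \<xi> \<eta> k l = c \<xi> \<eta> k l" if k: "k < order \<xi> P" and l: "l < order \<eta> Q" for \<xi> \<eta> k l
  proof -
    have "taylor_coeff s \<xi> \<eta> k l = (\<Sum>i\<in>zero_jets P. \<Sum>j\<in>zero_jets Q.
        c (fst i) (fst j) (snd i) (snd j) * (jet (hermite_basis P (fst i) (snd i)) \<xi> k * jet (hermite_basis Q (fst j) (snd j)) \<eta> l))"
      unfolding s_def taylor_coeff_sum taylor_coeff_scale taylor_coeff_product ..
    also have "\<dots> = (\<Sum>i\<in>zero_jets P. \<Sum>j\<in>zero_jets Q. if j = (\<eta>, l) then (if i = (\<xi>, k) then c \<xi> \<eta> k l else 0) else 0)"
      using k l by (intro sum.cong refl) (auto simp: zero_jets_iff P Q jet_hermite_basis split: if_splits)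
    also have "\<dots> = c \<xi> \<eta> k l"
      using k l by (simp add: finite_zero_jets P Q zero_jets_iff)
    finally show ?thesis .
  qed
  then show ?thesis by blast
qed

section \<open>The function class and its decompositions\<close>

abbreviation cpoly :: "real poly \<Rightarrow> complex poly" where
  "cpoly p \<equiv> map_poly complex_of_real p"

lemma poly_z_eq: "poly_z p = [:cpoly p:]"
  by (simp add: poly_z_def)

lemma poly_w_eq: "poly_w q = in_w (cpoly q)"
  by (simp add: poly_w_def map_poly_map_poly o_def)

lemma poly_cpoly: "poly (cpoly r) (complex_of_real x) = complex_of_real (poly r x)"
  by (induction r) (simp_all add: map_poly_pCons)

lemma ev_poly_z: "ev (poly_z p) z = complex_of_real (poly p (Re z))"
  and ev_poly_w: "ev (poly_w q) z = complex_of_real (poly q (Im z))"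
proof -
  have "poly (in_w b) [:y:] = [:poly b y:]" for b and y :: complex
    by (induction b) (simp_all add: in_w_pCons)
  then show "ev (poly_z p) z = complex_of_real (poly p (Re z))" "ev (poly_w q) z = complex_of_real (poly q (Im z))"
    unfolding poly_z_eq poly_w_eq by (simp_all add: poly_cpoly)
qed

lemma continuous_on_ev: "continuous_on A (ev s)"
proof -
  have "continuous_on A (\<lambda>z. eval2 s (f z) (g z))" if "continuous_on A f" "continuous_on A g" for f g :: "complex \<Rightarrow> complex"
  proof (induction s rule: bipoly_induct)
    case (timesZ s)
    then show ?case using that by (simp add: continuous_intros)
  qed (use that in \<open>simp_all add: continuous_intros\<close>)
  from this[of "\<lambda>z. of_real (Re z)" "\<lambda>z. of_real (Im z)"] show ?thesis by (simp add: continuous_intros)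
qed

lemma jet_cnj: "jet (cpoly p) (cnj \<xi>) k = cnj (jet (cpoly p) \<xi> k)"
proof -
  have "map_poly cnj (cpoly p) = cpoly p" by (simp add: poly_eq_iff coeff_map_poly)
  then have "conj_poly2 [:cpoly p:] = [:cpoly p:]" unfolding conj_poly2_def by (simp add: map_poly_pCons)
  then show ?thesis
    using taylor_coeff_conj[of "[:cpoly p:]" \<xi> 0 k 0] by (simp add: taylor_coeff_in_z)
qed

lemma cpoly_eq_0_iff [simp]: "cpoly p = 0 \<longleftrightarrow> p = 0"
  by (auto simp: poly_eq_iff coeff_map_poly)

text \<open>
  Multiplicity is read off from the first jet that does not vanish, and jets of real polynomials
  are conjugation invariant.
\<close>

lemma zero_mult_cnj:
  assumes "p \<noteq> 0" shows "zero_mult p (cnj \<xi>) = zero_mult p \<xi>"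
proof -
  have "order \<xi> (cpoly p) \<le> order (cnj \<xi>) (cpoly p)" for \<xi>
    using assms by (intro order_ge_if_jet_zero) (auto simp: jet_cnj jet_below_order)
  from this[of \<xi>] this[of "cnj \<xi>"] show ?thesis unfolding zero_mult_def by simp
qed

lemma bounded_mult_comp:
  fixes f g :: "'a \<Rightarrow> complex"
  assumes "bounded (f ` A)" "bounded (g ` A)" shows "bounded ((\<lambda>z. f z * g z) ` A)"
proof -
  obtain B C where B: "\<And>z. z \<in> A \<Longrightarrow> cmod (f z) \<le> B" and C: "\<And>z. z \<in> A \<Longrightarrow> cmod (g z) \<le> C"
    using assms unfolding bounded_iff by auto
  have "cmod (f z * g z) \<le> B * C" if "z \<in> A" for z
    unfolding norm_mult
    by (rule mult_mono[OF B[OF that] C[OF that] order_trans[OF norm_ge_zero B[OF that]] norm_ge_zero])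
  then show ?thesis by (intro boundedI[of _ "B * C"]) auto
qed

lemma locally_bounded_imp_bounded:
  fixes g :: "complex \<Rightarrow> complex"
  assumes S: "compact S" and loc: "\<And>w. w \<in> S \<Longrightarrow> \<exists>e>0. \<exists>C. \<forall>z\<in>D. dist w z < e \<longrightarrow> cmod (g z) \<le> C" and D: "D \<subseteq> S"
  shows "bounded (g ` D)"
proof -
  obtain e C where e: "\<And>w. w \<in> S \<Longrightarrow> 0 < e w" and C: "\<And>w z. w \<in> S \<Longrightarrow> z \<in> D \<Longrightarrow> dist w z < e w \<Longrightarrow> cmod (g z) \<le> C w"
    using loc by metis
  have cover: "S \<subseteq> (\<Union>w\<in>S. ball w (e w))"
  proof
    fix w assume "w \<in> S"
    then show "w \<in> (\<Union>w\<in>S. ball w (e w))" using e by (intro UN_I[of w]) auto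
  qed
  obtain T where T: "T \<subseteq> S" "finite T" "S \<subseteq> (\<Union>w\<in>T. ball w (e w))"
    by (rule compactE_image[OF S open_ball cover])
  have "cmod (g z) \<le> (\<Sum>w\<in>T. \<bar>C w\<bar>)" if z: "z \<in> D" for z
  proof -
    obtain w where w: "w \<in> T" "dist w z < e w" using T(3) D z by auto
    then have "cmod (g z) \<le> \<bar>C w\<bar>" using C[of w z] T(1) z by fastforce
    also have "\<dots> \<le> (\<Sum>w\<in>T. \<bar>C w\<bar>)" using T(2) w(1) by (intro member_le_sum) auto
    finally show ?thesis .
  qed
  then show ?thesis by (intro boundedI[of _ "\<Sum>w\<in>T. \<bar>C w\<bar>"]) auto
qed

text \<open>
  The points of \<open>S\<close> satisfy \<open>\<bar>p\<bar> \<le> \<bar>p + q\<bar>\<close> and \<open>\<bar>q\<bar> \<le> \<bar>p + q\<bar>\<close>; so \<open>p + q\<close> vanishes on \<open>S\<close> only at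
  critical points, and there not faster than \<open>p\<close> and \<open>q\<close> do.  The spectrum of \<open>\<Theta>(N)\<close> has this property
  although \<open>p\<close> and \<open>q\<close> may be negative on it.
\<close>

locale dominated_set =
  fixes p q :: "real poly" and S :: "complex set"
  assumes p0: "p \<noteq> 0" and q0: "q \<noteq> 0" and compact_S: "compact S"
    and dominated: "z \<in> S \<Longrightarrow> \<bar>poly p (Re z)\<bar> \<le> \<bar>poly p (Re z) + poly q (Im z)\<bar>"
      "z \<in> S \<Longrightarrow> \<bar>poly q (Im z)\<bar> \<le> \<bar>poly p (Re z) + poly q (Im z)\<bar>"
begin

abbreviation "K \<equiv> crit_real p q"
abbreviation m :: "complex \<Rightarrow> nat" where "m z \<equiv> zero_mult p (complex_of_real (Re z))"
abbreviation n :: "complex \<Rightarrow> nat" where "n z \<equiv> zero_mult q (complex_of_real (Im z))"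
abbreviation tc :: "complex poly poly \<Rightarrow> complex \<Rightarrow> nat \<Rightarrow> nat \<Rightarrow> complex" where
  "tc s z \<equiv> taylor_coeff s (complex_of_real (Re z)) (complex_of_real (Im z))"
abbreviation pq :: "complex \<Rightarrow> complex" where
  "pq z \<equiv> complex_of_real (poly p (Re z) + poly q (Im z))"
abbreviation \<alpha> :: "complex \<Rightarrow> complex" where "\<alpha> z \<equiv> jet (cpoly p) (complex_of_real (Re z)) (m z)"
abbreviation \<beta> :: "complex \<Rightarrow> complex" where "\<beta> z \<equiv> jet (cpoly q) (complex_of_real (Im z)) (n z)"

lemma order_eq: "order \<xi> (cpoly p) = zero_mult p \<xi>" "order \<xi> (cpoly q) = zero_mult q \<xi>"
  by (simp_all add: zero_mult_def)

lemma alpha_nonzero: "\<alpha> z \<noteq> 0" and beta_nonzero: "\<beta> z \<noteq> 0"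
  using jet_at_order[of "cpoly p"] jet_at_order[of "cpoly q"] p0 q0 by (simp_all add: order_eq)

lemma critD: "z \<in> K \<Longrightarrow> 0 < m z" "z \<in> K \<Longrightarrow> 0 < n z"
proof -
  have "0 < zero_mult r (complex_of_real x)" if "r \<noteq> 0" "poly r x = 0" for r x
  proof -
    have "poly (cpoly r) (complex_of_real x) = 0" using that(2) by (simp add: poly_cpoly)
    then have "order (complex_of_real x) (cpoly r) \<noteq> 0" using that(1) order_root cpoly_eq_0_iff by blast
    then show ?thesis unfolding zero_mult_def by simp
  qed
  then show "z \<in> K \<Longrightarrow> 0 < m z" "z \<in> K \<Longrightarrow> 0 < n z" unfolding crit_real_def using p0 q0 by simp_all
qed

text \<open>
  Entries below the top ones exist exactly at the zeros, which splits them into the real and the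
  nonreal critical points.
\<close>

lemma crit_cases: "(\<exists>z\<in>K. \<xi> = complex_of_real (Re z) \<and> \<eta> = complex_of_real (Im z)) \<or> (\<xi>, \<eta>) \<in> crit_nonreal p q"
  if "k < zero_mult p \<xi>" "l < zero_mult q \<eta>"
proof -
  have r: "poly (cpoly p) \<xi> = 0" "poly (cpoly q) \<eta> = 0"
    using that order_root[of "cpoly p" \<xi>] order_root[of "cpoly q" \<eta>] unfolding zero_mult_def by auto
  show ?thesis
  proof (cases "\<xi> \<in> \<real> \<and> \<eta> \<in> \<real>")
    case True
    then have e: "\<xi> = complex_of_real (Re \<xi>)" "\<eta> = complex_of_real (Re \<eta>)" by (auto simp: complex_is_Real_iff complex_eq_iff)
    then have "poly p (Re \<xi>) = 0" "poly q (Re \<eta>) = 0" using r poly_cpoly by (metis of_real_eq_0_iff)+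
    then show ?thesis using e by (intro disjI1 bexI[of _ "Complex (Re \<xi>) (Re \<eta>)"]) (auto simp: crit_real_def)
  qed (use r in \<open>auto simp: crit_nonreal_def\<close>)
qed

lemma finite_K: "finite K"
proof -
  have "K \<subseteq> (\<lambda>(x, y). Complex x y) ` ({x. poly p x = 0} \<times> {y. poly q y = 0})"
  proof
    fix z assume "z \<in> K"
    then show "z \<in> (\<lambda>(x, y). Complex x y) ` ({x. poly p x = 0} \<times> {y. poly q y = 0})"
      unfolding crit_real_def by (intro image_eqI[of _ _ "(Re z, Im z)"]) auto
  qed
  then show ?thesis
    by (rule finite_subset) (use p0 q0 in \<open>simp add: poly_roots_finite\<close>)
qed

lemma S_borel: "S \<in> sets borel" "K \<in> sets borel" "S - K \<in> sets borel" "S \<inter> K \<in> sets borel"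
  using compact_S finite_K by (auto simp: borel_compact finite_imp_closed)

lemma pq_nonzero: "z \<in> S - K \<Longrightarrow> pq z \<noteq> 0"
  using dominated[of z] unfolding crit_real_def by (auto simp flip: of_real_add)

lemma tc_poly_z: "tc (poly_z p) z k l = (if l = 0 then jet (cpoly p) (complex_of_real (Re z)) k else 0)"
  and tc_poly_w: "tc (poly_w q) z k l = (if k = 0 then jet (cpoly q) (complex_of_real (Im z)) l else 0)"
  unfolding poly_z_eq poly_w_eq taylor_coeff_in_z taylor_coeff_in_w by simp_all

lemma jet_below: "k < zero_mult p \<xi> \<Longrightarrow> jet (cpoly p) \<xi> k = 0" "l < zero_mult q \<xi> \<Longrightarrow> jet (cpoly q) \<xi> l = 0"
  using jet_below_order[of "cpoly p"] jet_below_order[of "cpoly q"] p0 q0 by (simp_all add: order_eq)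

lemma bounded_ev: "\<exists>C. \<forall>z\<in>S. cmod (ev s z) \<le> C"
  using compact_imp_bounded[OF compact_continuous_image[OF continuous_on_ev compact_S], of s]
  unfolding bounded_iff by auto

text \<open>
  A decomposition in terms of jets: \<open>\<phi>\<close> agrees with \<open>s\<close> below the top entries, and \<open>g\<close>, \<open>h\<close> describe
  the remaining difference relative to \<open>p + q\<close>.
\<close>

lemma admissible_iff:
  "admissible p q S \<phi> s g h \<longleftrightarrow>
     bounded (g ` (S - K)) \<and> g \<in> borel_measurable (restrict_space borel (S - K)) \<and> \<phi> \<in> M_class p q S \<and>
     (\<forall>z\<in>K. \<forall>k<m z. \<forall>l<n z. \<phi> (Inl z) k l = tc s z k l) \<and>
     (\<forall>\<xi> \<eta>. (\<xi>, \<eta>) \<in> crit_nonreal p q \<longrightarrow> (\<forall>k<zero_mult p \<xi>. \<forall>l<zero_mult q \<eta>. \<phi> (Inr (\<xi>, \<eta>)) k l = taylor_coeff s \<xi> \<eta> k l)) \<and>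
     (\<forall>z\<in>S - K. \<phi> (Inl z) 0 0 = ev s z + pq z * g z) \<and>
     (\<forall>z\<in>S \<inter> K. \<phi> (Inl z) (m z) 0 = tc s z (m z) 0 + \<alpha> z * fst (h z) \<and>
        \<phi> (Inl z) 0 (n z) = tc s z 0 (n z) + \<beta> z * snd (h z))"
proof -
  have pfM: "poly_fun p q S s \<in> M_class p q S" for s unfolding M_class_def poly_fun_def by auto
  have diffM: "fdiff \<phi> (poly_fun p q S s) \<in> M_class p q S \<longleftrightarrow> \<phi> \<in> M_class p q S"
    using pfM unfolding M_class_def fdiff_def by (auto; metis eq_iff_diff_eq_0)
  have pfK: "poly_fun p q S s (Inl z) k l = tc s z k l" if "z \<in> K" "k < m z" "l < n z" for s z k l
    using that unfolding poly_fun_def dom_pts_def idx_def idx_A_def idx_B_def by auto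
  have pfI: "poly_fun p q S s (Inr (\<xi>, \<eta>)) k l = (if k < zero_mult p \<xi> \<and> l < zero_mult q \<eta> then taylor_coeff s \<xi> \<eta> k l else 0)"
    if "(\<xi>, \<eta>) \<in> crit_nonreal p q" for \<xi> \<eta> k l
    using that unfolding poly_fun_def dom_pts_def idx_def idx_B_def by auto
  have pfS: "poly_fun p q S s (Inl z) k l = (if k = 0 \<and> l = 0 then ev s z else 0)" if "z \<in> S - K" for z k l
    using that unfolding poly_fun_def dom_pts_def idx_def by (auto simp: taylor_coeff_0_0)
  have pftop: "poly_fun p q S s (Inl z) (m z) 0 = tc s z (m z) 0" "poly_fun p q S s (Inl z) 0 (n z) = tc s z 0 (n z)"
    if "z \<in> K" for s z
    using that unfolding poly_fun_def dom_pts_def idx_def idx_A_def idx_B_def by auto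
  have pfoff: "poly_fun p q S s (Inl z) k l = 0" if "z \<in> K" "\<not> (k < m z \<and> l < n z)" "(k, l) \<noteq> (m z, 0)" "(k, l) \<noteq> (0, n z)" for z k l
    using that unfolding poly_fun_def dom_pts_def idx_def idx_A_def idx_B_def by auto
  have R: "fdiff \<phi> (poly_fun p q S s) \<in> R_class p q S \<longleftrightarrow> \<phi> \<in> M_class p q S \<and>
     (\<forall>z\<in>K. \<forall>k<m z. \<forall>l<n z. \<phi> (Inl z) k l = tc s z k l) \<and>
     (\<forall>\<xi> \<eta>. (\<xi>, \<eta>) \<in> crit_nonreal p q \<longrightarrow> (\<forall>k<zero_mult p \<xi>. \<forall>l<zero_mult q \<eta>. \<phi> (Inr (\<xi>, \<eta>)) k l = taylor_coeff s \<xi> \<eta> k l))"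
    (is "_ \<longleftrightarrow> _ \<and> ?a \<and> ?b")
  proof -
    have a: "(\<forall>z\<in>K. \<forall>(k, l)\<in>idx_B (m z) (n z). fdiff \<phi> (poly_fun p q S s) (Inl z) k l = 0) \<longleftrightarrow> ?a"
      unfolding idx_B_def fdiff_def by (auto simp: pfK)
    have b: "(\<forall>w\<in>crit_nonreal p q. \<forall>k l. fdiff \<phi> (poly_fun p q S s) (Inr w) k l = 0) \<longleftrightarrow> ?b" if "\<phi> \<in> M_class p q S"
    proof -
      have "\<phi> (Inr (\<xi>, \<eta>)) k l = 0" if "\<not> (k < zero_mult p \<xi> \<and> l < zero_mult q \<eta>)" for \<xi> \<eta> k l
        using \<open>\<phi> \<in> M_class p q S\<close> that unfolding M_class_def idx_def idx_B_def by auto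
      then show ?thesis unfolding fdiff_def by (auto simp: pfI split: if_splits)
    qed
    show ?thesis unfolding R_class_def using diffM a b by auto
  qed
  have pqt: "pq_times p q S g h z k l = (if z \<notin> K then (if (k, l) = (0, 0) then pq z * g z else 0)
      else if (k, l) = (m z, 0) then \<alpha> z * fst (h z) else if (k, l) = (0, n z) then \<beta> z * snd (h z) else 0)" for z k l
  proof -
    have "fadd (poly_fun p q S (poly_z p)) (poly_fun p q S (poly_w q)) (Inl z) (m z) 0 = \<alpha> z"
      "fadd (poly_fun p q S (poly_z p)) (poly_fun p q S (poly_w q)) (Inl z) 0 (n z) = \<beta> z" if "z \<in> K"
      using pftop[OF that] critD[OF that] unfolding fadd_def by (simp_all add: tc_poly_z tc_poly_w)
    then show ?thesis unfolding pq_times_def Let_def by auto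
  qed
  have S: "(\<forall>z\<in>S. \<forall>k l. \<phi> (Inl z) k l = poly_fun p q S s (Inl z) k l + pq_times p q S g h z k l) \<longleftrightarrow>
     (\<forall>z\<in>S - K. \<phi> (Inl z) 0 0 = ev s z + pq z * g z) \<and>
     (\<forall>z\<in>S \<inter> K. \<phi> (Inl z) (m z) 0 = tc s z (m z) 0 + \<alpha> z * fst (h z) \<and>
        \<phi> (Inl z) 0 (n z) = tc s z 0 (n z) + \<beta> z * snd (h z))" (is "?l \<longleftrightarrow> ?r")
    if M: "\<phi> \<in> M_class p q S" and a: "\<forall>z\<in>K. \<forall>k<m z. \<forall>l<n z. \<phi> (Inl z) k l = tc s z k l"
  proof
    assume l: ?l
    show ?r
    proof (intro conjI ballI)
      fix z assume "z \<in> S - K"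
      then show "\<phi> (Inl z) 0 0 = ev s z + pq z * g z" using l pfS[of z 0 0] by (auto simp: pqt)
    next
      fix z assume z: "z \<in> S \<inter> K"
      show "\<phi> (Inl z) (m z) 0 = tc s z (m z) 0 + \<alpha> z * fst (h z)"
        using l z pftop(1)[of z] by (auto simp: pqt)
      show "\<phi> (Inl z) 0 (n z) = tc s z 0 (n z) + \<beta> z * snd (h z)"
        using l z pftop(2)[of z] critD[of z] by (auto simp: pqt)
    qed
  next
    assume r: ?r
    show ?l
    proof (intro ballI allI)
      fix z k l assume z: "z \<in> S"
      show "\<phi> (Inl z) k l = poly_fun p q S s (Inl z) k l + pq_times p q S g h z k l"
      proof (cases "z \<in> K")
        case False
        have "\<phi> (Inl z) k l = 0" if "(k, l) \<noteq> (0, 0)"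
          using M that False unfolding M_class_def idx_def by auto
        then show ?thesis using r z False pfS[of z k l] by (auto simp: pqt)
      next
        case True
        consider "(k, l) = (m z, 0)" | "(k, l) = (0, n z)" | "k < m z" "l < n z"
          | "\<not> (k < m z \<and> l < n z)" "(k, l) \<noteq> (m z, 0)" "(k, l) \<noteq> (0, n z)" by blast
        then show ?thesis
        proof cases
          case 1
          then show ?thesis using r z True pftop(1)[OF True] by (auto simp: pqt)
        next
          case 2
          then show ?thesis using r z True pftop(2)[OF True] critD[OF True] by (auto simp: pqt)
        next
          case 3
          then show ?thesis using a True pfK[OF True 3] by (auto simp: pqt)
        next
          case 4
          then have "\<phi> (Inl z) k l = 0" using M True unfolding M_class_def idx_def idx_A_def idx_B_def by auto
          then show ?thesis using pfoff[OF True 4] 4 True by (auto simp: pqt)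
        qed
      qed
    qed
  qed
  show ?thesis unfolding admissible_def R using S by blast
qed

subsection \<open>Estimates at a critical point\<close>

abbreviation jet_poly :: "(nat \<Rightarrow> nat \<Rightarrow> complex) \<Rightarrow> complex \<Rightarrow> complex \<Rightarrow> complex" where
  "jet_poly a w z \<equiv> \<Sum>k<m w. \<Sum>l<n w. a k l * complex_of_real (Re (z - w) ^ k * Im (z - w) ^ l)"

abbreviation gauge :: "complex \<Rightarrow> complex \<Rightarrow> real" where
  "gauge w z \<equiv> max (\<bar>Re (z - w)\<bar> ^ m w) (\<bar>Im (z - w)\<bar> ^ n w)"

lemma gauge_pos: "z \<noteq> w \<Longrightarrow> 0 < gauge w z"
proof -
  assume "z \<noteq> w"
  then have "Re (z - w) \<noteq> 0 \<or> Im (z - w) \<noteq> 0" by (auto simp: complex_eq_iff)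
  then show ?thesis by (auto simp: less_max_iff_disj)
qed

text \<open>
  A monomial left out by the Taylor section has exponent at least \<open>m w\<close> in the real
  or at least \<open>n w\<close> in the imaginary direction, hence is bounded by the denominator
  in the definition of \<open>F_class\<close>.
\<close>

lemma taylor_remainder:
  "\<exists>C. \<forall>z. dist w z < 1 \<longrightarrow>
     cmod (ev s z - jet_poly (tc s w) w z) \<le> C * gauge w z"
proof -
  obtain N where N: "\<And>M x y. M \<ge> N \<Longrightarrow> eval2 s (of_real (Re w) + x) (of_real (Im w) + y)
      = (\<Sum>l\<le>M. \<Sum>k\<le>M. tc s w k l * x ^ k * y ^ l)" using eval2_taylor by blast
  define M where "M = N + m w + n w"
  define A where "A = {..M} \<times> {..M}"
  define C where "C = (\<Sum>(k, l)\<in>A. cmod (tc s w k l))"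
  have "cmod (ev s z - jet_poly (tc s w) w z) \<le> C * gauge w z"
    if z: "dist w z < 1" for z
  proof -
    define x where "x = Re (z - w)"
    define y where "y = Im (z - w)"
    have xy: "\<bar>x\<bar> \<le> 1" "\<bar>y\<bar> \<le> 1"
      using z abs_Re_le_cmod[of "z - w"] abs_Im_le_cmod[of "z - w"]
      unfolding x_def y_def by (auto simp: dist_norm norm_minus_commute)
    define f where "f i = (case i of (k, l) \<Rightarrow> tc s w k l * of_real (x ^ k * y ^ l))" for i
    have "ev s z = eval2 s (of_real (Re w) + of_real x) (of_real (Im w) + of_real y)"
      unfolding x_def y_def by simp
    also have "\<dots> = (\<Sum>l\<le>M. \<Sum>k\<le>M. tc s w k l * of_real (x ^ k * y ^ l))"
      by (subst N[of M]) (auto simp: M_def mult.assoc)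
    also have "\<dots> = sum f A" unfolding A_def f_def by (subst sum.swap) (simp add: sum.cartesian_product)
    finally have ev: "ev s z = sum f A" .
    define B where "B = {..<m w} \<times> {..<n w}"
    have BA: "B \<subseteq> A" unfolding A_def B_def M_def by auto
    have lower: "(\<Sum>k<m w. \<Sum>l<n w. tc s w k l * of_real (x ^ k * y ^ l)) = sum f B"
      unfolding B_def f_def by (simp add: sum.cartesian_product)
    have "ev s z - sum f B = sum f (A - B)"
      unfolding ev using sum_diff[OF _ BA, of f] by (simp add: A_def)
    also have "cmod \<dots> \<le> (\<Sum>i\<in>A - B. (case i of (k, l) \<Rightarrow> cmod (tc s w k l)) * gauge w z)"
    proof (rule sum_norm_le)
      fix i assume i: "i \<in> A - B"
      obtain k l where kl: "i = (k, l)" by (cases i)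
      have "\<bar>x\<bar> ^ k * \<bar>y\<bar> ^ l \<le> gauge w z"
      proof (cases "m w \<le> k")
        case True
        have "\<bar>x\<bar> ^ k * \<bar>y\<bar> ^ l \<le> \<bar>x\<bar> ^ m w * 1"
          using xy True by (intro mult_mono power_decreasing power_le_one) auto
        then show ?thesis unfolding x_def by simp
      next
        case False
        then have "n w \<le> l" using i kl unfolding B_def by auto
        then have "\<bar>x\<bar> ^ k * \<bar>y\<bar> ^ l \<le> 1 * \<bar>y\<bar> ^ n w"
          using xy by (intro mult_mono power_decreasing power_le_one) auto
        then show ?thesis unfolding y_def by simp
      qed
      then show "cmod (f i) \<le> (case i of (k, l) \<Rightarrow> cmod (tc s w k l)) * gauge w z"
        unfolding f_def kl by (simp add: norm_mult norm_power abs_mult power_abs mult_left_mono)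
    qed
    also have "\<dots> \<le> (\<Sum>i\<in>A. (case i of (k, l) \<Rightarrow> cmod (tc s w k l)) * gauge w z)"
      by (rule sum_mono2) (auto simp: A_def le_max_iff_disj)
    also have "\<dots> = C * gauge w z" unfolding C_def by (simp add: sum_distrib_right)
    finally show ?thesis unfolding lower[symmetric] x_def y_def .
  qed
  then show ?thesis by blast
qed

lemma pq_eq_ev: "pq z = ev (poly_z p + poly_w q) z"
  by (simp add: ev_poly_z ev_poly_w)

lemma pq_upper: "w \<in> K \<Longrightarrow> \<exists>C. \<forall>z. dist w z < 1 \<longrightarrow> cmod (pq z) \<le> C * gauge w z"
proof -
  assume w: "w \<in> K"
  have "tc (poly_z p + poly_w q) w k l = 0" if "k < m w" "l < n w" for k l
    using jet_below(1)[OF that(1)] jet_below(2)[OF that(2)]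
    unfolding taylor_coeff_add tc_poly_z tc_poly_w by (auto simp del: coeff_pcompose_0)
  then have z: "jet_poly (tc (poly_z p + poly_w q) w) w z = 0" for z
    by (intro sum.neutral ballI) simp
  show ?thesis using taylor_remainder[of w "poly_z p + poly_w q"] unfolding z pq_eq_ev diff_zero .
qed

lemma poly_lower:
  fixes r :: "real poly"
  assumes r: "r \<noteq> 0"
  shows "\<exists>c>0. \<exists>e>0. \<forall>t. \<bar>t - x\<bar> < e \<longrightarrow> c * \<bar>t - x\<bar> ^ zero_mult r (complex_of_real x) \<le> \<bar>poly r t\<bar>"
proof -
  obtain b where b: "cpoly r = [:- complex_of_real x, 1:] ^ zero_mult r (complex_of_real x) * b"
    "\<not> [:- complex_of_real x, 1:] dvd b"
    using order_decomp[of "cpoly r"] r unfolding zero_mult_def by auto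
  have b0: "poly b (complex_of_real x) \<noteq> 0" using b(2) by (simp add: poly_eq_0_iff_dvd)
  define c where "c = cmod (poly b (complex_of_real x)) / 2"
  have "((\<lambda>t. cmod (poly b (complex_of_real t))) \<longlongrightarrow> cmod (poly b (complex_of_real x))) (at x)"
    by (intro tendsto_norm isCont_tendsto_compose[OF poly_isCont] tendsto_of_real tendsto_ident_at)
  then have "\<forall>\<^sub>F t in at x. c < cmod (poly b (complex_of_real t))"
    by (rule order_tendstoD) (use b0 in \<open>simp add: c_def\<close>)
  then obtain e where e: "e > 0" "\<And>t. t \<noteq> x \<Longrightarrow> dist t x < e \<Longrightarrow> c < cmod (poly b (complex_of_real t))"
    unfolding eventually_at by blast
  have "c * \<bar>t - x\<bar> ^ zero_mult r (complex_of_real x) \<le> \<bar>poly r t\<bar>" if t: "\<bar>t - x\<bar> < e" for t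
  proof -
    have "c \<le> cmod (poly b (complex_of_real t))"
      using e(2)[of t] t b0 by (cases "t = x") (auto simp: dist_real_def c_def)
    moreover have "complex_of_real (poly r t) = complex_of_real (t - x) ^ zero_mult r (complex_of_real x) * poly b (complex_of_real t)"
      unfolding poly_cpoly[symmetric] by (subst b(1)) (simp add: poly_power)
    then have "\<bar>poly r t\<bar> = \<bar>t - x\<bar> ^ zero_mult r (complex_of_real x) * cmod (poly b (complex_of_real t))"
      by (metis norm_mult norm_of_real norm_power)
    ultimately show ?thesis by (simp add: mult.commute mult_right_mono)
  qed
  then show ?thesis using e(1) b0 by (intro exI[of _ c] conjI exI[of _ e]) (auto simp: c_def)
qed

text \<open>
  Near \<open>w\<close> the polynomial \<open>p\<close> is bounded below by its leading power
  and so is \<open>q\<close>; domination transfers both bounds to \<open>p + q\<close>,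
  excluding cancellation.
\<close>

lemma pq_lower: "\<exists>c>0. \<exists>e>0. \<forall>z\<in>S. dist w z < e \<longrightarrow> c * gauge w z \<le> cmod (pq z)"
proof -
  obtain c e where ce: "c > 0" "e > 0" "\<And>t. \<bar>t - Re w\<bar> < e \<Longrightarrow> c * \<bar>t - Re w\<bar> ^ m w \<le> \<bar>poly p t\<bar>"
    using poly_lower[OF p0] by blast
  obtain c' e' where ce': "c' > 0" "e' > 0" "\<And>t. \<bar>t - Im w\<bar> < e' \<Longrightarrow> c' * \<bar>t - Im w\<bar> ^ n w \<le> \<bar>poly q t\<bar>"
    using poly_lower[OF q0] by blast
  have "min c c' * gauge w z \<le> cmod (pq z)" if z: "z \<in> S" "dist w z < min e e'" for z
  proof -
    have d: "\<bar>Re z - Re w\<bar> < e" "\<bar>Im z - Im w\<bar> < e'"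
      using z(2) abs_Re_le_cmod[of "z - w"] abs_Im_le_cmod[of "z - w"] by (auto simp: dist_norm norm_minus_commute)
    have "min c c' * \<bar>Re (z - w)\<bar> ^ m w \<le> c * \<bar>Re z - Re w\<bar> ^ m w"
      "min c c' * \<bar>Im (z - w)\<bar> ^ n w \<le> c' * \<bar>Im z - Im w\<bar> ^ n w"
      by (auto intro: mult_right_mono)
    then have "min c c' * \<bar>Re (z - w)\<bar> ^ m w \<le> cmod (pq z)" "min c c' * \<bar>Im (z - w)\<bar> ^ n w \<le> cmod (pq z)"
      using ce(3)[OF d(1)] ce'(3)[OF d(2)] dominated[OF z(1)] unfolding norm_of_real by linarith+
    then show ?thesis by (simp add: max_def)
  qed
  then show ?thesis using ce(1,2) ce'(1,2) by (intro exI[of _ "min c c'"] conjI exI[of _ "min e e'"]) auto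
qed

lemma away_from_K: "\<exists>e>0. \<forall>z. z \<noteq> w \<longrightarrow> dist w z < e \<longrightarrow> z \<notin> K"
  using finite_set_avoid[OF finite_K, of w] by (metis dist_commute leD)

subsection \<open>Functions with a decomposition\<close>

text \<open>
  Near a critical point both the Taylor remainder of \<open>s\<close> and \<open>p + q\<close>
  are bounded by the gauge function, while \<open>g\<close> is bounded.
\<close>

lemma F_class_if_admissible:
  assumes adm: "admissible p q S \<phi> s g h"
  shows "\<phi> \<in> F_class p q S"
proof -
  note a = adm[unfolded admissible_iff]
  have gm: "g \<in> borel_measurable (restrict_space borel (S - K))" using a by blast
  obtain G where G: "\<And>z. z \<in> S - K \<Longrightarrow> cmod (g z) \<le> G" using a unfolding bounded_iff by auto
  have f: "\<phi> (Inl z) 0 0 = ev s z + pq z * g z" if "z \<in> S - K" for z using a that by blast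
  have evm: "ev s \<in> borel_measurable (restrict_space borel (S - K))" for s
    by (rule measurable_restrict_space1) (rule borel_measurable_continuous_onI[OF continuous_on_ev])
  have "(\<lambda>z. ev s z + pq z * g z) \<in> borel_measurable (restrict_space borel (S - K))"
    unfolding pq_eq_ev by (intro borel_measurable_add borel_measurable_times evm gm)
  then have meas: "(\<lambda>z. \<phi> (Inl z) 0 0) \<in> borel_measurable (restrict_space borel (S - K))"
    by (subst measurable_cong[where g = "\<lambda>z. ev s z + pq z * g z"]) (auto simp: space_restrict_space f)
  obtain C where C: "\<And>z. z \<in> S \<Longrightarrow> cmod (ev s z) \<le> C" using bounded_ev by blast
  obtain C' where C': "\<And>z. z \<in> S \<Longrightarrow> cmod (pq z) \<le> C'" using bounded_ev[of "poly_z p + poly_w q"] unfolding pq_eq_ev by blast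
  have bd: "bounded ((\<lambda>z. \<phi> (Inl z) 0 0) ` (S - K))"
  proof (intro boundedI)
    fix y assume "y \<in> (\<lambda>z. \<phi> (Inl z) 0 0) ` (S - K)"
    then obtain z where z: "z \<in> S - K" "y = \<phi> (Inl z) 0 0" by blast
    have "cmod (pq z * g z) \<le> C' * G"
      unfolding norm_mult
      by (rule mult_mono[OF _ G[OF z(1)] order_trans[OF norm_ge_zero] norm_ge_zero]) (use C'[of z] z(1) in blast)+
    then show "norm y \<le> C + C' * G"
      unfolding z(2) f[OF z(1)] using norm_triangle_ineq[of "ev s z" "pq z * g z"] C[of z] z(1) by auto
  qed
  have quot: "\<exists>C. \<forall>\<^sub>F z in at w within S. norm ((\<phi> (Inl z) 0 0 - jet_poly (\<phi> (Inl w)) w z) / of_real (gauge w z)) \<le> C"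
    if w: "w \<in> S \<inter> K" for w
  proof -
    obtain C1 where C1: "\<And>z. dist w z < 1 \<Longrightarrow>
      cmod (ev s z - jet_poly (tc s w) w z) \<le> C1 * gauge w z"
      using taylor_remainder by blast
    obtain C2 where C2: "\<And>z. dist w z < 1 \<Longrightarrow> cmod (pq z) \<le> C2 * gauge w z" using pq_upper w by blast
    obtain e where e: "e > 0" "\<And>z. z \<noteq> w \<Longrightarrow> dist w z < e \<Longrightarrow> z \<notin> K" using away_from_K by blast
    have "norm ((\<phi> (Inl z) 0 0 - jet_poly (\<phi> (Inl w)) w z) / of_real (gauge w z)) \<le> C1 + C2 * G"
      if z: "z \<in> S" "z \<noteq> w" "dist z w < min 1 e" for z
    proof -
      have zS: "z \<in> S - K" "dist w z < 1" using e(2) z by (auto simp: dist_commute)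
      have "jet_poly (\<phi> (Inl w)) w z
        = jet_poly (tc s w) w z"
        using a w by (intro sum.cong refl) auto
      then have "\<phi> (Inl z) 0 0 - jet_poly (\<phi> (Inl w)) w z
        = (ev s z - jet_poly (tc s w) w z) + pq z * g z"
        by (simp only: f[OF zS(1)]) simp
      also have "cmod \<dots> \<le> C1 * gauge w z + (C2 * gauge w z) * G"
      proof (rule norm_triangle_mono[OF C1[OF zS(2)]])
        show "cmod (pq z * g z) \<le> (C2 * gauge w z) * G"
          unfolding norm_mult
          by (rule mult_mono[OF C2[OF zS(2)] G[OF zS(1)] order_trans[OF norm_ge_zero C2[OF zS(2)]] norm_ge_zero])
      qed
      finally have "cmod (\<phi> (Inl z) 0 0 - jet_poly (\<phi> (Inl w)) w z)
        \<le> (C1 + C2 * G) * gauge w z" by (simp add: algebra_simps)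
      moreover have "0 < gauge w z" using gauge_pos[OF z(2)] .
      ultimately show ?thesis by (simp only: norm_divide norm_of_real abs_of_pos pos_divide_le_eq)
    qed
    then have "\<forall>\<^sub>F z in at w within S. norm ((\<phi> (Inl z) 0 0 - jet_poly (\<phi> (Inl w)) w z) / of_real (gauge w z)) \<le> C1 + C2 * G"
      unfolding eventually_at using e(1) by (intro exI[of _ "min 1 e"]) auto
    then show ?thesis by blast
  qed
  show ?thesis unfolding F_class_def Let_def using a meas bd quot by blast
qed

text \<open>
  Conversely, let the polynomial interpolate the jets of \<open>\<phi>\<close>; the quotient of the remaining
  difference by \<open>p + q\<close> is bounded near every point of the compact set \<open>S\<close>, near critical points
  because \<open>p + q\<close> dominates the gauge function there.
\<close>

lemma admissible_if_F_class:
  assumes F: "\<phi> \<in> F_class p q S"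
  shows "\<exists>s g h. admissible p q S \<phi> s g h"
proof -
  have M: "\<phi> \<in> M_class p q S" and fm: "(\<lambda>z. \<phi> (Inl z) 0 0) \<in> borel_measurable (restrict_space borel (S - K))"
    and fb: "bounded ((\<lambda>z. \<phi> (Inl z) 0 0) ` (S - K))" using F unfolding F_class_def by auto
  have quot: "\<exists>C. \<forall>\<^sub>F z in at w within S. norm ((\<phi> (Inl z) 0 0 - jet_poly (\<phi> (Inl w)) w z) / of_real (gauge w z)) \<le> C"
    if "w \<in> S \<inter> K" for w using F that unfolding F_class_def Let_def by blast
  \<comment> \<open>The prescribed jets: those of \<open>\<phi>\<close> at the real and at the nonreal critical points.\<close>
  define c where "c \<xi> \<eta> k l = (if \<xi> \<in> \<real> \<and> \<eta> \<in> \<real> then \<phi> (Inl (Complex (Re \<xi>) (Re \<eta>))) k l else \<phi> (Inr (\<xi>, \<eta>)) k l)"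
    for \<xi> \<eta> k l
  obtain s where s: "\<And>\<xi> \<eta> k l. k < zero_mult p \<xi> \<Longrightarrow> l < zero_mult q \<eta> \<Longrightarrow> taylor_coeff s \<xi> \<eta> k l = c \<xi> \<eta> k l"
    using bivariate_interpolation[of "cpoly p" "cpoly q" c] p0 q0 unfolding order_eq cpoly_eq_0_iff by blast
  have sK: "\<phi> (Inl z) k l = tc s z k l" if "k < m z" "l < n z" for z k l
    using s[OF that] by (simp add: c_def)
  have sI: "\<phi> (Inr (\<xi>, \<eta>)) k l = taylor_coeff s \<xi> \<eta> k l"
    if "(\<xi>, \<eta>) \<in> crit_nonreal p q" "k < zero_mult p \<xi>" "l < zero_mult q \<eta>" for \<xi> \<eta> k l
    using s[OF that(2,3)] that(1) by (auto simp: c_def crit_nonreal_def)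
  define g where "g z = (\<phi> (Inl z) 0 0 - ev s z) / pq z" for z
  define h where "h z = ((\<phi> (Inl z) (m z) 0 - tc s z (m z) 0) / \<alpha> z, (\<phi> (Inl z) 0 (n z) - tc s z 0 (n z)) / \<beta> z)" for z
  have evm: "ev s \<in> borel_measurable (restrict_space borel (S - K))" for s
    by (rule measurable_restrict_space1) (rule borel_measurable_continuous_onI[OF continuous_on_ev])
  have gm: "g \<in> borel_measurable (restrict_space borel (S - K))"
    unfolding g_def pq_eq_ev by (intro borel_measurable_divide borel_measurable_diff fm evm)
  have "bounded (g ` (S - K))"
  proof (rule locally_bounded_imp_bounded[OF compact_S])
    fix w assume w: "w \<in> S"
    show "\<exists>e>0. \<exists>C. \<forall>z\<in>S - K. dist w z < e \<longrightarrow> cmod (g z) \<le> C"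
    proof (cases "w \<in> K")
      case True
      obtain C0 e0 where C0: "e0 > 0" "\<And>z. z \<in> S \<Longrightarrow> z \<noteq> w \<Longrightarrow> dist z w < e0 \<Longrightarrow>
          norm ((\<phi> (Inl z) 0 0 - jet_poly (\<phi> (Inl w)) w z) / of_real (gauge w z)) \<le> C0"
        using quot[of w] w True unfolding eventually_at by blast
      obtain C1 where C1: "\<And>z. dist w z < 1 \<Longrightarrow>
        cmod (ev s z - jet_poly (tc s w) w z) \<le> C1 * gauge w z"
        using taylor_remainder by blast
      obtain c2 e2 where c2: "c2 > 0" "e2 > 0" "\<And>z. z \<in> S \<Longrightarrow> dist w z < e2 \<Longrightarrow> c2 * gauge w z \<le> cmod (pq z)"
        using pq_lower by blast
      have "cmod (g z) \<le> (C0 + C1) / c2" if z: "z \<in> S - K" "dist w z < Min {1, e0, e2}" for z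
      proof -
        define \<tau> where "\<tau> = jet_poly (tc s w) w z"
        have zw: "z \<noteq> w" using z(1) True by auto
        have d: "dist w z < 1" "dist z w < e0" "dist w z < e2" using z(2) by (auto simp: dist_commute)
        have gp: "0 < gauge w z" using gauge_pos[OF zw] .
        have "jet_poly (\<phi> (Inl w)) w z = \<tau>"
          unfolding \<tau>_def by (intro sum.cong refl) (auto simp: sK)
        then have "cmod (\<phi> (Inl z) 0 0 - \<tau>) \<le> C0 * gauge w z"
          using C0(2)[of z] z(1) zw d(2) gp by (simp only: norm_divide norm_of_real abs_of_pos pos_divide_le_eq) auto
        then have "cmod (\<phi> (Inl z) 0 0 - ev s z) \<le> (C0 + C1) * gauge w z"
          using C1[OF d(1)] norm_triangle_ineq4[of "\<phi> (Inl z) 0 0 - \<tau>" "ev s z - \<tau>"]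
          unfolding \<tau>_def[symmetric] by (simp add: distrib_right)
        then have "cmod (g z) \<le> (C0 + C1) * gauge w z / (c2 * gauge w z)"
          unfolding g_def norm_divide using c2(3)[of z] z(1) d(3) c2(1) gp
          by (intro frac_le) (auto intro: order_trans[OF norm_ge_zero])
        then show ?thesis using gp by simp
      qed
      moreover have "0 < Min {1, e0, e2}" using C0(1) c2(2) by simp
      ultimately show ?thesis by blast
    next
      case False
      have nz: "pq w \<noteq> 0" using pq_nonzero w False by blast
      have "(pq \<longlongrightarrow> pq w) (at w)"
        using continuous_on_ev[of UNIV "poly_z p + poly_w q"] unfolding pq_eq_ev[symmetric]
        by (simp add: continuous_on_def)
      from order_tendstoD(1)[OF tendsto_norm[OF this], of "cmod (pq w) / 2"]
      have "\<forall>\<^sub>F z in at w. cmod (pq w) / 2 < cmod (pq z)" using nz by simp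
      then obtain e where e: "e > 0" "\<And>z. z \<noteq> w \<Longrightarrow> dist z w < e \<Longrightarrow> cmod (pq w) / 2 < cmod (pq z)"
        unfolding eventually_at by blast
      obtain C where C: "\<And>z. z \<in> S - K \<Longrightarrow> cmod (\<phi> (Inl z) 0 0) \<le> C" using fb unfolding bounded_iff by auto
      obtain C' where C': "\<And>z. z \<in> S \<Longrightarrow> cmod (ev s z) \<le> C'" using bounded_ev by blast
      have "cmod (g z) \<le> (C + C') / (cmod (pq w) / 2)" if z: "z \<in> S - K" "dist w z < e" for z
      proof -
        have "cmod (pq w) / 2 \<le> cmod (pq z)"
          using e(2)[of z] z(2) by (cases "z = w") (auto simp: dist_commute less_imp_le simp del: of_real_add)
        moreover have "cmod (\<phi> (Inl z) 0 0 - ev s z) \<le> C + C'"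
          using norm_triangle_ineq4[of "\<phi> (Inl z) 0 0" "ev s z"] C[OF z(1)] C'[of z] z(1) by auto
        ultimately show ?thesis
          unfolding g_def norm_divide using nz
          by (intro frac_le) (auto intro: order_trans[OF norm_ge_zero] simp del: of_real_add)
      qed
      then show ?thesis using e(1) by blast
    qed
  qed auto
  moreover have "\<phi> (Inl z) 0 0 = ev s z + pq z * g z" if "z \<in> S - K" for z
    unfolding g_def using pq_nonzero[OF that] by (simp del: of_real_add)
  moreover have "\<phi> (Inl z) (m z) 0 = tc s z (m z) 0 + \<alpha> z * fst (h z)"
    "\<phi> (Inl z) 0 (n z) = tc s z 0 (n z) + \<beta> z * snd (h z)" for z
    unfolding h_def using alpha_nonzero beta_nonzero by simp_all
  ultimately have "admissible p q S \<phi> s g h"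
    unfolding admissible_iff using gm M sK sI by blast
  then show ?thesis by blast
qed

subsection \<open>Operations on decompositions\<close>

lemma admissible_add:
  assumes "admissible p q S \<phi> s g h" "admissible p q S \<psi> t g' h'"
  shows "admissible p q S (fadd \<phi> \<psi>) (s + t) (\<lambda>z. g z + g' z) (\<lambda>z. (fst (h z) + fst (h' z), snd (h z) + snd (h' z)))"
proof -
  note a = assms(1)[unfolded admissible_iff] and b = assms(2)[unfolded admissible_iff]
  have "fadd \<phi> \<psi> \<in> M_class p q S" using a b unfolding M_class_def fadd_def by auto
  moreover have "bounded ((\<lambda>z. g z + g' z) ` (S - K))" using a b by (intro bounded_plus_comp) auto
  moreover have "(\<lambda>z. g z + g' z) \<in> borel_measurable (restrict_space borel (S - K))"
    using a b by (intro borel_measurable_add) auto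
  ultimately show ?thesis
    unfolding admissible_iff using a b by (auto simp: fadd_def taylor_coeff_add algebra_simps)
qed

lemma admissible_scale:
  assumes "admissible p q S \<phi> s g h"
  shows "admissible p q S (fscale c \<phi>) (smult [:c:] s) (\<lambda>z. c * g z) (\<lambda>z. (c * fst (h z), c * snd (h z)))"
proof -
  note a = assms(1)[unfolded admissible_iff]
  have "fscale c \<phi> \<in> M_class p q S" using a unfolding M_class_def fscale_def by auto
  moreover have "bounded ((\<lambda>z. c * g z) ` (S - K))"
    using a bounded_mult_comp[of "\<lambda>z. c" "S - K" g] by (auto simp: image_constant_conv)
  moreover have "(\<lambda>z. c * g z) \<in> borel_measurable (restrict_space borel (S - K))"
    using a by (intro borel_measurable_times) auto
  ultimately show ?thesis
    unfolding admissible_iff using a by (auto simp: fscale_def taylor_coeff_scale algebra_simps)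
qed

lemma admissible_poly: "admissible p q S (poly_fun p q S s) s (\<lambda>z. 0) (\<lambda>z. (0, 0))"
  unfolding admissible_iff
proof (intro conjI ballI allI impI)
  show "bounded ((\<lambda>z. 0 :: complex) ` (S - K))" by (rule finite_imp_bounded) (auto intro: finite_subset[of _ "{0}"])
qed (use critD in \<open>auto simp: M_class_def poly_fun_def dom_pts_def idx_def idx_A_def idx_B_def taylor_coeff_0_0\<close>)

text \<open>
  In the product only the entries below the top ones and the products of a top entry with a
  \<open>(0, 0)\<close> entry contribute.
\<close>

lemma top_entry_convolution:
  fixes a b :: "nat \<Rightarrow> complex"
  assumes "0 < k"
  shows "(\<Sum>c\<le>k. (a c + (if c = k then x else 0)) * (b (k - c) + (if k - c = k then y else 0)))
    = (\<Sum>c\<le>k. a c * b (k - c)) + (a 0 * y + b 0 * x)"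
proof -
  have "(\<Sum>c\<le>k. (a c + (if c = k then x else 0)) * (b (k - c) + (if k - c = k then y else 0)))
    = (\<Sum>c\<le>k. a c * b (k - c) + ((if c = k then x * b 0 else 0) + (if c = 0 then a 0 * y else 0)))"
    using assms by (intro sum.cong) (auto simp: algebra_simps)
  also have "\<dots> = (\<Sum>c\<le>k. a c * b (k - c)) + (x * b 0 + a 0 * y)" by (simp add: sum.distrib)
  finally show ?thesis by (simp add: algebra_simps)
qed

lemma admissible_mult:
  assumes "admissible p q S \<phi> s g h" "admissible p q S \<psi> t g' h'"
  shows "admissible p q S (fmult p q \<phi> \<psi>) (s * t) (\<lambda>z. ev s z * g' z + ev t z * g z + pq z * (g z * g' z))
    (\<lambda>z. (ev s z * fst (h' z) + ev t z * fst (h z), ev s z * snd (h' z) + ev t z * snd (h z)))"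
    (is "admissible _ _ _ _ _ ?g ?h")
proof -
  note a = assms(1)[unfolded admissible_iff] and b = assms(2)[unfolded admissible_iff]
  have M: "fmult p q \<phi> \<psi> \<in> M_class p q S"
  proof -
    have "\<phi> u c d = 0" if "u \<notin> dom_pts p q S" for u c d using a that unfolding M_class_def by blast
    then show ?thesis unfolding M_class_def fmult_def by auto
  qed
  have lowK: "fmult p q \<phi> \<psi> (Inl z) k l = tc (s * t) z k l" if z: "z \<in> K" "k < m z" "l < n z" for z k l
  proof -
    have "(k, l) \<in> idx p q (Inl z)" using z unfolding idx_def idx_A_def idx_B_def by auto
    moreover have "\<phi> (Inl z) c d * \<psi> (Inl z) (k - c) (l - d) = tc s z c d * tc t z (k - c) (l - d)" if "c \<le> k" "d \<le> l" for c d
      using a b z that by auto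
    ultimately show ?thesis unfolding fmult_def taylor_coeff_mult by simp
  qed
  have lowI: "fmult p q \<phi> \<psi> (Inr (\<xi>, \<eta>)) k l = taylor_coeff (s * t) \<xi> \<eta> k l"
    if z: "(\<xi>, \<eta>) \<in> crit_nonreal p q" "k < zero_mult p \<xi>" "l < zero_mult q \<eta>" for \<xi> \<eta> k l
  proof -
    have "(k, l) \<in> idx p q (Inr (\<xi>, \<eta>))" using z unfolding idx_def idx_B_def by auto
    moreover have "\<phi> (Inr (\<xi>, \<eta>)) c d * \<psi> (Inr (\<xi>, \<eta>)) (k - c) (l - d)
        = taylor_coeff s \<xi> \<eta> c d * taylor_coeff t \<xi> \<eta> (k - c) (l - d)" if "c \<le> k" "d \<le> l" for c d
      using a b z that by auto
    ultimately show ?thesis unfolding fmult_def taylor_coeff_mult by simp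
  qed
  have off: "fmult p q \<phi> \<psi> (Inl z) 0 0 = ev (s * t) z + pq z * ?g z" if z: "z \<in> S - K" for z
  proof -
    have "(0, 0) \<in> idx p q (Inl z)" using z unfolding idx_def by auto
    then have "fmult p q \<phi> \<psi> (Inl z) 0 0 = (ev s z + pq z * g z) * (ev t z + pq z * g' z)"
      using a b z unfolding fmult_def by simp
    then show ?thesis by (simp add: algebra_simps del: of_real_add)
  qed
  have top: "fmult p q \<phi> \<psi> (Inl z) (m z) 0 = tc (s * t) z (m z) 0 + \<alpha> z * fst (?h z)"
    "fmult p q \<phi> \<psi> (Inl z) 0 (n z) = tc (s * t) z 0 (n z) + \<beta> z * snd (?h z)" if z: "z \<in> S \<inter> K" for z
  proof -
    have mn: "0 < m z" "0 < n z" using critD z by auto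
    have i: "(m z, 0) \<in> idx p q (Inl z)" "(0, n z) \<in> idx p q (Inl z)"
      using z unfolding idx_def idx_A_def by auto
    have f1: "\<phi> (Inl z) c 0 = tc s z c 0 + (if c = m z then \<alpha> z * fst (h z) else 0)"
      "\<psi> (Inl z) c 0 = tc t z c 0 + (if c = m z then \<alpha> z * fst (h' z) else 0)" if "c \<le> m z" for c
      using a b z mn that by (cases "c = m z"; simp)+
    have f2: "\<phi> (Inl z) 0 d = tc s z 0 d + (if d = n z then \<beta> z * snd (h z) else 0)"
      "\<psi> (Inl z) 0 d = tc t z 0 d + (if d = n z then \<beta> z * snd (h' z) else 0)" if "d \<le> n z" for d
      using a b z mn that by (cases "d = n z"; simp)+
    have "fmult p q \<phi> \<psi> (Inl z) (m z) 0 = (\<Sum>c\<le>m z. \<phi> (Inl z) c 0 * \<psi> (Inl z) (m z - c) 0)"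
      using i unfolding fmult_def by simp
    also have "\<dots> = (\<Sum>c\<le>m z. (tc s z c 0 + (if c = m z then \<alpha> z * fst (h z) else 0))
        * (tc t z (m z - c) 0 + (if m z - c = m z then \<alpha> z * fst (h' z) else 0)))"
      by (intro sum.cong refl) (simp only: f1 atMost_iff diff_le_self)
    also have "\<dots> = tc (s * t) z (m z) 0 + \<alpha> z * fst (?h z)"
      unfolding top_entry_convolution[OF mn(1), where a = "\<lambda>c. tc s z c 0" and b = "\<lambda>c. tc t z c 0"] taylor_coeff_mult by (simp add: taylor_coeff_0_0 algebra_simps)
    finally show "fmult p q \<phi> \<psi> (Inl z) (m z) 0 = tc (s * t) z (m z) 0 + \<alpha> z * fst (?h z)" .
    have "fmult p q \<phi> \<psi> (Inl z) 0 (n z) = (\<Sum>d\<le>n z. \<phi> (Inl z) 0 d * \<psi> (Inl z) 0 (n z - d))"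
      using i unfolding fmult_def by simp
    also have "\<dots> = (\<Sum>d\<le>n z. (tc s z 0 d + (if d = n z then \<beta> z * snd (h z) else 0))
        * (tc t z 0 (n z - d) + (if n z - d = n z then \<beta> z * snd (h' z) else 0)))"
      by (intro sum.cong refl) (simp only: f2 atMost_iff diff_le_self)
    also have "\<dots> = tc (s * t) z 0 (n z) + \<beta> z * snd (?h z)"
      unfolding top_entry_convolution[OF mn(2), where a = "tc s z 0" and b = "tc t z 0"] taylor_coeff_mult by (simp add: taylor_coeff_0_0 algebra_simps)
    finally show "fmult p q \<phi> \<psi> (Inl z) 0 (n z) = tc (s * t) z 0 (n z) + \<beta> z * snd (?h z)" .
  qed
  have evm: "ev s \<in> borel_measurable (restrict_space borel (S - K))" for s
    by (rule measurable_restrict_space1) (rule borel_measurable_continuous_onI[OF continuous_on_ev])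
  have meas: "?g \<in> borel_measurable (restrict_space borel (S - K))"
    unfolding pq_eq_ev using a b by (intro borel_measurable_add borel_measurable_times evm) auto
  have evb: "bounded (ev s ` (S - K))" for s
    using bounded_ev[of s] unfolding bounded_iff by blast
  have bd: "bounded (?g ` (S - K))"
    unfolding pq_eq_ev using a b by (intro bounded_plus_comp bounded_mult_comp evb) auto
  show ?thesis unfolding admissible_iff using M lowK lowI off top meas bd by blast
qed

lemma admissible_sharp:
  assumes "admissible p q S \<phi> s g h"
  shows "admissible p q S (fsharp \<phi>) (conj_poly2 s) (\<lambda>z. cnj (g z)) (\<lambda>z. (cnj (fst (h z)), cnj (snd (h z))))"
proof -
  note a = assms(1)[unfolded admissible_iff]
  have nr: "(cnj \<xi>, cnj \<eta>) \<in> crit_nonreal p q \<longleftrightarrow> (\<xi>, \<eta>) \<in> crit_nonreal p q" for \<xi> \<eta>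
  proof -
    have "poly (cpoly r) (cnj \<zeta>) = 0 \<longleftrightarrow> poly (cpoly r) \<zeta> = 0" for r \<zeta>
      using jet_cnj[of r \<zeta> 0] by (simp only: jet_0) simp
    then show ?thesis unfolding crit_nonreal_def by (simp add: complex_is_Real_iff)
  qed
  have M: "fsharp \<phi> \<in> M_class p q S"
  proof -
    define cu :: "point \<Rightarrow> point" where "cu u = (case u of Inl z \<Rightarrow> Inl z | Inr (\<xi>, \<eta>) \<Rightarrow> Inr (cnj \<xi>, cnj \<eta>))" for u
    have "fsharp \<phi> u k l = cnj (\<phi> (cu u) k l)" for u k l
      unfolding fsharp_def cu_def by (simp split: sum.split prod.split)
    moreover have "cu u \<in> dom_pts p q S \<longleftrightarrow> u \<in> dom_pts p q S" for u
      unfolding cu_def dom_pts_def by (auto simp: nr split: sum.split prod.split)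
    moreover have "idx p q (cu u) = idx p q u" for u
      unfolding cu_def idx_def by (simp add: zero_mult_cnj p0 q0 split: sum.split prod.split)
    ultimately show ?thesis using a unfolding M_class_def by simp
  qed
  have al: "cnj (\<alpha> z) = \<alpha> z" "cnj (\<beta> z) = \<beta> z" for z
    by (simp_all flip: jet_cnj)
  have bd: "bounded ((\<lambda>z. cnj (g z)) ` (S - K))" using a unfolding bounded_iff by auto
  have meas: "(\<lambda>z. cnj (g z)) \<in> borel_measurable (restrict_space borel (S - K))"
    using a by (intro borel_measurable_continuous_on[of cnj]) (auto intro: continuous_intros)
  have "cnj (pq z) = pq z" for z by simp
  then show ?thesis
    unfolding admissible_iff using a M bd meas nr
    by (auto simp: fsharp_def taylor_coeff_conj zero_mult_cnj p0 q0 al simp flip: taylor_coeff_0_0 simp del: of_real_add)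
qed

text \<open>
  Two decompositions of the same function differ by an element of the ideal generated by \<open>p(z)\<close> and
  \<open>q(w)\<close>, whose cofactors determine how the other parts differ.
\<close>

lemma decomposition_difference:
  assumes "admissible p q S \<phi> s g h" "admissible p q S \<phi> s' g' h'"
  obtains u v where "s' = s + (poly_z p * u + poly_w q * v)"
    "\<And>z. z \<in> S - K \<Longrightarrow> pq z * (g z - g' z) = of_real (poly p (Re z)) * ev u z + of_real (poly q (Im z)) * ev v z"
    "\<And>z. z \<in> S \<inter> K \<Longrightarrow> fst (h z) - fst (h' z) = ev u z"
    "\<And>z. z \<in> S \<inter> K \<Longrightarrow> snd (h z) - snd (h' z) = ev v z"
proof -
  note a = assms(1)[unfolded admissible_iff] and b = assms(2)[unfolded admissible_iff]
  have tcd: "taylor_coeff (s' - s) \<xi> \<eta> k l = taylor_coeff s' \<xi> \<eta> k l - taylor_coeff s \<xi> \<eta> k l" for \<xi> \<eta> k l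
    using taylor_coeff_add[of "s' - s" s] by simp
  have "taylor_coeff (s' - s) \<xi> \<eta> k l = 0" if kl: "k < zero_mult p \<xi>" "l < zero_mult q \<eta>" for \<xi> \<eta> k l
    using crit_cases[OF kl] a b kl unfolding tcd by auto
  then obtain u v where uv: "s' - s = [:cpoly p:] * u + in_w (cpoly q) * v"
    using in_ideal_if_jets_vanish[of "cpoly p" "cpoly q" "s' - s"] p0 q0 unfolding order_eq cpoly_eq_0_iff by blast
  then have e: "s' - s = poly_z p * u + poly_w q * v" unfolding poly_z_eq poly_w_eq .
  have off: "pq z * (g z - g' z) = of_real (poly p (Re z)) * ev u z + of_real (poly q (Im z)) * ev v z" if "z \<in> S - K" for z
  proof -
    have "ev s z + pq z * g z = ev s' z + pq z * g' z" using a b that by metis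
    then have "pq z * (g z - g' z) = ev (s' - s) z" by (simp add: algebra_simps del: of_real_add)
    also have "\<dots> = of_real (poly p (Re z)) * ev u z + of_real (poly q (Im z)) * ev v z"
      unfolding e by (simp add: ev_poly_z ev_poly_w)
    finally show ?thesis .
  qed
  have crit: "fst (h z) - fst (h' z) = ev u z" "snd (h z) - snd (h' z) = ev v z" if z: "z \<in> S \<inter> K" for z
  proof -
    have mn: "0 < m z" "0 < n z" using critD z by auto
    have z0: "jet (cpoly p) (of_real (Re z)) k = 0" if "k < m z" for k using jet_below(1)[OF that] .
    have z0': "jet (cpoly q) (of_real (Im z)) l = 0" if "l < n z" for l using jet_below(2)[OF that] .
    have "tc (poly_z p * u) z (m z) 0 = (\<Sum>c\<le>m z. jet (cpoly p) (of_real (Re z)) c * tc u z (m z - c) 0)"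
      unfolding taylor_coeff_mult tc_poly_z by simp
    also have "\<dots> = (\<Sum>c\<le>m z. if c = m z then \<alpha> z * ev u z else 0)"
      using z0 by (intro sum.cong) (auto simp: taylor_coeff_0_0)
    finally have t1: "tc (poly_z p * u) z (m z) 0 = \<alpha> z * ev u z" by simp
    have t2: "tc (poly_w q * v) z (m z) 0 = 0"
      unfolding taylor_coeff_mult tc_poly_w using z0'[OF mn(2)] by (intro sum.neutral ballI) auto
    have "tc (poly_w q * v) z 0 (n z) = (\<Sum>d\<le>n z. jet (cpoly q) (of_real (Im z)) d * tc v z 0 (n z - d))"
      unfolding taylor_coeff_mult tc_poly_w by simp
    also have "\<dots> = (\<Sum>d\<le>n z. if d = n z then \<beta> z * ev v z else 0)"
      using z0' by (intro sum.cong) (auto simp: taylor_coeff_0_0)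
    finally have t3: "tc (poly_w q * v) z 0 (n z) = \<beta> z * ev v z" by simp
    have t4: "tc (poly_z p * u) z 0 (n z) = 0"
      unfolding taylor_coeff_mult tc_poly_z using z0[OF mn(1)] by (intro sum.neutral ballI) auto
    have d: "tc s z (m z) 0 + \<alpha> z * fst (h z) = tc s' z (m z) 0 + \<alpha> z * fst (h' z)"
      "tc s z 0 (n z) + \<beta> z * snd (h z) = tc s' z 0 (n z) + \<beta> z * snd (h' z)"
      using a b z by metis+
    have "\<alpha> z * (fst (h z) - fst (h' z)) = tc (s' - s) z (m z) 0"
      "\<beta> z * (snd (h z) - snd (h' z)) = tc (s' - s) z 0 (n z)"
      using d unfolding tcd by (simp_all add: algebra_simps)
    then have "\<alpha> z * (fst (h z) - fst (h' z)) = \<alpha> z * ev u z" "\<beta> z * (snd (h z) - snd (h' z)) = \<beta> z * ev v z"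
      unfolding e taylor_coeff_add t1 t2 t3 t4 by simp_all
    then show "fst (h z) - fst (h' z) = ev u z" "snd (h z) - snd (h' z) = ev v z"
      using alpha_nonzero beta_nonzero mult_cancel_left by blast+
  qed
  have "s' = s + (poly_z p * u + poly_w q * v)" using e by (simp add: algebra_simps)
  then show ?thesis using that off crit by blast
qed

end

section \<open>The operators attached to a definitizable normal operator\<close>

text \<open>
  The data of the theorem with \<open>T\<^sub>1 = T R\<^sub>1\<close> and \<open>T\<^sub>2 = T
  R\<^sub>2\<close> eliminated. The operator \<open>Z\<close> is \<open>\<Theta>(N)\<close>, and
  \<open>Q1\<close>, \<open>Q2\<close> are \<open>R\<^sub>1 R\<^sub>1\<^sup>*\<close> and
  \<open>R\<^sub>2 R\<^sub>2\<^sup>*\<close>.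
\<close>

locale definitizable_normal = spectral_resolution E
  for E :: "complex set \<Rightarrow> 'v::chilbert_space \<Rightarrow> 'v" +
  fixes N :: "'k::krein_space \<Rightarrow> 'k" and p q :: "real poly" and T :: "'v \<Rightarrow> 'k"
    and R1 :: "'v1::chilbert_space \<Rightarrow> 'v" and R2 :: "'v2::chilbert_space \<Rightarrow> 'v"
  assumes N: "bounded_clinear N" and normal: "N (adj N x) = adj N (N x)"
    and nonzero: "p \<noteq> 0" "q \<noteq> 0"
    and T: "bounded_clinear T" and inj_T: "inj T"
    and R1: "bounded_clinear R1" and R1_le: "norm (R1 v1) \<le> norm v1"
    and R2: "bounded_clinear R2" and R2_le: "norm (R2 v2) \<le> norm v2"
    and TT: "T (adj T x) = op_poly p (re_part N) x + op_poly q (im_part N) x"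
    and TR1: "T (R1 (adj R1 (adj T x))) = op_poly p (re_part N) x"
    and TR2: "T (R2 (adj R2 (adj T x))) = op_poly q (im_part N) x"
    and spectral: "spectral_measure_of (Theta T N) E"
begin

abbreviation "A \<equiv> re_part N"
abbreviation "B \<equiv> im_part N"
definition "Z = Theta T N"
definition "S = spectrum Z"
definition "Q1 v = R1 (adj R1 v)"
definition "Q2 v = R2 (adj R2 v)"

lemmas N' = bounded_clinear_adj[OF N]
lemmas T' = bounded_clinear_adj[OF T]

lemma bounded_clinear_parts:
  fixes X :: "'a::krein_space \<Rightarrow> 'a"
  assumes X: "bounded_clinear X"
  shows "bounded_clinear (re_part X)" "bounded_clinear (im_part X)"
proof -
  have e: "re_part X = (\<lambda>x. (1 / 2) *\<^sub>C (X x + adj X x))" "im_part X = (\<lambda>x. (1 / (2 * \<i>)) *\<^sub>C (X x - adj X x))"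
    by (rule ext, simp only: re_part_def im_part_def)+
  show "bounded_clinear (re_part X)" "bounded_clinear (im_part X)"
    unfolding e
    by (rule bounded_clinear_scale bounded_clinear_plus bounded_clinear_sub X bounded_clinear_adj[OF X])+
qed

lemmas A = bounded_clinear_parts(1)[OF N]
lemmas B = bounded_clinear_parts(2)[OF N]

lemma adj_A: "adj A = A" and adj_B: "adj B = B"
proof -
  show "adj A = A"
    by (rule adj_eqI)
      (simp add: re_part_def cinner_simps cinner_adj_right[OF N] cinner_adj_left[OF N])
  show "adj B = B"
    by (rule adj_eqI)
      (simp add: im_part_def cinner_simps cinner_adj_right[OF N] cinner_adj_left[OF N] algebra_simps)
qed

lemma commutes_parts:
  assumes C: "bounded_clinear C" "\<And>x. C (N x) = N (C x)" "\<And>x. C (adj N x) = adj N (C x)"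
  shows "C (A x) = A (C x)" "C (B x) = B (C x)"
  by (simp_all add: re_part_def im_part_def bounded_clinear_simps[OF C(1)] C)

lemma AB: "A (B x) = B (A x)"
proof -
  have "N (A x) = A (N x)" "adj N (A x) = A (adj N x)" for x
    by (rule commutes_parts[OF N]; simp add: normal) (rule commutes_parts[OF N']; simp add: normal)
  then show ?thesis
    by (simp add: im_part_def bounded_clinear_simps[OF A])
qed

lemma commutes_poly:
  assumes C: "bounded_clinear C" "\<And>x. C (N x) = N (C x)" "\<And>x. C (adj N x) = adj N (C x)"
  shows "C (op_poly2 s A B x) = op_poly2 s A B (C x)"
  by (rule op_poly2_intertwine[OF A B C(1) A B]) (rule commutes_parts[OF C])+

lemma commutes_TT:
  assumes C: "bounded_clinear C" "\<And>x. C (N x) = N (C x)" "\<And>x. C (adj N x) = adj N (C x)"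
  shows "C (T (adj T x)) = T (adj T (C x))"
  unfolding TT op_poly2_poly_z[of p A B, symmetric] op_poly2_poly_w[of q A B, symmetric]
  by (simp add: bounded_clinear_simps[OF C(1)] commutes_poly[OF C])

lemma intertwines_Z: "intertwines T Z N"
  unfolding Z_def by (rule intertwines_Theta[OF T inj_T N]) (rule commutes_TT[OF N]; simp add: normal)

lemma intertwines_adj_Z: "intertwines T (adj Z) (adj N)"
  by (rule intertwines_adj[OF T inj_T intertwines_Z N]) (rule commutes_TT[OF N]; simp add: normal)

lemma Z: "bounded_clinear Z" and TZ: "T (Z v) = N (T v)" and TZ': "T (adj Z v) = adj N (T v)"
  using intertwines_Z intertwines_adj_Z unfolding intertwines_def by auto

lemmas AZ = bounded_clinear_parts(1)[OF Z]
lemmas BZ = bounded_clinear_parts(2)[OF Z]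

lemma T_parts: "T (re_part Z v) = A (T v)" "T (im_part Z v) = B (T v)"
  by (simp_all add: re_part_def im_part_def bounded_clinear_simps[OF T] TZ TZ')

lemma T_poly: "T (op_poly2 s (re_part Z) (im_part Z) v) = op_poly2 s A B (T v)"
  by (rule op_poly2_intertwine[OF A B T AZ BZ]) (rule T_parts)+

text \<open>
  \<open>T\<^sup>*\<close> intertwines in the opposite direction, because \<open>T
  T\<^sup>*\<close> is itself a polynomial in \<open>A\<close> and \<open>B\<close>.
\<close>

lemma adj_T_poly: "adj T (op_poly2 s A B x) = op_poly2 s (re_part Z) (im_part Z) (adj T x)"
proof (rule injD[OF inj_T])
  have "op_poly2 s A B (T (adj T x)) = T (adj T (op_poly2 s A B x))"
  proof -
    have "op_poly2 s A B (T (adj T x)) = op_poly2 s A B (op_poly2 (poly_z p + poly_w q) A B x)"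
      by (simp add: TT op_poly2_add op_poly2_poly_z op_poly2_poly_w)
    also have "\<dots> = op_poly2 (poly_z p + poly_w q) A B (op_poly2 s A B x)"
      using op_poly2_mult[OF A B AB, of s "poly_z p + poly_w q" x]
        op_poly2_mult[OF A B AB, of "poly_z p + poly_w q" s x] by (simp only: mult.commute)
    also have "\<dots> = T (adj T (op_poly2 s A B x))"
      by (simp add: TT op_poly2_add op_poly2_poly_z op_poly2_poly_w)
    finally show ?thesis .
  qed
  then show "T (adj T (op_poly2 s A B x)) = T (op_poly2 s (re_part Z) (im_part Z) (adj T x))"
    by (simp add: T_poly)
qed

subsection \<open>The spectral measure of \<open>\<Theta>(N)\<close>\<close>

lemma compact_S: "compact S"
  unfolding S_def compact_eq_bounded_closed using bounded_spectrum[OF Z] closed_spectrum[OF Z] by blast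

lemma S_measurable: "S \<in> sets borel"
  using compact_S by (simp add: borel_compact)

lemma E_S: "E S u = u"
  using spectral unfolding spectral_measure_of_def S_def Z_def by simp

text \<open>
  Integrals over \<open>S\<close> have integrands on the whole plane that vanish off \<open>S\<close>: polynomials are bounded
  on \<open>S\<close>, but not on the plane.
\<close>

definition onS :: "(complex \<Rightarrow> complex) \<Rightarrow> complex \<Rightarrow> complex" where
  "onS f z = indicator S z * f z"

lemma bounded_borel_onS:
  assumes "continuous_on UNIV f" shows "bounded_borel (onS f)"
proof -
  have "compact (f ` S)" by (rule compact_continuous_image[OF continuous_on_subset[OF assms] compact_S]) simp
  from compact_imp_bounded[OF this] obtain M where M: "\<And>z. z \<in> S \<Longrightarrow> cmod (f z) \<le> M"
    unfolding bounded_iff by auto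
  have "f \<in> borel_measurable borel" by (rule borel_measurable_continuous_onI[OF assms])
  then have "onS f \<in> borel_measurable borel" unfolding onS_def[abs_def] using S_measurable by measurable
  moreover have "cmod (onS f z) \<le> max M 0" for z using M[of z] by (auto simp: onS_def indicator_def)
  ultimately show ?thesis by (rule bounded_borelI)
qed

lemmas bounded_borel_ev = bounded_borel_onS[OF continuous_on_ev]

lemma Z_eq: "Z u = I (onS (\<lambda>z. z)) u" and adj_Z_eq: "adj Z u = I (onS cnj) u"
proof -
  have "has_spectral_integral E S (\<lambda>z. z) Z"
    using spectral unfolding spectral_measure_of_def S_def Z_def by simp
  moreover have "(\<lambda>z. indicator S z *\<^sub>R z) = onS (\<lambda>z. z)" by (auto simp: onS_def indicator_def)
  ultimately have "SI (onS (\<lambda>z. z)) Z"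
    unfolding has_spectral_integral_def set_lebesgue_integral_def by simp
  then have e: "I (onS (\<lambda>z. z)) = Z" by (rule I_eqI) (intro bounded_borel_onS continuous_intros)
  then show "Z u = I (onS (\<lambda>z. z)) u" by simp
  have "(\<lambda>z. cnj (onS (\<lambda>z. z) z)) = onS cnj" by (auto simp: onS_def indicator_def)
  then show "adj Z u = I (onS cnj) u"
    using I_adj[OF bounded_borel_onS[of "\<lambda>z. z"]] e by (simp add: continuous_intros)
qed

lemma re_Z_eq: "re_part Z u = I (onS (\<lambda>z. complex_of_real (Re z))) u"
  and im_Z_eq: "im_part Z u = I (onS (\<lambda>z. complex_of_real (Im z))) u"
proof -
  have b: "bounded_borel (onS (\<lambda>z. z))" "bounded_borel (onS cnj)"
    by (intro bounded_borel_onS continuous_intros)+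
  have "onS (\<lambda>z. complex_of_real (Re z)) = (\<lambda>z. (1 / 2) * (onS (\<lambda>z. z) z + onS cnj z))"
    by (auto simp: onS_def indicator_def complex_add_cnj)
  then show "re_part Z u = I (onS (\<lambda>z. complex_of_real (Re z))) u"
    by (simp only: I_scale I_add bounded_borel_add b re_part_def Z_eq adj_Z_eq)
  have "onS (\<lambda>z. complex_of_real (Im z)) = (\<lambda>z. (1 / (2 * \<i>)) * (onS (\<lambda>z. z) z - onS cnj z))"
    by (rule ext) (simp add: onS_def indicator_def complex_eq_iff)
  then show "im_part Z u = I (onS (\<lambda>z. complex_of_real (Im z))) u"
    by (simp only: I_scale I_diff bounded_borel_diff b im_part_def Z_eq adj_Z_eq)
qed

lemma poly_Z_eq: "op_poly2 s (re_part Z) (im_part Z) u = I (onS (ev s)) u"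
proof (induction s arbitrary: u rule: bipoly_induct)
  case (const c)
  have "onS (ev [:[:c:]:]) = (\<lambda>z. c * indicator S z)" by (auto simp: onS_def)
  then show ?case
    by (simp only: I_scale bounded_borel_indicator[OF S_measurable] I_indicator[OF S_measurable] E_S op_poly2_const)
next
  case (add s t)
  have "onS (ev (s + t)) = (\<lambda>z. onS (ev s) z + onS (ev t) z)" by (auto simp: onS_def algebra_simps)
  then show ?case by (simp only: I_add bounded_borel_ev op_poly2_add add)
next
  case (timesZ s)
  have "bounded_borel (onS (\<lambda>z. complex_of_real (Re z)))" by (intro bounded_borel_onS continuous_intros)
  moreover have "onS (ev (smult [:0, 1:] s)) = (\<lambda>z. onS (\<lambda>z. complex_of_real (Re z)) z * onS (ev s) z)"
    by (auto simp: onS_def indicator_def)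
  moreover have "op_poly2 (smult [:0, 1:] s) (re_part Z) (im_part Z) u
      = I (onS (\<lambda>z. complex_of_real (Re z))) (I (onS (ev s)) u)"
    by (simp only: op_poly2_timesZ[OF AZ] timesZ) (rule re_Z_eq)
  ultimately show ?case by (simp only: I_mult bounded_borel_ev)
next
  case (timesW s)
  have "bounded_borel (onS (\<lambda>z. complex_of_real (Im z)))" by (intro bounded_borel_onS continuous_intros)
  moreover have "onS (ev (pCons 0 s)) = (\<lambda>z. onS (ev s) z * onS (\<lambda>z. complex_of_real (Im z)) z)"
    by (auto simp: onS_def indicator_def)
  moreover have "op_poly2 (pCons 0 s) (re_part Z) (im_part Z) u
      = I (onS (ev s)) (I (onS (\<lambda>z. complex_of_real (Im z))) u)"
    by (simp only: op_poly2_timesW timesW) (simp only: im_Z_eq)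
  ultimately show ?case by (simp only: I_mult bounded_borel_ev)
qed

text \<open>
  Through \<open>T\<close> the identities \<open>T T\<^sup>* = p(A) + q(B)\<close> and \<open>T\<^sub>1 T\<^sub>1\<^sup>* = p(A)\<close> become identities for
  \<open>T\<^sup>* T\<close> and \<open>R\<^sub>1 R\<^sub>1\<^sup>* T\<^sup>* T\<close> in the calculus of \<open>\<Theta>(N)\<close>.
\<close>

lemma adj_T_T: "adj T (T v) = I (onS (ev (poly_z p + poly_w q))) v"
proof (rule injD[OF inj_T])
  show "T (adj T (T v)) = T (I (onS (ev (poly_z p + poly_w q))) v)"
    unfolding poly_Z_eq[symmetric] T_poly TT by (simp add: op_poly2_add op_poly2_poly_z op_poly2_poly_w)
qed

lemma Q1_adj_T_T: "Q1 (adj T (T v)) = I (onS (ev (poly_z p))) v"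
  and Q2_adj_T_T: "Q2 (adj T (T v)) = I (onS (ev (poly_w q))) v"
proof -
  show "Q1 (adj T (T v)) = I (onS (ev (poly_z p))) v"
    by (rule injD[OF inj_T]) (simp only: Q1_def TR1 poly_Z_eq[symmetric] T_poly, simp only: op_poly2_poly_z)
  show "Q2 (adj T (T v)) = I (onS (ev (poly_w q))) v"
    by (rule injD[OF inj_T]) (simp only: Q2_def TR2 poly_Z_eq[symmetric] T_poly, simp only: op_poly2_poly_w)
qed

lemma Q1: "bounded_clinear Q1" and Q2: "bounded_clinear Q2"
  unfolding Q1_def[abs_def] Q2_def[abs_def]
  by (rule bounded_clinear_compose[OF R1 bounded_clinear_adj[OF R1]]
      bounded_clinear_compose[OF R2 bounded_clinear_adj[OF R2]])+

lemma Q1_adj: "adj Q1 = Q1" and Q2_adj: "adj Q2 = Q2"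
proof -
  show "adj Q1 = Q1"
    by (rule adj_eqI) (simp add: Q1_def cinner_adj_right[OF R1] flip: cinner_adj_left[OF R1])
  show "adj Q2 = Q2"
    by (rule adj_eqI) (simp add: Q2_def cinner_adj_right[OF R2] flip: cinner_adj_left[OF R2])
qed

lemma Q1_le: "norm (Q1 v) \<le> norm v" and Q2_le: "norm (Q2 v) \<le> norm v"
proof -
  have "norm (adj R1 v) \<le> 1 * norm v" by (rule adj_norm_bound[OF R1]) (simp_all add: R1_le)
  then show "norm (Q1 v) \<le> norm v" unfolding Q1_def using R1_le[of "adj R1 v"] by simp
  have "norm (adj R2 v) \<le> 1 * norm v" by (rule adj_norm_bound[OF R2]) (simp_all add: R2_le)
  then show "norm (Q2 v) \<le> norm v" unfolding Q2_def using R2_le[of "adj R2 v"] by simp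
qed

text \<open>
  Between \<open>T\<close> and \<open>T\<^sup>*\<close> the operators \<open>Q1\<close> and
  \<open>Q2\<close> become \<open>p(A)\<close> and \<open>q(B)\<close>, with which
  \<open>C\<close> commutes.
\<close>

lemma intertwiner_commutes_Q:
  assumes C: "bounded_clinear C" "\<And>x. C (N x) = N (C x)" "\<And>x. C (adj N x) = adj N (C x)"
    and D: "intertwines T D C"
  shows "D (Q1 v) = Q1 (D v)" "D (Q2 v) = Q2 (D v)"
proof -
  have Db: "bounded_clinear D" and TD: "\<And>v. T (D v) = C (T v)" using D unfolding intertwines_def by auto
  have DT: "D (adj T x) = adj T (C x)" for x
    by (rule intertwines_adj_T[OF T inj_T D commutes_TT[OF C]])
  have "(\<lambda>v. D (Q1 v)) = (\<lambda>v. Q1 (D v))"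
  proof (rule eq_on_range_adj[OF T inj_T, where D = "\<lambda>v. D (Q1 v)" and D' = "\<lambda>v. Q1 (D v)"])
    fix x
    show "T (D (Q1 (adj T x))) = T (Q1 (D (adj T x)))"
      unfolding TD DT using commutes_poly[OF C, of "poly_z p"] by (simp add: Q1_def TR1 op_poly2_poly_z)
  qed (rule bounded_clinear_compose[OF Db Q1] bounded_clinear_compose[OF Q1 Db])+
  then show "D (Q1 v) = Q1 (D v)" by (rule fun_cong)
  have "(\<lambda>v. D (Q2 v)) = (\<lambda>v. Q2 (D v))"
  proof (rule eq_on_range_adj[OF T inj_T, where D = "\<lambda>v. D (Q2 v)" and D' = "\<lambda>v. Q2 (D v)"])
    fix x
    show "T (D (Q2 (adj T x))) = T (Q2 (D (adj T x)))"
      unfolding TD DT using commutes_poly[OF C, of "poly_w q"] by (simp add: Q2_def TR2 op_poly2_poly_w)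
  qed (rule bounded_clinear_compose[OF Db Q2] bounded_clinear_compose[OF Q2 Db])+
  then show "D (Q2 v) = Q2 (D v)" by (rule fun_cong)
qed

lemma commutes_E:
  assumes C: "bounded_clinear C" and c: "\<And>u. C (Z u) = Z (C u)" "\<And>u. adj C (Z u) = Z (adj C u)"
    and D: "\<Delta> \<in> sets borel"
  shows "C (E \<Delta> u) = E \<Delta> (C u)"
proof -
  have e: "Z u = I (\<lambda>z. indicator S z * z) u" for u unfolding Z_eq onS_def[abs_def] ..
  show ?thesis
    by (rule commutes_with_spectral_measure[OF S_measurable compact_imp_bounded[OF compact_S] E_S C _ _ D];
        rule c[unfolded e])
qed

lemma Q_E:
  assumes D: "\<Delta> \<in> sets borel" shows "Q1 (E \<Delta> u) = E \<Delta> (Q1 u)" "Q2 (E \<Delta> u) = E \<Delta> (Q2 u)"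
proof -
  note c = intertwiner_commutes_Q[OF N refl _ intertwines_Z]
  show "Q1 (E \<Delta> u) = E \<Delta> (Q1 u)" using c by (intro commutes_E D Q1) (simp_all add: Q1_adj normal)
  show "Q2 (E \<Delta> u) = E \<Delta> (Q2 u)" using c by (intro commutes_E D Q2) (simp_all add: Q2_adj normal)
qed

lemma Q_I: "bounded_borel f \<Longrightarrow> Q1 (I f u) = I f (Q1 u)" "bounded_borel f \<Longrightarrow> Q2 (I f u) = I f (Q2 u)"
  using commute_E_I[OF Q1 Q_E(1)] commute_E_I[OF Q2 Q_E(2)] by blast+

subsection \<open>The inequality between \<open>p\<close>, \<open>q\<close> and \<open>p + q\<close> on the spectrum\<close>

text \<open>
  If \<open>E\<close> vanished near \<open>w\<close>, then \<open>1 / (z - w)\<close> would agree almost everywhere with a bounded function,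
  whose integral would be an inverse of \<open>Z - w\<close>.
\<close>

lemma spectrum_in_support:
  assumes w: "w \<in> S" and e: "0 < e" shows "\<exists>u. E (ball w e) u \<noteq> 0"
proof (rule ccontr)
  assume "\<nexists>u. E (ball w e) u \<noteq> 0"
  then have zero: "E (ball w e) u = 0" for u by blast
  define f where "f z = indicator (- ball w e) z * inverse (z - w)" for z
  have f: "bounded_borel f"
  proof (rule bounded_borelI[of _ "1 / e"])
    show "f \<in> borel_measurable borel" unfolding f_def by measurable
    fix z
    show "cmod (f z) \<le> 1 / e"
      using e by (auto simp: f_def indicator_def norm_divide inverse_eq_divide dist_norm norm_minus_commute intro!: frac_le)
  qed
  have b: "bounded_borel (onS (\<lambda>z. z))" by (intro bounded_borel_onS continuous_intros)
  define k where "k z = onS (\<lambda>z. z) z - w" for z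
  have k: "bounded_borel k" unfolding k_def by (intro bounded_borel_diff b bounded_borel_const)
  have Ik: "I k u = Z u - w *\<^sub>C u" for u
    unfolding k_def by (simp add: I_diff b bounded_borel_const I_const Z_eq)
  have inv: "inverse (z - w) * (z - w) = 1" if "\<not> dist w z < e" for z
    using that e by (cases "z = w") auto
  have "I (\<lambda>z. f z * k z) u = u" for u
  proof -
    have "I (\<lambda>z. f z * k z) (E (S - ball w e) u) = I (\<lambda>z. 1) (E (S - ball w e) u)"
      using e S_measurable by (intro I_cong_on bounded_borel_mult f k bounded_borel_const)
        (auto simp: f_def k_def onS_def inv)
    moreover have "E (S - ball w e) u = u"
    proof -
      have "E (- ball w e) (E S u) = u" by (simp add: E_Compl zero E_S)
      moreover have "- ball w e \<inter> S = S - ball w e" by auto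
      ultimately show ?thesis using E_Int[of "- ball w e" S u] S_measurable by simp
    qed
    ultimately show ?thesis by (simp add: I_one)
  qed
  then have "I f (Z u - w *\<^sub>C u) = u" "Z (I f u) - w *\<^sub>C I f u = u" for u
    using I_mult[OF f k, of u] I_mult[OF k f, of u] by (simp_all add: Ik mult.commute)
  then have "w \<notin> S"
    unfolding S_def spectrum_def using I_clinear[OF f] by (auto simp: fun_eq_iff intro!: exI[of _ "I f"])
  then show False using w by simp
qed

text \<open>
  Near a point where \<open>\<bar>t\<bar> > \<bar>r\<bar>\<close> the operator \<open>t(\<Theta>(N))\<close> would stretch the vectors of a nonzero
  spectral subspace by more than \<open>r(\<Theta>(N))\<close> does, contradicting \<open>t(\<Theta>(N)) = Q r(\<Theta>(N))\<close>.  This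
  is applied to \<open>r = p + q\<close>, \<open>t = p\<close>, \<open>Q = R\<^sub>1 R\<^sub>1\<^sup>*\<close> and likewise to \<open>q\<close>.
\<close>

lemma contraction_dominates:
  assumes Q: "\<And>v. I (onS (ev t)) v = Q (I (onS (ev r)) v)" and le: "\<And>v. norm (Q v) \<le> norm v" and w: "w \<in> S"
  shows "cmod (ev t w) \<le> cmod (ev r w)"
proof (rule ccontr)
  assume "\<not> cmod (ev t w) \<le> cmod (ev r w)"
  then have lt: "cmod (ev r w) < cmod (ev t w)" by simp
  obtain b where b: "cmod (ev r w) < b" "b < cmod (ev t w)" using dense[OF lt] by blast
  obtain a where a: "b < a" "a < cmod (ev t w)" using dense[OF b(2)] by blast
  have "0 < a" using norm_ge_zero[of "ev r w"] b(1) a(1) by linarith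
  note ab = b(1) a this
  have c: "((\<lambda>z. cmod (ev s z)) \<longlongrightarrow> cmod (ev s w)) (at w)" for s
    using continuous_on_ev[of UNIV s] by (intro tendsto_norm) (simp add: continuous_on_def)
  have "\<forall>\<^sub>F z in at w. cmod (ev r z) < b \<and> a < cmod (ev t z)"
    using order_tendstoD(2)[OF c[of r] ab(1)] order_tendstoD(1)[OF c[of t] ab(3)] by (rule eventually_conj)
  then obtain e where e: "0 < e" "\<And>z. z \<noteq> w \<Longrightarrow> dist z w < e \<Longrightarrow> cmod (ev r z) < b \<and> a < cmod (ev t z)"
    unfolding eventually_at by blast
  have near: "cmod (ev r z) \<le> b" "a \<le> cmod (ev t z)" if "z \<in> ball w e" for z
    using e(2)[of z] that ab(1,3) by (cases "z = w"; fastforce simp: dist_commute)+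
  obtain u where u: "E (ball w e) u \<noteq> 0" using spectrum_in_support[OF w e(1)] by blast
  define \<Delta> where "\<Delta> = ball w e \<inter> S"
  have D: "\<Delta> \<in> sets borel" unfolding \<Delta>_def using S_measurable by auto
  have Eu: "E \<Delta> u = E (ball w e) u"
    using E_Int[of "ball w e" S u] S_measurable unfolding \<Delta>_def by (simp add: E_S)
  have "a * norm (E \<Delta> u) \<le> norm (I (onS (ev t)) (E \<Delta> u))"
    using near(2) by (intro norm_I_ge bounded_borel_ev D ab(4)) (auto simp: \<Delta>_def onS_def)
  also have "\<dots> \<le> norm (I (onS (ev r)) (E \<Delta> u))" unfolding Q by (rule le)
  also have "I (onS (ev r)) (E \<Delta> u) = I (\<lambda>z. indicator \<Delta> z * onS (ev r) z) (E \<Delta> u)"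
    by (rule I_cong_on[OF bounded_borel_ev bounded_borel_mult[OF bounded_borel_indicator[OF D] bounded_borel_ev] D]) simp
  also have "norm \<dots> \<le> b * norm (E \<Delta> u)"
  proof (rule norm_I_le[OF bounded_borel_mult[OF bounded_borel_indicator[OF D] bounded_borel_ev]])
    show "cmod (indicator \<Delta> z * onS (ev r) z) \<le> b" for z
      using near(1)[of z] order_trans[OF norm_ge_zero less_imp_le[OF ab(1)]]
      by (auto simp: \<Delta>_def onS_def indicator_def)
  qed
  finally have "a * norm (E \<Delta> u) \<le> b * norm (E \<Delta> u)" .
  then show False using ab(2) u unfolding Eu by (simp add: mult_le_cancel_right)
qed

sublocale dominated_set p q S
proof
  show "p \<noteq> 0" "q \<noteq> 0" using nonzero by auto
  show "compact S" by (rule compact_S)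
  fix z assume z: "z \<in> S"
  have e: "ev (poly_z p + poly_w q) z = complex_of_real (poly p (Re z) + poly q (Im z))"
    using ev_poly_z[of p z] ev_poly_w[of q z] by simp
  have "cmod (ev (poly_z p) z) \<le> cmod (ev (poly_z p + poly_w q) z)"
    by (rule contraction_dominates[of _ Q1, OF _ Q1_le z]) (simp only: adj_T_T[symmetric] Q1_adj_T_T)
  then show "\<bar>poly p (Re z)\<bar> \<le> \<bar>poly p (Re z) + poly q (Im z)\<bar>"
    unfolding e ev_poly_z norm_of_real .
  have "cmod (ev (poly_w q) z) \<le> cmod (ev (poly_z p + poly_w q) z)"
    by (rule contraction_dominates[of _ Q2, OF _ Q2_le z]) (simp only: adj_T_T[symmetric] Q2_adj_T_T)
  then show "\<bar>poly q (Im z)\<bar> \<le> \<bar>poly p (Re z) + poly q (Im z)\<bar>"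
    unfolding e ev_poly_w norm_of_real .
qed

end

section \<open>The functional calculus\<close>

context definitizable_normal
begin

text \<open>
  \<open>RInt g h\<close> is the integral with respect to \<open>E\<close>, \<open>R1\<close>, \<open>R2\<close> of the function with scalar part \<open>g\<close> and
  part \<open>h\<close> at the critical points.  The scalar part enters through \<open>cut g\<close>, which is a bounded Borel
  function on the whole plane.
\<close>

definition symbol :: "(complex \<Rightarrow> complex) \<Rightarrow> bool" where
  "symbol g \<longleftrightarrow> bounded (g ` (S - K)) \<and> g \<in> borel_measurable (restrict_space borel (S - K))"

definition cut :: "(complex \<Rightarrow> complex) \<Rightarrow> complex \<Rightarrow> complex" where
  "cut g z = indicator (S - K) z * g z"

definition RInt :: "(complex \<Rightarrow> complex) \<Rightarrow> (complex \<Rightarrow> complex \<times> complex) \<Rightarrow> 'v \<Rightarrow> 'v" where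
  "RInt g h y = I (cut g) y + (\<Sum>w\<in>S \<inter> K. fst (h w) *\<^sub>C Q1 (E {w} y) + snd (h w) *\<^sub>C Q2 (E {w} y))"

lemma symbol_admissible: "admissible p q S \<phi> s g h \<Longrightarrow> symbol g"
  unfolding admissible_def symbol_def by blast

lemma symbol_ev: "symbol (ev s)"
proof -
  have "ev s \<in> borel_measurable (restrict_space borel (S - K))"
    by (rule measurable_restrict_space1) (rule borel_measurable_continuous_onI[OF continuous_on_ev])
  then show ?thesis using bounded_ev[of s] unfolding symbol_def bounded_iff by blast
qed

lemma bounded_borel_cut:
  assumes g: "symbol g" shows "bounded_borel (cut g)"
proof -
  obtain M where M: "\<And>z. z \<in> S - K \<Longrightarrow> cmod (g z) \<le> M" using g unfolding symbol_def bounded_iff by auto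
  have "(\<lambda>z. indicator (S - K) z *\<^sub>R g z) \<in> borel_measurable borel"
    using g S_borel(3) unfolding symbol_def by (simp add: borel_measurable_restrict_space_iff)
  moreover have "cut g = (\<lambda>z. indicator (S - K) z *\<^sub>R g z)" by (auto simp: cut_def indicator_def)
  ultimately show ?thesis
    by (intro bounded_borelI[of _ "max M 0"]) (use M in \<open>fastforce simp: indicator_def le_max_iff_disj\<close>)+
qed

lemma symbol_add: "symbol g \<Longrightarrow> symbol g' \<Longrightarrow> symbol (\<lambda>z. g z + g' z)"
  unfolding symbol_def by (auto intro: bounded_plus_comp)

lemma symbol_mult: "symbol g \<Longrightarrow> symbol g' \<Longrightarrow> symbol (\<lambda>z. g z * g' z)"
  unfolding symbol_def by (auto intro: bounded_mult_comp)

lemma symbol_bounded_borel: "bounded_borel f \<Longrightarrow> symbol f"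
  unfolding bounded_borel_def symbol_def
  by (auto intro: measurable_restrict_space1 bounded_subset)

lemma symbol_const: "symbol (\<lambda>z. c)"
  by (rule symbol_bounded_borel[OF bounded_borel_const])

lemma finite_SK: "finite (S \<inter> K)"
  using finite_K by simp

lemma point_borel: "{w::complex} \<in> sets borel"
  by simp

lemma I_at_point: "bounded_borel f \<Longrightarrow> I f (E {w} y) = f w *\<^sub>C E {w} y"
proof -
  assume f: "bounded_borel f"
  have "I f (E {w} y) = I (\<lambda>z. f w) (E {w} y)"
    by (rule I_cong_on[OF f bounded_borel_const point_borel]) simp
  then show ?thesis by (simp only: I_const)
qed

lemma R_integral_eq: "R_integral R1 R2 E p q S g h = RInt g h"
proof -
  have "has_spectral_integral E (S - K) g = has_spectral_integral E UNIV (cut g)"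
  proof -
    have "(\<lambda>z. indicator (S - K) z *\<^sub>R g z) = cut g" by (auto simp: cut_def indicator_def)
    then show ?thesis unfolding has_spectral_integral_def set_lebesgue_integral_def by auto
  qed
  then have "spectral_integral E (S - K) g = I (cut g)" unfolding spectral_integral_def by simp
  then show ?thesis unfolding R_integral_def[abs_def] RInt_def[abs_def] Q1_def Q2_def by simp
qed

lemma RInt_cong:
  assumes "\<And>z. z \<in> S - K \<Longrightarrow> g z = g' z" "\<And>w. w \<in> S \<inter> K \<Longrightarrow> h w = h' w"
  shows "RInt g h y = RInt g' h' y"
proof -
  have "cut g z = cut g' z" for z using assms(1)[of z] by (cases "z \<in> S - K") (auto simp: cut_def)
  then have "cut g = cut g'" by (rule ext)
  then show ?thesis unfolding RInt_def using assms(2) by simp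
qed

lemma RInt_add:
  assumes "symbol g" "symbol g'"
  shows "RInt (\<lambda>z. g z + g' z) (\<lambda>w. (fst (h w) + fst (h' w), snd (h w) + snd (h' w))) y = RInt g h y + RInt g' h' y"
proof -
  have "cut (\<lambda>z. g z + g' z) = (\<lambda>z. cut g z + cut g' z)" by (auto simp: cut_def algebra_simps)
  then show ?thesis
    unfolding RInt_def by (simp add: I_add bounded_borel_cut assms scaleC_add_left sum.distrib)
qed

lemma RInt_clinear: assumes "symbol g" shows "bounded_clinear (RInt g h)"
proof -
  have "bounded_clinear (\<lambda>y. c *\<^sub>C Q1 (E {w} y) + d *\<^sub>C Q2 (E {w} y))" for c d w
    by (rule bounded_clinear_plus bounded_clinear_scale bounded_clinear_compose[OF Q1 E_clinear[OF point_borel]]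
        bounded_clinear_compose[OF Q2 E_clinear[OF point_borel]])+
  then have "bounded_clinear (\<lambda>y. \<Sum>w\<in>S \<inter> K. fst (h w) *\<^sub>C Q1 (E {w} y) + snd (h w) *\<^sub>C Q2 (E {w} y))"
    by (intro bounded_clinear_setsum)
  from bounded_clinear_plus[OF I_clinear[OF bounded_borel_cut[OF assms]] this]
  show ?thesis by (simp add: RInt_def[abs_def])
qed

lemma RInt_commute:
  assumes D: "bounded_clinear D" "\<And>\<Delta> u. \<Delta> \<in> sets borel \<Longrightarrow> D (E \<Delta> u) = E \<Delta> (D u)"
    "\<And>v. D (Q1 v) = Q1 (D v)" "\<And>v. D (Q2 v) = Q2 (D v)" and g: "symbol g"
  shows "D (RInt g h y) = RInt g h (D y)"
  unfolding RInt_def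
  by (simp add: bounded_clinear_simps[OF D(1)] bounded_clinear_sum[OF D(1)] D(2-4)
      commute_E_I[OF D(1,2) bounded_borel_cut[OF g]])

text \<open>
  The integral is a module over the bounded Borel functions, because \<open>Q1\<close> and
  \<open>Q2\<close> commute with \<open>E\<close> and \<open>I f\<close> acts on the range of
  \<open>E {w}\<close> as the scalar \<open>f w\<close>.
\<close>

lemma I_RInt:
  assumes f: "bounded_borel f" and g: "symbol g"
  shows "I f (RInt g h y) = RInt (\<lambda>z. f z * g z) (\<lambda>w. (f w * fst (h w), f w * snd (h w))) y"
proof -
  have "(\<lambda>z. f z * cut g z) = cut (\<lambda>z. f z * g z)" by (auto simp: cut_def)
  then have 1: "I f (I (cut g) y) = I (cut (\<lambda>z. f z * g z)) y"
    using I_mult[OF f bounded_borel_cut[OF g], of y] by simp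
  have 2: "I f (c *\<^sub>C Q1 (E {w} y)) = (f w * c) *\<^sub>C Q1 (E {w} y)"
    "I f (c *\<^sub>C Q2 (E {w} y)) = (f w * c) *\<^sub>C Q2 (E {w} y)" for c w
    by (simp_all add: bounded_clinear_simps[OF I_clinear[OF f]] Q_I[OF f, symmetric] I_at_point[OF f]
        bounded_clinear_simps[OF Q1] bounded_clinear_simps[OF Q2] scaleC_scaleC mult.commute)
  show ?thesis
    unfolding RInt_def by (simp add: bounded_clinear_add[OF I_clinear[OF f]] bounded_clinear_sum[OF I_clinear[OF f]] 1 2)
qed

lemma RInt_I:
  assumes f: "bounded_borel f" and g: "symbol g"
  shows "RInt g h (I f y) = I f (RInt g h y)"
  by (rule RInt_commute[OF I_clinear[OF f] I_E_commute[OF f] _ _ g, symmetric]) (simp_all add: Q_I[OF f])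

lemma cinner_RInt:
  assumes g: "symbol g"
  shows "cinner (RInt g h x) y = cinner x (RInt (\<lambda>z. cnj (g z)) (\<lambda>w. (cnj (fst (h w)), cnj (snd (h w)))) y)"
proof -
  have c: "(\<lambda>z. cnj (cut g z)) = cut (\<lambda>z. cnj (g z))" by (auto simp: cut_def indicator_def)
  have 1: "cinner (I (cut g) x) y = cinner x (I (cut (\<lambda>z. cnj (g z))) y)"
    using cinner_adj_right[OF I_clinear[OF bounded_borel_cut[OF g]], of x y]
    by (simp add: I_adj bounded_borel_cut[OF g] c)
  have e: "cinner (E {w} a) b = cinner a (E {w} b)" for w a b
    using cinner_adj_right[OF E_clinear[OF point_borel[of w]], of a b] by (simp add: E_adj)
  have Q: "cinner (Q1 a) b = cinner a (Q1 b)" "cinner (Q2 a) b = cinner a (Q2 b)" for a b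
    using cinner_adj_right[OF Q1, of a b] cinner_adj_right[OF Q2, of a b] by (simp_all add: Q1_adj Q2_adj)
  have q: "cinner (Q1 (E {w} x)) y = cinner x (Q1 (E {w} y))" "cinner (Q2 (E {w} x)) y = cinner x (Q2 (E {w} y))" for w
    by (simp_all add: Q_E[OF point_borel] e Q)
  have csum: "cinner x (\<Sum>i\<in>X. f i) = (\<Sum>i\<in>X. cinner x (f i))" for f :: "complex \<Rightarrow> 'v" and X
    by (induction X rule: infinite_finite_induct) (auto simp: cinner_add_right)
  show ?thesis
    unfolding RInt_def by (simp add: cinner_simps cinner_sum_left csum 1 q)
qed

lemma I_onS_split:
  assumes f: "continuous_on UNIV f" "symbol f"
  shows "I (onS f) y = I (cut f) y + (\<Sum>w\<in>S \<inter> K. f w *\<^sub>C E {w} y)"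
proof -
  have "onS f = (\<lambda>z. cut f z + (\<Sum>w\<in>S \<inter> K. f w * indicator {w} z))"
  proof
    fix z
    have "(\<Sum>w\<in>S \<inter> K. f w * indicator {w} z) = (\<Sum>w\<in>S \<inter> K. if w = z then f z else 0)"
      by (intro sum.cong) (auto simp: indicator_def)
    also have "\<dots> = (if z \<in> S \<inter> K then f z else 0)" using finite_SK by simp
    finally show "onS f z = cut f z + (\<Sum>w\<in>S \<inter> K. f w * indicator {w} z)"
      by (auto simp: onS_def cut_def indicator_def)
  qed
  moreover have b: "bounded_borel (\<lambda>z. f w * indicator {w} z)" for w
    by (intro bounded_borel_scale bounded_borel_indicator) simp
  ultimately show ?thesis
    by (simp only: I_add bounded_borel_cut[OF f(2)] bounded_borel_sum I_sum I_scale
        bounded_borel_indicator[OF point_borel] I_indicator[OF point_borel])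
qed

text \<open>
  The identity behind the independence of the decomposition.  At the critical points it is the
  hypothesis on \<open>h\<close>.  Off them both sides agree after multiplication by \<open>T\<^sup>* T = (p + q)(\<Theta>(N))\<close>, because
  \<open>Q1 (T\<^sup>* T) = p(\<Theta>(N))\<close> and \<open>Q2 (T\<^sup>* T) = q(\<Theta>(N))\<close>, and this factor is injective on the range of
  \<open>E (S - K)\<close>.
\<close>

lemma RInt_difference:
  assumes g: "symbol g" and g': "symbol g'"
    and off: "\<And>z. z \<in> S - K \<Longrightarrow> pq z * (g z - g' z) = of_real (poly p (Re z)) * ev u z + of_real (poly q (Im z)) * ev v z"
    and crit: "\<And>w. w \<in> S \<inter> K \<Longrightarrow> fst (h w) - fst (h' w) = ev u w" "\<And>w. w \<in> S \<inter> K \<Longrightarrow> snd (h w) - snd (h' w) = ev v w"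
  shows "RInt g h y = RInt g' h' y + (Q1 (I (onS (ev u)) y) + Q2 (I (onS (ev v)) y))"
proof -
  define d where "d z = g z + (- 1) * g' z" for z
  have d: "symbol d" unfolding d_def by (intro symbol_add symbol_mult g g' symbol_const)
  define F where "F = onS (ev (poly_z p + poly_w q))"
  have F: "bounded_borel F" unfolding F_def by (rule bounded_borel_ev)
  note cu = bounded_borel_cut[OF symbol_ev[of u]] and cv = bounded_borel_cut[OF symbol_ev[of v]]
    and cd = bounded_borel_cut[OF d]
  \<comment> \<open>The defect off the critical points; it commutes with \<open>I F\<close>, where \<open>I F = T\<^sup>* T\<close>.\<close>
  define D where "D y = Q1 (I (cut (ev u)) y) + Q2 (I (cut (ev v)) y) - I (cut d) y" for y
  have comm: "I F (I f y) = I f (I F y)" if "bounded_borel f" for f y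
    unfolding I_mult[OF F that, symmetric] I_mult[OF that F, symmetric] by (simp only: mult.commute)
  have "I F (D y) = D (I F y)"
    unfolding D_def by (simp add: bounded_clinear_simps[OF I_clinear[OF F]] Q_I[OF F, symmetric] comm cu cv cd)
  also have "D (I F y) = I (\<lambda>z. (cut (ev u) z * onS (ev (poly_z p)) z + cut (ev v) z * onS (ev (poly_w q)) z) - cut d z * F z) y"
  proof -
    have "Q1 (I (cut (ev u)) (I F y)) = I (cut (ev u)) (I (onS (ev (poly_z p))) y)"
      unfolding Q_I[OF cu] F_def adj_T_T[symmetric] Q1_adj_T_T ..
    moreover have "Q2 (I (cut (ev v)) (I F y)) = I (cut (ev v)) (I (onS (ev (poly_w q))) y)"
      unfolding Q_I[OF cv] F_def adj_T_T[symmetric] Q2_adj_T_T ..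
    ultimately show ?thesis
      unfolding D_def by (simp only: I_diff I_add I_mult bounded_borel_add bounded_borel_mult cu cv cd F bounded_borel_ev)
  qed
  also have "(\<lambda>z. (cut (ev u) z * onS (ev (poly_z p)) z + cut (ev v) z * onS (ev (poly_w q)) z) - cut d z * F z) = (\<lambda>z. 0)"
  proof
    fix z
    show "(cut (ev u) z * onS (ev (poly_z p)) z + cut (ev v) z * onS (ev (poly_w q)) z) - cut d z * F z = 0"
    proof (cases "z \<in> S - K")
      case True
      have "cut d z * F z = pq z * (g z - g' z)"
        unfolding F_def onS_def cut_def pq_eq_ev[symmetric] d_def using True by simp
      then show ?thesis unfolding off[OF True] onS_def cut_def ev_poly_z ev_poly_w using True by simp
    qed (simp add: cut_def)
  qed
  finally have "I F (D y) = 0" by (simp add: I_zero)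
  from E_support_zero[OF F this] have "E {z. F z \<noteq> 0} (D y) = 0" .
  moreover have "{z. F z \<noteq> 0} = S - K"
  proof -
    have "pq z = 0" if "z \<in> K" for z using that unfolding crit_real_def by simp
    then show ?thesis
      using pq_nonzero unfolding F_def onS_def pq_eq_ev[symmetric] by (auto simp: indicator_def simp del: of_real_add)
  qed
  moreover have "E (S - K) (D y) = D y"
  proof -
    have "E (S - K) (I (cut f) x) = I (cut f) x" if "symbol f" for f x
    proof -
      have "(\<lambda>z. indicator (S - K) z * cut f z) = cut f" by (auto simp: cut_def indicator_def)
      then show ?thesis
        using I_mult[OF bounded_borel_indicator[OF S_borel(3)] bounded_borel_cut[OF that], of x]
        by (simp add: I_indicator[OF S_borel(3)])
    qed
    then show ?thesis unfolding D_def
      by (simp add: bounded_clinear_simps[OF E_clinear[OF S_borel(3)]] Q_E[OF S_borel(3), symmetric] symbol_ev d)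
  qed
  ultimately have "D y = 0" by simp
  then have D0: "Q1 (I (cut (ev u)) y) + Q2 (I (cut (ev v)) y) = I (cut d) y" unfolding D_def by simp
  define k where "k w = (ev u w, ev v w)" for w
  have "Q1 (I (onS (ev u)) y) + Q2 (I (onS (ev v)) y) = RInt d k y"
    unfolding I_onS_split[OF continuous_on_ev symbol_ev] RInt_def k_def
    by (simp add: bounded_clinear_simps[OF Q1] bounded_clinear_simps[OF Q2] bounded_clinear_sum[OF Q1]
        bounded_clinear_sum[OF Q2] sum.distrib flip: D0)
  moreover have "RInt g h y = RInt (\<lambda>z. g' z + d z) (\<lambda>w. (fst (h' w) + fst (k w), snd (h' w) + snd (k w))) y"
  proof (rule RInt_cong)
    fix w assume "w \<in> S \<inter> K"
    from crit(1)[OF this] crit(2)[OF this]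
    show "h w = (fst (h' w) + fst (k w), snd (h' w) + snd (k w))"
      unfolding k_def by (simp add: prod_eq_iff algebra_simps)
  qed (simp add: d_def)
  ultimately show ?thesis using RInt_add[OF g' d] by simp
qed

text \<open>The operator \<open>s(A, B) + \<Xi> (RInt g h)\<close> attached to a decomposition.\<close>

definition Op :: "complex poly poly \<Rightarrow> (complex \<Rightarrow> complex) \<Rightarrow> (complex \<Rightarrow> complex \<times> complex) \<Rightarrow> 'k \<Rightarrow> 'k" where
  "Op s g h x = op_poly2 s A B x + T (RInt g h (adj T x))"

text \<open>
  The polynomials of two decompositions differ by \<open>p(z) u + q(w) v\<close>, and
  \<open>p(A) u(A, B)\<close> equals \<open>\<Xi> (Q1 u(\<Theta>(A), \<Theta>(B)))\<close>: the
  change of the polynomial is compensated by the change of the integral.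
\<close>

lemma Op_unique:
  assumes a: "admissible p q S \<phi> s g h" and b: "admissible p q S \<phi> s' g' h'"
  shows "Op s' g' h' = Op s g h"
proof
  fix x
  obtain u v where uv: "s' = s + (poly_z p * u + poly_w q * v)"
    "\<And>z. z \<in> S - K \<Longrightarrow> pq z * (g z - g' z) = of_real (poly p (Re z)) * ev u z + of_real (poly q (Im z)) * ev v z"
    "\<And>z. z \<in> S \<inter> K \<Longrightarrow> fst (h z) - fst (h' z) = ev u z"
    "\<And>z. z \<in> S \<inter> K \<Longrightarrow> snd (h z) - snd (h' z) = ev v z"
    using decomposition_difference[OF a b] by blast
  have "op_poly2 (poly_z p * u) A B x = T (Q1 (adj T (op_poly2 u A B x)))"
    unfolding op_poly2_mult[OF A B AB] op_poly2_poly_z Q1_def TR1 ..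
  moreover have "op_poly2 (poly_w q * v) A B x = T (Q2 (adj T (op_poly2 v A B x)))"
    unfolding op_poly2_mult[OF A B AB] op_poly2_poly_w Q2_def TR2 ..
  ultimately have "op_poly2 s' A B x = op_poly2 s A B x
      + T (Q1 (I (onS (ev u)) (adj T x)) + Q2 (I (onS (ev v)) (adj T x)))"
    unfolding uv(1) op_poly2_add adj_T_poly poly_Z_eq by (simp add: bounded_clinear_add[OF T])
  then show "Op s' g' h' x = Op s g h x"
    using RInt_difference[OF symbol_admissible[OF a] symbol_admissible[OF b] uv(2-4), where y = "adj T x"]
    by (simp add: Op_def bounded_clinear_add[OF T])
qed

lemma fun_calc_eq:
  assumes a: "admissible p q S \<phi> s g h"
  shows "fun_calc N p q T R1 R2 E \<phi> = Op s g h"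
proof -
  have Op: "(\<lambda>x. op_poly2 s A B x + Xi T (R_integral R1 R2 E p q S g h) x) = Op s g h" for s g h
    by (rule ext) (simp add: Op_def Xi_def R_integral_eq)
  have "(THE X. \<exists>s g h. admissible p q S \<phi> s g h \<and>
        X = (\<lambda>x. op_poly2 s A B x + Xi T (R_integral R1 R2 E p q S g h) x)) = Op s g h"
    unfolding Op
  proof (rule the_equality)
    show "\<exists>s' g' h'. admissible p q S \<phi> s' g' h' \<and> Op s g h = Op s' g' h'" using a by blast
    fix X assume "\<exists>s' g' h'. admissible p q S \<phi> s' g' h' \<and> X = Op s' g' h'"
    then show "X = Op s g h" using Op_unique[OF a] by blast
  qed
  then show ?thesis unfolding fun_calc_def Let_def S_def[unfolded Z_def, symmetric] .
qed

lemma Op_clinear: "symbol g \<Longrightarrow> bounded_clinear (Op s g h)"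
  unfolding Op_def[abs_def]
  using bounded_clinear_plus[OF bounded_clinear_op_poly2[OF A B]
      bounded_clinear_compose[OF T bounded_clinear_compose[OF RInt_clinear T']]] by blast

lemma Op_add:
  assumes "symbol g" "symbol g'"
  shows "Op (s + t) (\<lambda>z. g z + g' z) (\<lambda>z. (fst (h z) + fst (h' z), snd (h z) + snd (h' z))) = (\<lambda>x. Op s g h x + Op t g' h' x)"
  by (rule ext) (simp add: Op_def op_poly2_add RInt_add[OF assms] bounded_clinear_add[OF T])

lemma Op_scale:
  assumes g: "symbol g"
  shows "Op (smult [:c:] s) (\<lambda>z. c * g z) (\<lambda>z. (c * fst (h z), c * snd (h z))) = (\<lambda>x. c *\<^sub>C Op s g h x)"
proof
  fix x
  have "RInt (\<lambda>z. c * g z) (\<lambda>z. (c * fst (h z), c * snd (h z))) y = c *\<^sub>C RInt g h y" for y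
    using I_RInt[OF bounded_borel_const g, of c h y] by (simp add: I_const)
  moreover have "op_poly2 (smult [:c:] s) A B x = c *\<^sub>C op_poly2 s A B x"
    using op_poly2_mult[OF A B AB, of "[:[:c:]:]" s x] by (simp add: op_poly2_const)
  ultimately show "Op (smult [:c:] s) (\<lambda>z. c * g z) (\<lambda>z. (c * fst (h z), c * snd (h z))) x = c *\<^sub>C Op s g h x"
    by (simp add: Op_def scaleC_add_right bounded_clinear_scaleC[OF T])
qed

text \<open>
  The two cross terms are moved under \<open>\<Xi>\<close> by the intertwining property of
  \<open>T\<close>. In the product of the two integrals the factor \<open>T\<^sup>* T = (p +
  q)(\<Theta>(N))\<close> appears between them; it annihilates the ranges of \<open>E
  {w}\<close> at critical points, so that only the scalar parts contribute.
\<close>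

lemma Op_mult:
  assumes g: "symbol g" and g': "symbol g'"
  shows "Op (s * t) (\<lambda>z. ev s z * g' z + ev t z * g z + pq z * (g z * g' z))
    (\<lambda>z. (ev s z * fst (h' z) + ev t z * fst (h z), ev s z * snd (h' z) + ev t z * snd (h z))) = Op s g h \<circ> Op t g' h'"
proof
  fix x
  define y where "y = adj T x"
  define r where "r = poly_z p + poly_w q"
  have r0: "ev r w = 0" if "w \<in> S \<inter> K" for w
    using that unfolding r_def pq_eq_ev[symmetric] crit_real_def by simp
  have st: "op_poly2 s A B (T (RInt g' h' y)) = T (I (onS (ev s)) (RInt g' h' y))"
    unfolding T_poly[symmetric] poly_Z_eq ..
  have ts: "T (RInt g h (adj T (op_poly2 t A B x))) = T (I (onS (ev t)) (RInt g h y))"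
    unfolding adj_T_poly poly_Z_eq y_def RInt_I[OF bounded_borel_ev g] ..
  have gg: "RInt g h (adj T (T (RInt g' h' y))) = RInt (\<lambda>z. pq z * (g z * g' z)) (\<lambda>w. (0, 0)) y"
  proof -
    define f where "f = cut (\<lambda>z. ev r z * g z)"
    have f: "bounded_borel f" unfolding f_def by (intro bounded_borel_cut symbol_mult symbol_ev g)
    have "RInt g h (adj T (T (RInt g' h' y))) = I (onS (ev r)) (RInt g h (RInt g' h' y))"
      unfolding adj_T_T RInt_I[OF bounded_borel_ev g] r_def ..
    also have "\<dots> = RInt (\<lambda>z. ev r z * g z) (\<lambda>w. (0, 0)) (RInt g' h' y)"
      unfolding I_RInt[OF bounded_borel_ev g] by (rule RInt_cong) (auto simp: onS_def r0)
    also have "\<dots> = I f (RInt g' h' y)" by (simp add: RInt_def f_def)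
    also have "\<dots> = RInt (\<lambda>z. pq z * (g z * g' z)) (\<lambda>w. (0, 0)) y"
      unfolding I_RInt[OF f g'] by (rule RInt_cong) (simp_all add: f_def cut_def pq_eq_ev r_def del: of_real_add poly_add)
    finally show ?thesis .
  qed
  have sum: "RInt (\<lambda>z. ev s z * g' z + ev t z * g z + pq z * (g z * g' z))
    (\<lambda>z. (ev s z * fst (h' z) + ev t z * fst (h z), ev s z * snd (h' z) + ev t z * snd (h z))) y
    = I (onS (ev s)) (RInt g' h' y) + I (onS (ev t)) (RInt g h y) + RInt (\<lambda>z. pq z * (g z * g' z)) (\<lambda>w. (0, 0)) y"
  proof -
    have e: "I (onS (ev s)) (RInt g h y) = RInt (\<lambda>z. ev s z * g z) (\<lambda>w. (ev s w * fst (h w), ev s w * snd (h w))) y"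
      if "symbol g" for s g h
      unfolding I_RInt[OF bounded_borel_ev that] by (rule RInt_cong) (auto simp: onS_def)
    have pqs: "symbol pq" unfolding pq_eq_ev by (rule symbol_ev)
    note st = symbol_mult[OF symbol_ev[of s] g'] symbol_mult[OF symbol_ev[of t] g]
    note a = RInt_add[OF st, where h = "\<lambda>w. (ev s w * fst (h' w), ev s w * snd (h' w))"
        and h' = "\<lambda>w. (ev t w * fst (h w), ev t w * snd (h w))" and y = y]
    note b = RInt_add[OF symbol_add[OF st] symbol_mult[OF pqs symbol_mult[OF g g']], where
        h = "\<lambda>w. (ev s w * fst (h' w) + ev t w * fst (h w), ev s w * snd (h' w) + ev t w * snd (h w))"
        and h' = "\<lambda>w. (0, 0)" and y = y]
    show ?thesis unfolding e[OF g] e[OF g'] using a b by simp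
  qed
  have "(Op s g h \<circ> Op t g' h') x = op_poly2 s A B (op_poly2 t A B x) + op_poly2 s A B (T (RInt g' h' y))
      + (T (RInt g h (adj T (op_poly2 t A B x))) + T (RInt g h (adj T (T (RInt g' h' y)))))"
    unfolding Op_def o_def y_def
    by (simp add: bounded_clinear_add[OF bounded_clinear_op_poly2[OF A B]] bounded_clinear_add[OF T']
        bounded_clinear_add[OF RInt_clinear[OF g]] bounded_clinear_add[OF T])
  also have "\<dots> = op_poly2 (s * t) A B x + T (I (onS (ev s)) (RInt g' h' y) + I (onS (ev t)) (RInt g h y)
      + RInt (\<lambda>z. pq z * (g z * g' z)) (\<lambda>w. (0, 0)) y)"
    unfolding st ts gg by (simp add: op_poly2_mult[OF A B AB] bounded_clinear_add[OF T] add_ac)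
  finally show "Op (s * t) (\<lambda>z. ev s z * g' z + ev t z * g z + pq z * (g z * g' z))
    (\<lambda>z. (ev s z * fst (h' z) + ev t z * fst (h z), ev s z * snd (h' z) + ev t z * snd (h z))) x = (Op s g h \<circ> Op t g' h') x"
    unfolding sum[symmetric] by (simp only: Op_def[of "s * t"] y_def)
qed

lemma Op_sharp:
  assumes g: "symbol g"
  shows "Op (conj_poly2 s) (\<lambda>z. cnj (g z)) (\<lambda>z. (cnj (fst (h z)), cnj (snd (h z)))) = adj (Op s g h)"
proof (rule adj_eqI[symmetric])
  fix x y
  have "cinner (op_poly2 s A B x) y = cinner x (op_poly2 (conj_poly2 s) A B y)"
    using cinner_adj_right[OF bounded_clinear_op_poly2[OF A B], of x s y] adj_op_poly2[OF A B AB adj_A adj_B, of s] by simp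
  moreover have "cinner (T (RInt g h (adj T x))) y
      = cinner x (T (RInt (\<lambda>z. cnj (g z)) (\<lambda>z. (cnj (fst (h z)), cnj (snd (h z)))) (adj T y)))"
    unfolding cinner_adj_right[OF T, symmetric] cinner_RInt[OF g] cinner_adj_left[OF T] ..
  ultimately show "cinner (Op s g h x) y = cinner x (Op (conj_poly2 s) (\<lambda>z. cnj (g z)) (\<lambda>z. (cnj (fst (h z)), cnj (snd (h z)))) y)"
    unfolding Op_def cinner_add_left cinner_add_right by simp
qed

lemma Op_poly: "Op s (\<lambda>z. 0) (\<lambda>z. (0, 0)) = op_poly2 s A B"
proof -
  have "cut (\<lambda>z. 0) = (\<lambda>z. 0)" by (auto simp: cut_def)
  then show ?thesis by (intro ext) (simp add: Op_def RInt_def I_zero bounded_clinear_zero[OF T])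
qed

text \<open>
  An operator \<open>C\<close> commuting with \<open>N\<close> and \<open>N\<^sup>*\<close> is
  carried by \<open>\<Theta>\<close> to an operator that commutes, together with its adjoint,
  with \<open>\<Theta>(N)\<close>; hence it commutes with \<open>E\<close> and with \<open>RInt
  g h\<close>.
\<close>

lemma Op_bicommutant:
  assumes g: "symbol g" shows "Op s g h \<in> commutant (commutant {N, adj N})"
proof -
  have "C (Op s g h x) = Op s g h (C x)" if "C \<in> commutant {N, adj N}" for C x
  proof -
    have C: "bounded_clinear C" "\<And>x. C (N x) = N (C x)" "\<And>x. C (adj N x) = adj N (C x)"
      using that unfolding commutant_def by (auto simp: fun_eq_iff)
    obtain D where D: "intertwines T D C"
      using intertwiner_exists[OF T inj_T C(1) commutes_TT[OF C]] by blast
    have Db: "bounded_clinear D" and TD: "\<And>v. T (D v) = C (T v)" using D unfolding intertwines_def by auto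
    have C': "adj C (N x) = N (adj C x)" for x
    proof (rule cinner_eqI)
      fix z
      show "cinner z (adj C (N x)) = cinner z (N (adj C x))"
        by (simp add: cinner_adj_right[OF C(1)] C(3) flip: cinner_adj_left[OF N])
    qed
    have D': "intertwines T (adj D) (adj C)" by (rule intertwines_adj[OF T inj_T D C(1) commutes_TT[OF C]])
    have TD': "\<And>v. T (adj D v) = adj C (T v)" using D' unfolding intertwines_def by auto
    have DE: "D (E \<Delta> u) = E \<Delta> (D u)" if "\<Delta> \<in> sets borel" for \<Delta> u
    proof (rule commutes_E[OF Db _ _ that])
      show "D (Z u) = Z (D u)" for u by (rule injD[OF inj_T]) (simp add: TD TZ C(2))
      show "adj D (Z u) = Z (adj D u)" for u by (rule injD[OF inj_T]) (simp add: TD' TZ C')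
    qed
    have "C (T (RInt g h (adj T x))) = T (RInt g h (D (adj T x)))"
      by (simp only: TD[symmetric] RInt_commute[OF Db DE intertwiner_commutes_Q[OF C D] g])
    also have "D (adj T x) = adj T (C x)" by (rule intertwines_adj_T[OF T inj_T D commutes_TT[OF C]])
    finally show ?thesis
      unfolding Op_def by (simp add: bounded_clinear_add[OF C(1)] commutes_poly[OF C])
  qed
  then show ?thesis
    unfolding commutant_def[of "commutant {N, adj N}"] using Op_clinear[OF g] by (auto simp: fun_eq_iff)
qed

text \<open>Operations on functions pass to decompositions, where they become operations on \<open>Op\<close>.\<close>

lemma fun_calc_homomorphism:
  defines "F \<equiv> F_class p q S" and "\<Phi> \<equiv> fun_calc N p q T R1 R2 E"
  shows "\<phi> \<in> F \<Longrightarrow> \<Phi> \<phi> \<in> commutant (commutant {N, adj N})"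
    and "\<phi> \<in> F \<Longrightarrow> \<psi> \<in> F \<Longrightarrow> fadd \<phi> \<psi> \<in> F \<and> \<Phi> (fadd \<phi> \<psi>) = (\<lambda>x. \<Phi> \<phi> x + \<Phi> \<psi> x)"
    and "\<phi> \<in> F \<Longrightarrow> fscale c \<phi> \<in> F \<and> \<Phi> (fscale c \<phi>) = (\<lambda>x. c *\<^sub>C \<Phi> \<phi> x)"
    and "\<phi> \<in> F \<Longrightarrow> \<psi> \<in> F \<Longrightarrow> fmult p q \<phi> \<psi> \<in> F \<and> \<Phi> (fmult p q \<phi> \<psi>) = \<Phi> \<phi> \<circ> \<Phi> \<psi>"
    and "\<phi> \<in> F \<Longrightarrow> fsharp \<phi> \<in> F \<and> \<Phi> (fsharp \<phi>) = adj (\<Phi> \<phi>)"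
    and "poly_fun p q S s \<in> F \<and> \<Phi> (poly_fun p q S s) = op_poly2 s A B"
proof -
  have calc: "\<phi> \<in> F \<and> \<Phi> \<phi> = Op s g h" if "admissible p q S \<phi> s g h" for \<phi> s g h
    using fun_calc_eq[OF that] F_class_if_admissible[OF that] unfolding F_def \<Phi>_def by blast
  have dec: "\<exists>s g h. admissible p q S \<phi> s g h" if "\<phi> \<in> F" for \<phi>
    using admissible_if_F_class that unfolding F_def by blast
  show "poly_fun p q S s \<in> F \<and> \<Phi> (poly_fun p q S s) = op_poly2 s A B"
    using calc[OF admissible_poly] unfolding Op_poly .
  assume "\<phi> \<in> F"
  then obtain s g h where a: "admissible p q S \<phi> s g h" using dec by blast
  note g = symbol_admissible[OF a]
  have \<phi>: "\<Phi> \<phi> = Op s g h" using calc[OF a] by blast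
  show "\<Phi> \<phi> \<in> commutant (commutant {N, adj N})" unfolding \<phi> by (rule Op_bicommutant[OF g])
  show "fscale c \<phi> \<in> F \<and> \<Phi> (fscale c \<phi>) = (\<lambda>x. c *\<^sub>C \<Phi> \<phi> x)"
    using calc[OF admissible_scale[OF a]] unfolding \<phi> Op_scale[OF g] .
  show "fsharp \<phi> \<in> F \<and> \<Phi> (fsharp \<phi>) = adj (\<Phi> \<phi>)"
    using calc[OF admissible_sharp[OF a]] unfolding \<phi> Op_sharp[OF g] .
  assume "\<psi> \<in> F"
  then obtain t g' h' where b: "admissible p q S \<psi> t g' h'" using dec by blast
  note g' = symbol_admissible[OF b]
  have \<psi>: "\<Phi> \<psi> = Op t g' h'" using calc[OF b] by blast
  show "fadd \<phi> \<psi> \<in> F \<and> \<Phi> (fadd \<phi> \<psi>) = (\<lambda>x. \<Phi> \<phi> x + \<Phi> \<psi> x)"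
    using calc[OF admissible_add[OF a b]] unfolding \<phi> \<psi> Op_add[OF g g'] .
  show "fmult p q \<phi> \<psi> \<in> F \<and> \<Phi> (fmult p q \<phi> \<psi>) = \<Phi> \<phi> \<circ> \<Phi> \<psi>"
    using calc[OF admissible_mult[OF a b]] unfolding \<phi> \<psi> Op_mult[OF g g'] .
qed

end

theorem theorem5p4:
  fixes N :: "'k::krein_space \<Rightarrow> 'k"
    and p q :: "real poly"
    and T1 :: "'v1::chilbert_space \<Rightarrow> 'k"
    and T2 :: "'v2::chilbert_space \<Rightarrow> 'k"
    and T :: "'v::chilbert_space \<Rightarrow> 'k"
    and R1 :: "'v1 \<Rightarrow> 'v"
    and R2 :: "'v2 \<Rightarrow> 'v"
    and E :: "complex set \<Rightarrow> 'v \<Rightarrow> 'v"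
  assumes "bounded_clinear N" and "normal_op N" and "definitizing N p q"
    and "bounded_clinear T1" and "inj T1" and "T1 \<circ> adj T1 = op_poly p (re_part N)"
    and "bounded_clinear T2" and "inj T2" and "T2 \<circ> adj T2 = op_poly q (im_part N)"
    and "bounded_clinear T" and "inj T"
    and "T \<circ> adj T = (\<lambda>x. op_poly p (re_part N) x + op_poly q (im_part N) x)"
    and "bounded_clinear R1" and "inj R1" and "\<And>x. norm (R1 x) \<le> norm x" and "T1 = T \<circ> R1"
    and "bounded_clinear R2" and "inj R2" and "\<And>x. norm (R2 x) \<le> norm x" and "T2 = T \<circ> R2"
    and "spectral_measure_of (Theta T N) E"
  shows "let F = F_class p q (spectrum (Theta T N));
             \<Phi> = fun_calc N p q T R1 R2 E;
             s\<^sub>N = poly_fun p q (spectrum (Theta T N))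
         in (\<forall>\<phi>\<in>F. \<Phi> \<phi> \<in> commutant (commutant {N, adj N})) \<and>
            (\<forall>\<phi>\<in>F. \<forall>\<psi>\<in>F. fadd \<phi> \<psi> \<in> F \<and> \<Phi> (fadd \<phi> \<psi>) = (\<lambda>x. \<Phi> \<phi> x + \<Phi> \<psi> x)) \<and>
            (\<forall>c. \<forall>\<phi>\<in>F. fscale c \<phi> \<in> F \<and> \<Phi> (fscale c \<phi>) = (\<lambda>x. c *\<^sub>C \<Phi> \<phi> x)) \<and>
            (\<forall>\<phi>\<in>F. \<forall>\<psi>\<in>F. fmult p q \<phi> \<psi> \<in> F \<and> \<Phi> (fmult p q \<phi> \<psi>) = \<Phi> \<phi> \<circ> \<Phi> \<psi>) \<and>
            (\<forall>\<phi>\<in>F. fsharp \<phi> \<in> F \<and> \<Phi> (fsharp \<phi>) = adj (\<Phi> \<phi>)) \<and>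
            (\<forall>s. s\<^sub>N s \<in> F \<and> \<Phi> (s\<^sub>N s) = op_poly2 s (re_part N) (im_part N))"
proof -
  have adj_T1: "adj (T \<circ> R1) = adj R1 \<circ> adj T" by (rule adj_comp[OF assms(10,13)])
  have adj_T2: "adj (T \<circ> R2) = adj R2 \<circ> adj T" by (rule adj_comp[OF assms(10,17)])
  interpret definitizable_normal E N p q T R1 R2
  proof
    show "projection_valued_measure E" using assms(21) unfolding spectral_measure_of_def by blast
    show "N (adj N x) = adj N (N x)" for x using assms(2) unfolding normal_op_def by (auto simp: fun_eq_iff)
    show "p \<noteq> 0" "q \<noteq> 0" using assms(3) unfolding definitizing_def by auto
    show "T (adj T x) = op_poly p (re_part N) x + op_poly q (im_part N) x" for x
      using fun_cong[OF assms(12), of x] by simp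
    show "T (R1 (adj R1 (adj T x))) = op_poly p (re_part N) x" for x
      using fun_cong[OF assms(6), of x] by (simp add: assms(16) adj_T1)
    show "T (R2 (adj R2 (adj T x))) = op_poly q (im_part N) x" for x
      using fun_cong[OF assms(9), of x] by (simp add: assms(20) adj_T2)
  qed (fact assms)+
  have "spectrum (Theta T N) = S" unfolding S_def Z_def ..
  then show ?thesis
    unfolding Let_def by (simp only:) (intro conjI; intro ballI allI; rule fun_calc_homomorphism; assumption)
qed

end
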